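(* Let $\mathcal M$ be a von Neumann algebra with a normal faithful finite trace $\tau$, let $\mathcal T=(T_t)_{t\ge 0}$ be a quantum Markov semigroup on $\mathcal M$, and let $\mathcal P=(P_t)_{t\ge0}$ be the Poisson semigroup subordinated to $(T_t)_{t\ge0}$. (i) For any $0<\alpha<2$, one has $\mathcal L^c_\alpha(\mathcal P)=\mathcal L^r_\alpha(\mathcal P)=\mathcal L^{cr}_\alpha(\mathcal P)$ with equivalent norms. (ii) For any $0<\alpha<\frac12$, if $(T_t)_{t\ge0}$ satisfies $\Gamma^2\ge0$, then $\ell^c_\alpha(\mathcal P)=\ell^r_\alpha(\mathcal P)=\ell^{cr}_\alpha(\mathcal P)$ with equivalent norms.
   Context: Notation: $\|\cdot\|_\infty$ is the operator norm of $\mathcal M$, $|x|^2=x^*x$, $I$ is the identity operator, and $[\alpha]$ is the integer part of $\alpha$. A (quantum) Markov semigroup on $(\mathcal M,\tau)$ is a family $(T_t)_{t\ge0}$ of operators on $\mathcal M$ with $T_tT_s=T_{t+s}$, $T_0=\mathrm{id}$, such that every $T_t$ is normal, completely positive and unital ($T_t(1)=1$); $\tau(T_t(f^* )g)=\tau(f^*T_t(g))$ for all $f,g\in\mathcal M\cap L^2(\mathcal M)$; and $T_t(f)\to f$ in the weak-$*$ topology as $t\to0^+$ for all $f\in\mathcal M$. Its generator is $A=\lim_{t\to0}\frac{\mathrm{id}-T_t}{t}$, so $T_t=e^{-tA}$, with weak-$*$ domain $\mathrm{dom}_\infty(A)=\{f\in\mathcal M:\lim_{t\to0}\frac{f-T_tf}{t}\text{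 exists weak-}*\}$. By convention $T_sf\in\mathrm{dom}_\infty(A)$ for every $s>0$, $f\in\mathcal M$. The subordinated Poisson semigroup is $P_t=e^{-t\sqrt A}$, i.e. $P_0=\mathrm{id}$ and $P_t=\frac{1}{2\sqrt\pi}\int_0^\infty t e^{-t^2/(4u)}u^{-3/2}T_u\,du$ for $t>0$. Campanato spaces ($\alpha>0$): for $f\in\mathcal M$ put $\|f\|_{\mathcal L^c_\alpha(\mathcal P)}=\|f\|_\infty+\sup_{t>0}\frac1{t^\alpha}\big\|P_t|(I-P_t)^{[\alpha]+1}f|^2\big\|_\infty^{1/2}$, $\|f\|_{\mathcal L^r_\alpha(\mathcal P)}=\|f^*\|_{\mathcal L^c_\alpha(\mathcal P)}$. The spaces $\mathcal L^c_\alpha(\mathcal P)$, $\mathcal L^r_\alpha(\mathcal P)$ consist of all $f\in\mathcal M$ with finite corresponding norm, and $\mathcal L^{cr}_\alpha(\mathcal P)=\mathcal L^c_\alpha(\mathcal P)\cap\mathcal L^r_\alpha(\mathcal P)$ with the intersection norm (maximum of the two norms). Little Campanato spaces ($0<\alpha<1$): $\|f\|_{\ell^c_\alpha(\mathcal P)}=\|f\|_\infty+\sup_{t>0}\frac1{t^\alpha}\big\|P_t|f|^2-|P_tf|^2\big\|_\infty^{1/2}$, $\|f\|_{\ell^r_\alpha(\mathcal P)}=\|f^*\|_{\ell^c_\alpha(\mathcal P)}$, $\|f\|_{\ell^{cr}_\alpha(\mathcal P)}=\max\{\|f\|_{\ell^c_\alpha(\mathcal P)},\|f\|_{\ell^r_\alpha(\mathcal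 P)}\}$; the spaces consist of the $f\in\mathcal M$ with finite norm. The condition $\Gamma^2\ge0$: the gradient form is $2\Gamma(f,g)=(Af^* )g+f^*(Ag)-A(f^*g)$, $\Gamma(f)=\Gamma(f,f)$, and the iterated form is $2\Gamma^2(f,g)=\Gamma(Af,g)+\Gamma(f,Ag)-A\Gamma(f,g)$. "$\Gamma^2\ge0$" means $\Gamma^2(f,f)\ge0$ for all nice $f$, equivalently (and this is the precise form to be used) $T_r\Gamma(T_{s+t}f)\le T_{r+t}\Gamma(T_sf)$ for all $r,s,t>0$ and $f\in\mathcal M$, where $2T_u\Gamma(T_vf)$ is read as $T_u((AT_vf^* )(T_vf))+T_u((T_vf^* )(AT_vf))-AT_u((T_vf^* )(T_vf))$. *)

theory Defs
  imports "HOL-Analysis.Analysis"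
begin

section \<open>Complex Hilbert spaces and their operators\<close>

text \<open>The inner product is linear in the second argument. Completeness comes from \<^class>\<open>banach\<close>.\<close>

class chilbert_space = banach +
  fixes scaleC :: "complex \<Rightarrow> 'a \<Rightarrow> 'a"  (infixr "*\<^sub>C" 75)
    and cinner :: "'a \<Rightarrow> 'a \<Rightarrow> complex"
  assumes scaleC_add_right: "c *\<^sub>C (x + y) = c *\<^sub>C x + c *\<^sub>C y"
    and scaleC_add_left: "(c + d) *\<^sub>C x = c *\<^sub>C x + d *\<^sub>C x"
    and scaleC_scaleC: "c *\<^sub>C d *\<^sub>C x = (c * d) *\<^sub>C x"
    and scaleC_of_real: "complex_of_real r *\<^sub>C x = r *\<^sub>R x"
    and cinner_commute: "cinner x y = cnj (cinner y x)"
    and cinner_add_right: "cinner x (y + z) = cinner x y + cinner x z"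
    and cinner_scaleC_right: "cinner x (c *\<^sub>C y) = c * cinner x y"
    and cinner_self: "cinner x x = complex_of_real ((norm x)\<^sup>2)"
begin

lemma norm_scaleC: "norm (c *\<^sub>C x) = cmod c * norm x"
proof -
  have "cinner (c *\<^sub>C x) (c *\<^sub>C x) = c * cinner (c *\<^sub>C x) x"
    by (rule cinner_scaleC_right)
  also have "cinner (c *\<^sub>C x) x = cnj c * cinner x x"
    by (metis cinner_commute cinner_scaleC_right complex_cnj_mult)
  finally have "complex_of_real ((norm (c *\<^sub>C x))\<^sup>2) = (c * cnj c) * complex_of_real ((norm x)\<^sup>2)"
    by (simp only: cinner_self mult.assoc)
  also have "\<dots> = complex_of_real ((cmod c * norm x)\<^sup>2)"
    by (simp only: complex_norm_square[symmetric] of_real_mult[symmetric] power_mult_distrib)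
  finally have "complex_of_real ((norm (c *\<^sub>C x))\<^sup>2) = complex_of_real ((cmod c * norm x)\<^sup>2)" .
  then have "(norm (c *\<^sub>C x))\<^sup>2 = (cmod c * norm x)\<^sup>2"
    by (simp only: of_real_eq_iff)
  then show ?thesis
    by (simp add: power2_eq_iff_nonneg)
qed

end

type_synonym 'h op = "'h \<Rightarrow>\<^sub>L 'h"

text \<open>
  The type \<^typ>\<open>'h op\<close> consists of the bounded \<^emph>\<open>real\<close>-linear operators (it provides the operator
  norm and the composition); \<open>bounded_ops\<close> below is the algebra \<open>B(H)\<close> inside it.
\<close>

definition bounded_ops :: "'h::chilbert_space op set" where
  "bounded_ops = {x. \<forall>c \<xi>. blinfun_apply x (c *\<^sub>C \<xi>) = c *\<^sub>C blinfun_apply x \<xi>}"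

definition scale_op :: "complex \<Rightarrow> 'h::chilbert_space op \<Rightarrow> 'h op" where
  "scale_op c x = Blinfun (\<lambda>\<xi>. c *\<^sub>C blinfun_apply x \<xi>)"

lemma scale_op_apply: "blinfun_apply (scale_op c x) \<xi> = c *\<^sub>C blinfun_apply x \<xi>"
proof -
  have scaleR: "c *\<^sub>C (r *\<^sub>R \<eta>) = r *\<^sub>R (c *\<^sub>C \<eta>)" for r and \<eta> :: 'a
    by (simp add: scaleC_scaleC mult.commute flip: scaleC_of_real)
  have "bounded_linear (\<lambda>\<xi>. c *\<^sub>C blinfun_apply x \<xi>)"
  proof (rule bounded_linear_intro)
    show "norm (c *\<^sub>C blinfun_apply x \<xi>) \<le> norm \<xi> * (cmod c * norm x)" for \<xi>
      using mult_left_mono[OF norm_blinfun[of x \<xi>], of "cmod c"]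
      by (simp add: norm_scaleC ac_simps)
  qed (simp_all add: blinfun.add_right blinfun.scaleR_right scaleC_add_right scaleR)
  then show ?thesis
    by (simp add: scale_op_def bounded_linear_Blinfun_apply)
qed

definition is_adjoint :: "'h::chilbert_space op \<Rightarrow> 'h op \<Rightarrow> bool" where
  "is_adjoint x y \<longleftrightarrow>
     (\<forall>\<xi> \<eta>. cinner (blinfun_apply x \<xi>) \<eta> = cinner \<xi> (blinfun_apply y \<eta>))"

definition adj :: "'h::chilbert_space op \<Rightarrow> 'h op" where
  "adj x = (THE y. is_adjoint x y)"

lemma cinner_eqI:
  fixes \<eta> \<zeta> :: "'h::chilbert_space"
  assumes "\<And>\<xi>. cinner \<xi> \<eta> = cinner \<xi> \<zeta>"
  shows "\<eta> = \<zeta>"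
proof -
  have "cinner (\<eta> - \<zeta>) (\<eta> - \<zeta>) + cinner (\<eta> - \<zeta>) \<zeta> = cinner (\<eta> - \<zeta>) \<eta>"
    by (metis cinner_add_right diff_add_cancel)
  then have "complex_of_real ((norm (\<eta> - \<zeta>))\<^sup>2) = 0"
    using assms[of "\<eta> - \<zeta>"] by (simp add: cinner_self)
  then show ?thesis
    by simp
qed

lemma adj_eqI: "is_adjoint x y \<Longrightarrow> adj x = y"
  unfolding adj_def
proof (rule the_equality)
  fix z assume "is_adjoint x y" "is_adjoint x z"
  then show "z = y"
    by (intro blinfun_eqI cinner_eqI) (metis is_adjoint_def)
qed

abbreviation abs_sq :: "'h::chilbert_space op \<Rightarrow> 'h op" where
  "abs_sq x \<equiv> adj x o\<^sub>L x"

definition positive_op :: "'h::chilbert_space op \<Rightarrow> bool" where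
  "positive_op x \<longleftrightarrow> x \<in> bounded_ops \<and> (\<forall>\<xi>. cinner \<xi> (blinfun_apply x \<xi>) \<in> \<real>\<^sub>\<ge>\<^sub>0)"

definition op_le :: "'h::chilbert_space op \<Rightarrow> 'h op \<Rightarrow> bool" where
  "op_le x y \<longleftrightarrow> positive_op (y - x)"


section \<open>Von Neumann algebras, the weak-* topology, traces\<close>

definition commutant :: "'h::chilbert_space op set \<Rightarrow> 'h op set" where
  "commutant S = {y \<in> bounded_ops. \<forall>x\<in>S. x o\<^sub>L y = y o\<^sub>L x}"

definition von_neumann_algebra :: "'h::chilbert_space op set \<Rightarrow> bool" where
  "von_neumann_algebra M \<longleftrightarrow>
     M \<subseteq> bounded_ops \<and>
     (\<forall>x\<in>M. \<exists>y\<in>M. is_adjoint x y) \<and>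
     commutant (commutant M) = M"

definition normal_functionals :: "('h::chilbert_space op \<Rightarrow> complex) set" where
  "normal_functionals =
     {\<phi>. \<exists>\<xi> \<eta> :: nat \<Rightarrow> 'h.
        summable (\<lambda>n. (norm (\<xi> n))\<^sup>2) \<and> summable (\<lambda>n. (norm (\<eta> n))\<^sup>2) \<and>
        \<phi> = (\<lambda>x. \<Sum>n. cinner (\<xi> n) (blinfun_apply x (\<eta> n)))}"

text \<open>
  The weak-* topology of a von Neumann algebra is its ultraweak (sigma-weak) topology, and a
  (linear) map is normal iff it is continuous for it.
\<close>

definition weak_star :: "'h::chilbert_space op set \<Rightarrow> 'h op topology" where
  "weak_star M =
     subtopology
       (topology_generated_by {{x. \<phi> x \<in> U} | \<phi> U. \<phi> \<in> normal_functionals \<and> open U}) M"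

definition nff_trace :: "'h::chilbert_space op set \<Rightarrow> ('h op \<Rightarrow> complex) \<Rightarrow> bool" where
  "nff_trace M \<tau> \<longleftrightarrow>
     (\<forall>x\<in>M. \<forall>y\<in>M. \<tau> (x + y) = \<tau> x + \<tau> y) \<and>
     (\<forall>c. \<forall>x\<in>M. \<tau> (scale_op c x) = c * \<tau> x) \<and>
     (\<forall>x\<in>M. positive_op x \<longrightarrow> \<tau> x \<in> \<real>\<^sub>\<ge>\<^sub>0) \<and>
     (\<forall>x\<in>M. \<forall>y\<in>M. \<tau> (x o\<^sub>L y) = \<tau> (y o\<^sub>L x)) \<and>
     (\<forall>x\<in>M. positive_op x \<and> \<tau> x = 0 \<longrightarrow> x = 0) \<and>
     continuous_map (weak_star M) euclidean \<tau>"


section \<open>Quantum Markov semigroups\<close>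

definition linear_map_on ::
    "'h::chilbert_space op set \<Rightarrow> ('h op \<Rightarrow> 'h op) \<Rightarrow> bool" where
  "linear_map_on M S \<longleftrightarrow>
     (\<forall>x\<in>M. S x \<in> M) \<and>
     (\<forall>x\<in>M. \<forall>y\<in>M. S (x + y) = S x + S y) \<and>
     (\<forall>c. \<forall>x\<in>M. S (scale_op c x) = scale_op c (S x))"

text \<open>An \<open>n \<times> n\<close> matrix of operators is identified with an operator on the direct sum of \<open>n\<close> copies
  of the Hilbert space.\<close>

definition positive_op_matrix :: "nat \<Rightarrow> (nat \<Rightarrow> nat \<Rightarrow> 'h::chilbert_space op) \<Rightarrow> bool" where
  "positive_op_matrix n x \<longleftrightarrow>
     (\<forall>\<xi> :: nat \<Rightarrow> 'h. (\<Sum>i<n. \<Sum>j<n. cinner (\<xi> i) (blinfun_apply (x i j) (\<xi> j))) \<in> \<real>\<^sub>\<ge>\<^sub>0)"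

definition completely_positive_on ::
    "'h::chilbert_space op set \<Rightarrow> ('h op \<Rightarrow> 'h op) \<Rightarrow> bool" where
  "completely_positive_on M S \<longleftrightarrow>
     (\<forall>n x. (\<forall>i<n. \<forall>j<n. x i j \<in> M) \<and> positive_op_matrix n x
        \<longrightarrow> positive_op_matrix n (\<lambda>i j. S (x i j)))"

text \<open>As the trace is finite, \<open>M \<inter> L\<^sup>2(M) = M\<close> in the symmetry condition.\<close>

definition markov_semigroup ::
    "'h::chilbert_space op set \<Rightarrow> ('h op \<Rightarrow> complex) \<Rightarrow> (real \<Rightarrow> 'h op \<Rightarrow> 'h op) \<Rightarrow> bool" where
  "markov_semigroup M \<tau> T \<longleftrightarrow>
     (\<forall>t\<ge>0. linear_map_on M (T t)) \<and>
     (\<forall>t\<ge>0. \<forall>s\<ge>0. \<forall>f\<in>M. T t (T s f) = T (t + s) f) \<and>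
     (\<forall>f\<in>M. T 0 f = f) \<and>
     (\<forall>t\<ge>0. continuous_map (weak_star M) (weak_star M) (T t)) \<and>
     (\<forall>t\<ge>0. completely_positive_on M (T t)) \<and>
     (\<forall>t\<ge>0. T t id_blinfun = id_blinfun) \<and>
     (\<forall>t\<ge>0. \<forall>f\<in>M. \<forall>g\<in>M. \<tau> (T t (adj f) o\<^sub>L g) = \<tau> (adj f o\<^sub>L T t g)) \<and>
     (\<forall>f\<in>M. limitin (weak_star M) (\<lambda>t. T t f) f (at_right 0))"

definition is_generator_value ::
    "'h::chilbert_space op set \<Rightarrow> (real \<Rightarrow> 'h op \<Rightarrow> 'h op) \<Rightarrow> 'h op \<Rightarrow> 'h op \<Rightarrow> bool" where
  "is_generator_value M T f y \<longleftrightarrow>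
     limitin (weak_star M) (\<lambda>t. (1 / t) *\<^sub>R (f - T t f)) y (at_right 0)"

definition gen_dom ::
    "'h::chilbert_space op set \<Rightarrow> (real \<Rightarrow> 'h op \<Rightarrow> 'h op) \<Rightarrow> 'h op set" where
  "gen_dom M T = {f \<in> M. \<exists>y. is_generator_value M T f y}"

definition generator ::
    "'h::chilbert_space op set \<Rightarrow> (real \<Rightarrow> 'h op \<Rightarrow> 'h op) \<Rightarrow> 'h op \<Rightarrow> 'h op" where
  "generator M T f = (THE y. is_generator_value M T f y)"

definition poisson_kernel :: "real \<Rightarrow> real \<Rightarrow> real" where
  "poisson_kernel t u = 1 / (2 * sqrt pi) * t * exp (- t\<^sup>2 / (4 * u)) * u powr (-3/2)"

text \<open>The subordination integral is taken in the weak-* sense, i.e. against normal functionals.\<close>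

definition is_poisson_value ::
    "'h::chilbert_space op set \<Rightarrow> (real \<Rightarrow> 'h op \<Rightarrow> 'h op) \<Rightarrow> real \<Rightarrow> 'h op \<Rightarrow> 'h op \<Rightarrow> bool" where
  "is_poisson_value M T t f y \<longleftrightarrow>
     y \<in> M \<and>
     (\<forall>\<phi>\<in>normal_functionals.
        set_integrable lborel {0<..} (\<lambda>u. complex_of_real (poisson_kernel t u) * \<phi> (T u f)) \<and>
        \<phi> y = (LINT u:{0<..}|lborel. complex_of_real (poisson_kernel t u) * \<phi> (T u f)))"

definition poisson_semigroup ::
    "'h::chilbert_space op set \<Rightarrow> (real \<Rightarrow> 'h op \<Rightarrow> 'h op) \<Rightarrow> real \<Rightarrow> 'h op \<Rightarrow> 'h op" where
  "poisson_semigroup M T t f = (if t = 0 then f else (THE y. is_poisson_value M T t f y))"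

text \<open>\<open>gamma_form M T u v f\<close> is the operator written \<open>T\<^sub>u \<Gamma>(T\<^sub>v f)\<close>.\<close>

definition gamma_form ::
    "'h::chilbert_space op set \<Rightarrow> (real \<Rightarrow> 'h op \<Rightarrow> 'h op) \<Rightarrow> real \<Rightarrow> real \<Rightarrow> 'h op \<Rightarrow> 'h op" where
  "gamma_form M T u v f =
     (1 / 2) *\<^sub>R
       (T u (generator M T (T v (adj f)) o\<^sub>L T v f)
        + T u (T v (adj f) o\<^sub>L generator M T (T v f))
        - generator M T (T u (T v (adj f) o\<^sub>L T v f)))"

definition gamma2_nonneg ::
    "'h::chilbert_space op set \<Rightarrow> (real \<Rightarrow> 'h op \<Rightarrow> 'h op) \<Rightarrow> bool" where
  "gamma2_nonneg M T \<longleftrightarrow>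
     (\<forall>r>0. \<forall>s>0. \<forall>t>0. \<forall>f\<in>M.
        op_le (gamma_form M T r (s + t) f) (gamma_form M T (r + t) s f))"


section \<open>Campanato spaces\<close>

text \<open>The norms below take the value \<open>\<infinity>\<close> outside the corresponding spaces; \<open>P\<close> is the semigroup.\<close>

definition campanato_norm_c ::
    "real \<Rightarrow> (real \<Rightarrow> 'h::chilbert_space op \<Rightarrow> 'h op) \<Rightarrow> 'h op \<Rightarrow> ennreal" where
  "campanato_norm_c \<alpha> P f =
     ennreal (norm f) +
     (SUP t\<in>{0<..}. ennreal (1 / t powr \<alpha> *
        sqrt (norm (P t (abs_sq (((\<lambda>g. g - P t g) ^^ (nat \<lfloor>\<alpha>\<rfloor> + 1)) f))))))"

definition campanato_norm_r ::
    "real \<Rightarrow> (real \<Rightarrow> 'h::chilbert_space op \<Rightarrow> 'h op) \<Rightarrow> 'h op \<Rightarrow> ennreal" where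
  "campanato_norm_r \<alpha> P f = campanato_norm_c \<alpha> P (adj f)"

definition campanato_norm_cr ::
    "real \<Rightarrow> (real \<Rightarrow> 'h::chilbert_space op \<Rightarrow> 'h op) \<Rightarrow> 'h op \<Rightarrow> ennreal" where
  "campanato_norm_cr \<alpha> P f = max (campanato_norm_c \<alpha> P f) (campanato_norm_r \<alpha> P f)"

definition campanato_c ::
    "'h::chilbert_space op set \<Rightarrow> real \<Rightarrow> (real \<Rightarrow> 'h op \<Rightarrow> 'h op) \<Rightarrow> 'h op set" where
  "campanato_c M \<alpha> P = {f \<in> M. campanato_norm_c \<alpha> P f < \<infinity>}"

definition campanato_r ::
    "'h::chilbert_space op set \<Rightarrow> real \<Rightarrow> (real \<Rightarrow> 'h op \<Rightarrow> 'h op) \<Rightarrow> 'h op set" where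
  "campanato_r M \<alpha> P = {f \<in> M. campanato_norm_r \<alpha> P f < \<infinity>}"

definition campanato_cr ::
    "'h::chilbert_space op set \<Rightarrow> real \<Rightarrow> (real \<Rightarrow> 'h op \<Rightarrow> 'h op) \<Rightarrow> 'h op set" where
  "campanato_cr M \<alpha> P = campanato_c M \<alpha> P \<inter> campanato_r M \<alpha> P"

definition little_norm_c ::
    "real \<Rightarrow> (real \<Rightarrow> 'h::chilbert_space op \<Rightarrow> 'h op) \<Rightarrow> 'h op \<Rightarrow> ennreal" where
  "little_norm_c \<alpha> P f =
     ennreal (norm f) +
     (SUP t\<in>{0<..}. ennreal (1 / t powr \<alpha> *
        sqrt (norm (P t (abs_sq f) - abs_sq (P t f)))))"

definition little_norm_r ::
    "real \<Rightarrow> (real \<Rightarrow> 'h::chilbert_space op \<Rightarrow> 'h op) \<Rightarrow> 'h op \<Rightarrow> ennreal" where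
  "little_norm_r \<alpha> P f = little_norm_c \<alpha> P (adj f)"

definition little_norm_cr ::
    "real \<Rightarrow> (real \<Rightarrow> 'h::chilbert_space op \<Rightarrow> 'h op) \<Rightarrow> 'h op \<Rightarrow> ennreal" where
  "little_norm_cr \<alpha> P f = max (little_norm_c \<alpha> P f) (little_norm_r \<alpha> P f)"

definition little_campanato_c ::
    "'h::chilbert_space op set \<Rightarrow> real \<Rightarrow> (real \<Rightarrow> 'h op \<Rightarrow> 'h op) \<Rightarrow> 'h op set" where
  "little_campanato_c M \<alpha> P = {f \<in> M. little_norm_c \<alpha> P f < \<infinity>}"

definition little_campanato_r ::
    "'h::chilbert_space op set \<Rightarrow> real \<Rightarrow> (real \<Rightarrow> 'h op \<Rightarrow> 'h op) \<Rightarrow> 'h op set" where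
  "little_campanato_r M \<alpha> P = {f \<in> M. little_norm_r \<alpha> P f < \<infinity>}"

definition little_campanato_cr ::
    "'h::chilbert_space op set \<Rightarrow> real \<Rightarrow> (real \<Rightarrow> 'h op \<Rightarrow> 'h op) \<Rightarrow> 'h op set" where
  "little_campanato_cr M \<alpha> P = {f \<in> M. little_norm_cr \<alpha> P f < \<infinity>}"

definition equivalent_norms_on :: "'a set \<Rightarrow> ('a \<Rightarrow> ennreal) \<Rightarrow> ('a \<Rightarrow> ennreal) \<Rightarrow> bool" where
  "equivalent_norms_on X N1 N2 \<longleftrightarrow>
     (\<exists>C::real. C > 0 \<and> (\<forall>f\<in>X. N1 f \<le> ennreal C * N2 f \<and> N2 f \<le> ennreal C * N1 f))"

end

theory Submission
  imports Defs "HOL-Probability.Distributions" "HOL-Probability.Convolution"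
begin

text \<open>
  Each column norm turns out to be equivalent to a Lipschitz norm, which controls the operator norms
  \<open>\<parallel>(I - P\<^sub>t)\<^sup>k f\<parallel> \<le> L t\<^sup>\<alpha>\<close>. Both \<open>P\<^sub>t\<close> and the operator norm respect adjoints, so a Lipschitz
  bound for \<open>f\<close> is one for \<open>f\<^sup>*\<close>, and the row norm is dominated by the column norm. Since
  \<open>f\<^sup>*\<^sup>* = f\<close>, this one estimate yields the equality of all the spaces and all the equivalences
  (\<open>adjoint_comparison\<close>).

  For the Campanato norm (\<open>campanato_norm_adjoint\<close>), the Schwarz inequality
  \<open>\<bar>P\<^sub>t g\<bar>\<^sup>2 \<le> P\<^sub>t \<bar>g\<bar>\<^sup>2\<close> bounds \<open>P\<^sub>t (I - P\<^sub>t)\<^sup>k f\<close> by \<open>B t\<^sup>\<alpha>\<close>. To remove the outer \<open>P\<^sub>t\<close>, write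
  \<open>(I - P\<^sub>2\<^sub>s)\<^sup>k = (I + P\<^sub>s)\<^sup>k (I - P\<^sub>s)\<^sup>k\<close>: passing from the scale \<open>2 s\<close> to the scale \<open>s\<close> changes
  \<open>(I - P\<^sub>2\<^sub>s)\<^sup>k f\<close> only by terms that contain \<open>P\<^sub>s (I - P\<^sub>s)\<^sup>k f\<close>. These are summable along
  \<open>s = 2\<^sup>-\<^sup>j t\<close>, and \<open>(I - P\<^sub>s)\<^sup>k f\<close> tends weakly to zero (\<open>\<Delta>_power_norm_le\<close>).

  For the little norm, one direction (\<open>P_oscillation_le_variance\<close>) uses that the subordination
  density satisfies \<open>p\<^sub>2\<^sub>t \<le> 2 p\<^sub>t\<close>. Hence \<open>2 P\<^sub>t - P\<^sub>2\<^sub>t\<close> is again unital and completely positive, and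
  the variance \<open>P\<^sub>t \<bar>f\<bar>\<^sup>2 - \<bar>P\<^sub>t f\<bar>\<^sup>2\<close> dominates \<open>\<bar>P\<^sub>t f - P\<^sub>2\<^sub>t f\<bar>\<^sup>2\<close>. In the other direction
  (\<open>P_variance_le_lipschitz\<close>), the variance under \<open>P\<^sub>t\<close> is at most the second moment about \<open>f\<close>, that
  is, the average over \<open>u\<close> of
  \<open>D\<^sub>u(f) = T\<^sub>u \<bar>f\<bar>\<^sup>2 - f\<^sup>* T\<^sub>u f - (T\<^sub>u f)\<^sup>* f + \<bar>f\<bar>\<^sup>2\<close>
  with respect to the subordination law. A bound \<open>D\<^sub>u(f) \<le> C L\<^sup>2 u\<^sup>\<alpha>\<close> suffices, because that law has a
  moment of order \<open>\<alpha>\<close> exactly when \<open>\<alpha> < 1/2\<close>. The square root of \<open>D\<^sub>u\<close> is a seminorm, and it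
  satisfies \<open>D\<^sub>u(P\<^sub>v g)\<^sup>1\<^sup>/\<^sup>2 \<le> C (\<surd>u / v) \<parallel>g\<parallel>\<close>; decomposing \<open>f\<close> along the scales \<open>2\<^sup>j \<surd>u\<close> then gives
  the required bound from the Lipschitz condition.

  The smoothing estimate for \<open>D\<^sub>u\<close> has two halves. The displacement \<open>T\<^sub>u P\<^sub>v g - P\<^sub>v g\<close> is small because
  translating the subordination law by \<open>u\<close> costs \<open>O(u/v\<^sup>2)\<close> in total variation
  (\<open>subordinator_shift\<close>). The variance \<open>T\<^sub>u \<bar>P\<^sub>v g\<bar>\<^sup>2 - \<bar>T\<^sub>u P\<^sub>v g\<bar>\<^sup>2\<close> is where \<open>\<Gamma>\<^sup>2 \<ge> 0\<close> enters
  (\<open>gamma2_reverse_poincare\<close>): that condition says that the derivative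
  \<open>-2 T\<^sub>w\<^sub>-\<^sub>s \<Gamma>(T\<^sub>s g)\<close> of \<open>h(s) = T\<^sub>w\<^sub>-\<^sub>s \<bar>T\<^sub>s g\<bar>\<^sup>2\<close> increases, so \<open>h\<close> is convex and its decrease over
  \<open>[s, s + u]\<close> is controlled by its decrease over \<open>[s/2, s]\<close>.
\<close>

section \<open>Complex Hilbert spaces\<close>

lemma cinner_add_left: "cinner (x + y) z = cinner x z + cinner y z"
  for x :: "'h::chilbert_space"
  by (metis cinner_add_right cinner_commute complex_cnj_add)

lemma cinner_scaleC_left: "cinner (c *\<^sub>C x) z = cnj c * cinner x z"
  for x :: "'h::chilbert_space"
  by (metis cinner_commute cinner_scaleC_right complex_cnj_mult)

lemma cinner_scaleR_right: "cinner x (r *\<^sub>R y) = complex_of_real r * cinner x y"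
  for x :: "'h::chilbert_space"
  by (metis cinner_scaleC_right scaleC_of_real)

lemma cinner_scaleR_left: "cinner (r *\<^sub>R x) y = complex_of_real r * cinner x y"
  for x :: "'h::chilbert_space"
  by (metis cinner_scaleC_left scaleC_of_real complex_cnj_complex_of_real)

lemma cinner_minus_right: "cinner x (- y) = - cinner x y"
  for x :: "'h::chilbert_space"
  using cinner_scaleR_right[of x "-1" y] by simp

lemma cinner_minus_left: "cinner (- x) y = - cinner x y"
  for x :: "'h::chilbert_space"
  using cinner_scaleR_left[of "-1" x y] by simp

lemma cinner_diff_right: "cinner x (y - z) = cinner x y - cinner x z"
  for x :: "'h::chilbert_space"
  using cinner_add_right[of x y "-z"] cinner_minus_right[of x z] by simp

lemma cinner_diff_left: "cinner (x - y) z = cinner x z - cinner y z"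
  for x :: "'h::chilbert_space"
  using cinner_add_left[of x "-y" z] cinner_minus_left[of y z] by simp

lemma cinner_zero_right [simp]: "cinner x 0 = 0" for x :: "'h::chilbert_space"
  using cinner_scaleR_right[of x 0 0] by simp

lemma cinner_zero_left [simp]: "cinner 0 x = 0" for x :: "'h::chilbert_space"
  using cinner_scaleR_left[of 0 0 x] by simp

lemmas cinner_simps = cinner_add_left cinner_add_right cinner_diff_left cinner_diff_right
  cinner_minus_left cinner_minus_right cinner_scaleC_left cinner_scaleC_right
  cinner_scaleR_left cinner_scaleR_right

lemma Re_cinner_self: "Re (cinner x x) = (norm x)\<^sup>2" for x :: "'h::chilbert_space"
  by (simp add: cinner_self)

lemma Re_cinner_commute: "Re (cinner x y) = Re (cinner y x)" for x :: "'h::chilbert_space"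
  by (metis cinner_commute cnj.simps(1))

lemma norm_add_sq: "(norm (x + y))\<^sup>2 = (norm x)\<^sup>2 + 2 * Re (cinner x y) + (norm y)\<^sup>2"
  for x :: "'h::chilbert_space"
  unfolding Re_cinner_self[symmetric] using Re_cinner_commute[of x y] by (simp add: cinner_simps)

lemma norm_diff_sq: "(norm (x - y))\<^sup>2 = (norm x)\<^sup>2 - 2 * Re (cinner x y) + (norm y)\<^sup>2"
  for x :: "'h::chilbert_space"
  unfolding Re_cinner_self[symmetric] using Re_cinner_commute[of x y] by (simp add: cinner_simps)

lemma scaleC_scaleR: "c *\<^sub>C (r *\<^sub>R x) = r *\<^sub>R (c *\<^sub>C x)" for x :: "'h::chilbert_space"
  by (simp add: scaleC_scaleC mult.commute flip: scaleC_of_real)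

lemma scaleC_minus_right: "c *\<^sub>C (- x) = - (c *\<^sub>C x)" for x :: "'h::chilbert_space"
  using scaleC_scaleR[of c "-1" x] by simp

lemma scaleC_diff_right: "c *\<^sub>C (x - y) = c *\<^sub>C x - c *\<^sub>C y" for x :: "'h::chilbert_space"
  using scaleC_add_right[of c x "-y"] by (simp add: scaleC_minus_right)

text \<open>The common source of the Cauchy--Schwarz inequalities below, for the inner product as well as for
  the positive forms attached to positive operators and to completely positive maps.\<close>

lemma nonneg_quadratic_discriminant:
  fixes a b c :: real
  assumes "\<And>r. 0 \<le> a + r * b + r\<^sup>2 * c"
  shows "b\<^sup>2 \<le> 4 * a * c"
proof (cases "c = 0")
  case True
  have "b = 0"
  proof (rule ccontr)
    assume "b \<noteq> 0"
    then show False
      using assms[of "- (a + 1) / b"] True by (simp add: field_simps)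
  qed
  then show ?thesis using True by simp
next
  case False
  have "0 \<le> c"
  proof (rule ccontr)
    assume c: "\<not> 0 \<le> c"
    \<comment> \<open>For a negative leading coefficient the values at \<open>r\<close> and \<open>-r\<close> have a negative sum once
      \<open>r\<close> is large.\<close>
    define r where "r = (\<bar>a\<bar> + 1) / (- c) + 1"
    have "r \<ge> 1" using c by (simp add: r_def field_simps)
    have "a + c * r\<^sup>2 \<le> a + c * r"
      using c \<open>r \<ge> 1\<close> by (simp add: power2_eq_square mult_left_mono_neg)
    also have "\<dots> = a - \<bar>a\<bar> - 1 + c" using c by (simp add: r_def field_simps)
    also have "\<dots> < 0" using c by linarith
    finally have "a + c * r\<^sup>2 < 0" .
    then show False using assms[of r] assms[of "-r"] by (simp add: mult.commute)
  qed
  then have c: "0 < c" using False by simp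
  have "a + (- b / (2 * c)) * b + (- b / (2 * c))\<^sup>2 * c = a - b\<^sup>2 / (4 * c)"
    using c by (simp add: power2_eq_square field_simps)
  then have "b\<^sup>2 / (4 * c) \<le> a" using assms[of "- b / (2 * c)"] by linarith
  then show ?thesis using c by (simp add: field_simps)
qed

lemma Re_cinner_le_norm: "\<bar>Re (cinner x y)\<bar> \<le> norm x * norm y" for x :: "'h::chilbert_space"
proof -
  have "(2 * Re (cinner x y))\<^sup>2 \<le> 4 * (norm x)\<^sup>2 * (norm y)\<^sup>2"
  proof (rule nonneg_quadratic_discriminant)
    fix r :: real
    have "0 \<le> (norm (x + r *\<^sub>R y))\<^sup>2" by simp
    also have "\<dots> = (norm x)\<^sup>2 + r * (2 * Re (cinner x y)) + r\<^sup>2 * (norm y)\<^sup>2"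
      by (simp add: norm_add_sq cinner_simps power_mult_distrib)
    finally show "0 \<le> (norm x)\<^sup>2 + r * (2 * Re (cinner x y)) + r\<^sup>2 * (norm y)\<^sup>2" .
  qed
  then have "(Re (cinner x y))\<^sup>2 \<le> (norm x * norm y)\<^sup>2"
    by (simp add: power_mult_distrib)
  then show ?thesis
    by (simp add: abs_le_square_iff[symmetric])
qed

text \<open>Rotating a complex number onto the positive half-line reduces a bound for a modulus to a bound for a
  real part.\<close>

lemma unimodular_rotation: "\<exists>c. cmod c = 1 \<and> c * z = complex_of_real (cmod z)"
proof (cases "z = 0")
  case False
  then have "cnj z / cmod z * z = cmod z"
    by (metis complex_norm_square mult.commute nonzero_divide_eq_eq norm_eq_zero of_real_eq_0_iff
        of_real_power power2_eq_square times_divide_eq_left)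
  then show ?thesis using False by (intro exI[of _ "cnj z / cmod z"]) (simp add: norm_divide)
qed (auto intro: exI[of _ 1])

lemma cinner_le_norm: "cmod (cinner x y) \<le> norm x * norm y" for x :: "'h::chilbert_space"
proof -
  obtain c where c: "cmod c = 1" "c * cinner x y = complex_of_real (cmod (cinner x y))"
    using unimodular_rotation by blast
  then have "cmod (cinner x y) = Re (cinner x (c *\<^sub>C y))"
    by (simp add: cinner_simps)
  also have "\<dots> \<le> norm x * norm y"
    using Re_cinner_le_norm[of x "c *\<^sub>C y"] c by (simp add: norm_scaleC)
  finally show ?thesis .
qed

lemma bounded_bilinear_cinner:
  "bounded_bilinear (cinner :: 'h::chilbert_space \<Rightarrow> 'h \<Rightarrow> complex)"
  by standard (auto simp: cinner_simps scaleR_conv_of_real intro!: exI[of _ 1] cinner_le_norm)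

interpretation cinner: bounded_bilinear "cinner :: 'h::chilbert_space \<Rightarrow> 'h \<Rightarrow> complex"
  by (rule bounded_bilinear_cinner)

lemma norm_le_of_cinner:
  fixes x :: "'h::chilbert_space"
  assumes "0 \<le> C" and "\<And>y. cmod (cinner y x) \<le> C * norm y"
  shows "norm x \<le> C"
proof (cases "x = 0")
  case True
  then show ?thesis using assms by simp
next
  case False
  have "norm x * norm x \<le> C * norm x"
    using assms(2)[of x] by (simp add: cinner_self power2_eq_square norm_mult)
  then show ?thesis using False by simp
qed

text \<open>The representing vector minimises the functional \<open>\<parallel>\<zeta>\<parallel>\<^sup>2 - 2 Re (L \<zeta>)\<close>. The parallelogram law
  makes every minimising sequence Cauchy, and stationarity at the minimum is the representation.\<close>

theorem riesz_representation:
  fixes L :: "'h::chilbert_space \<Rightarrow> complex"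
  assumes add: "\<And>x y. L (x + y) = L x + L y"
    and scale: "\<And>c x. L (c *\<^sub>C x) = c * L x"
    and bound: "\<And>x. cmod (L x) \<le> C * norm x"
  obtains z where "\<And>x. L x = cinner z x"
proof -
  define J where "J x = (norm x)\<^sup>2 - 2 * Re (L x)" for x
  define m where "m = (INF x. J x)"
  have scaleR: "L (r *\<^sub>R x) = complex_of_real r * L x" for r x
    by (metis scale scaleC_of_real)
  have lower: "- C\<^sup>2 \<le> J x" for x
  proof -
    have "Re (L x) \<le> C * norm x" using bound[of x] complex_Re_le_cmod order_trans by blast
    then have "(norm x - C)\<^sup>2 - C\<^sup>2 \<le> J x" by (simp add: J_def power2_diff mult.commute)
    then show ?thesis using zero_le_power2[of "norm x - C"] by linarith
  qed
  have bdd: "bdd_below (range J)" by (rule bdd_belowI2) (rule lower)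
  have m_le: "m \<le> J x" for x unfolding m_def using bdd by (rule cINF_lower) simp
  have "\<exists>x. J x < m + 1 / real (Suc n)" for n
  proof -
    have "(INF x. J x) < m + 1 / real (Suc n)" by (simp add: m_def)
    then show ?thesis using bdd by (subst (asm) cINF_less_iff) auto
  qed
  then obtain X where X: "\<And>n. J (X n) < m + 1 / real (Suc n)" by metis
  have para: "(norm (x - y))\<^sup>2 \<le> 2 * (J x - m) + 2 * (J y - m)" for x y
  proof -
    have "4 * m \<le> 4 * J ((1/2) *\<^sub>R (x + y))" using m_le by simp
    also have "J ((1/2) *\<^sub>R (x + y)) = (norm (x + y))\<^sup>2 / 4 - Re (L x) - Re (L y)"
      by (simp only: J_def scaleR add norm_scaleR) (simp add: power_divide add_divide_distrib)
    also have "4 * \<dots> = (norm (x + y))\<^sup>2 - 4 * Re (L x) - 4 * Re (L y)" by simp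
    also have "\<dots> = 2 * J x + 2 * J y - (norm (x - y))\<^sup>2"
      by (simp add: J_def norm_add_sq norm_diff_sq)
    finally show ?thesis by simp
  qed
  have cauchy: "Cauchy X"
  proof (rule metric_CauchyI)
    fix e :: real assume "e > 0"
    then obtain N where N: "4 / e\<^sup>2 < real N" using reals_Archimedean2 by blast
    have "dist (X k) (X n) < e" if "k \<ge> N" "n \<ge> N" for k n
    proof -
      have "N > 0" using N \<open>e > 0\<close> by (metis divide_pos_pos of_nat_0_less_iff order_less_trans zero_less_numeral zero_less_power)
      have le: "1 / real (Suc j) \<le> 1 / real N" if "j \<ge> N" for j
        using that \<open>N > 0\<close> by (simp add: frac_le)
      have near: "J (X j) < m + 1 / real N" if "j \<ge> N" for j
        using X[of j] le[OF that] by (meson add_left_mono less_le_trans)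
      have "(norm (X k - X n))\<^sup>2 < 2 * (1 / real N) + 2 * (1 / real N)"
        using para[of "X k" "X n"] near[OF that(1)] near[OF that(2)] by argo
      also have "\<dots> = 4 / real N" by simp
      also have "\<dots> < e\<^sup>2" using N \<open>e > 0\<close> \<open>N > 0\<close> by (simp add: field_simps)
      finally show ?thesis using \<open>e > 0\<close> by (simp add: dist_norm power_less_imp_less_base)
    qed
    then show "\<exists>N. \<forall>k\<ge>N. \<forall>n\<ge>N. dist (X k) (X n) < e" by blast
  qed
  obtain z where z: "X \<longlonglongrightarrow> z" using cauchy Cauchy_convergent convergent_def by metis
  have "bounded_linear L"
    by (rule bounded_linear_intro[of L C]) (auto simp: add scaleR scaleR_conv_of_real bound mult.commute)
  then have L_lim: "(\<lambda>n. L (X n)) \<longlonglongrightarrow> L z" using z by (rule bounded_linear.tendsto)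
  have "J z \<le> m"
  proof (rule LIMSEQ_le)
    show "(\<lambda>n. J (X n)) \<longlonglongrightarrow> J z"
      unfolding J_def by (intro tendsto_intros z L_lim)
    have "(\<lambda>n. m + 1 / real (Suc n)) \<longlonglongrightarrow> m + 0"
      by (intro tendsto_intros LIMSEQ_inverse_real_of_nat[unfolded inverse_eq_divide])
    then show "(\<lambda>n. m + 1 / real (Suc n)) \<longlonglongrightarrow> m" by simp
  qed (use X less_imp_le in blast)
  have ReL: "Re (L x) = Re (cinner z x)" for x
  proof -
    have "(2 * Re (cinner z x) - 2 * Re (L x))\<^sup>2 \<le> 4 * (J z - m) * (norm x)\<^sup>2"
    proof (rule nonneg_quadratic_discriminant)
      fix r :: real
      have "0 \<le> J (z + r *\<^sub>R x) - m" using m_le by simp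
      then show "0 \<le> J z - m + r * (2 * Re (cinner z x) - 2 * Re (L x)) + r\<^sup>2 * (norm x)\<^sup>2"
        by (simp add: J_def norm_add_sq add scaleR cinner_simps power_mult_distrib algebra_simps)
    qed
    also have "\<dots> = 0" using \<open>J z \<le> m\<close> m_le[of z] by simp
    finally show ?thesis by simp
  qed
  have "L x = cinner z x" for x
    using ReL[of x] ReL[of "\<i> *\<^sub>C x"] by (intro complex_eqI) (simp_all add: scale cinner_simps)
  then show thesis by (rule that)
qed

section \<open>Normal functionals\<close>

lemma bounded_opsD: "x \<in> bounded_ops \<Longrightarrow> blinfun_apply x (c *\<^sub>C \<xi>) = c *\<^sub>C blinfun_apply x \<xi>"
  by (simp add: bounded_ops_def)

lemma is_adjoint_sym: "is_adjoint x y \<Longrightarrow> is_adjoint y x"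
  unfolding is_adjoint_def by (metis cinner_commute)

text \<open>The vectors \<open>\<xi>\<^sub>n\<close> and \<open>\<eta>\<^sub>n\<close> enter only through the trace-class bound \<open>\<Sum> \<parallel>\<xi>\<^sub>n\<parallel> \<parallel>\<eta>\<^sub>n\<parallel> < \<infinity>\<close>.\<close>

lemma normal_functional_summable:
  fixes \<xi> \<eta> :: "nat \<Rightarrow> 'h::chilbert_space"
  assumes "summable (\<lambda>n. (norm (\<xi> n))\<^sup>2)" and "summable (\<lambda>n. (norm (\<eta> n))\<^sup>2)"
  shows "summable (\<lambda>n. norm (\<xi> n) * norm (\<eta> n))"
    and "summable (\<lambda>n. cinner (\<xi> n) (blinfun_apply x (\<eta> n)))"
    and "cmod (\<Sum>n. cinner (\<xi> n) (blinfun_apply x (\<eta> n))) \<le> (\<Sum>n. norm (\<xi> n) * norm (\<eta> n)) * norm x"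
proof -
  show sm: "summable (\<lambda>n. norm (\<xi> n) * norm (\<eta> n))"
  proof (rule summable_comparison_test')
    show "summable (\<lambda>n. (norm (\<xi> n))\<^sup>2 + (norm (\<eta> n))\<^sup>2)"
      using assms by (rule summable_add)
    show "norm (norm (\<xi> n) * norm (\<eta> n)) \<le> (norm (\<xi> n))\<^sup>2 + (norm (\<eta> n))\<^sup>2" for n
    proof -
      have "2 * (norm (\<xi> n) * norm (\<eta> n)) \<le> (norm (\<xi> n))\<^sup>2 + (norm (\<eta> n))\<^sup>2"
        using sum_squares_bound[of "norm (\<xi> n)" "norm (\<eta> n)"] by simp
      moreover have "0 \<le> norm (\<xi> n) * norm (\<eta> n)" by simp
      ultimately show ?thesis unfolding real_norm_def by linarith
    qed
  qed
  have bnd: "norm (cinner (\<xi> n) (blinfun_apply x (\<eta> n))) \<le> norm (\<xi> n) * norm (\<eta> n) * norm x" for n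
  proof -
    have "cmod (cinner (\<xi> n) (blinfun_apply x (\<eta> n))) \<le> norm (\<xi> n) * norm (blinfun_apply x (\<eta> n))"
      by (rule cinner_le_norm)
    also have "\<dots> \<le> norm (\<xi> n) * (norm x * norm (\<eta> n))"
      by (intro mult_left_mono norm_blinfun) simp
    finally show ?thesis by (simp add: mult_ac)
  qed
  have s1: "summable (\<lambda>n. norm (\<xi> n) * norm (\<eta> n) * norm x)"
    using sm by (rule summable_mult2)
  have s2: "summable (\<lambda>n. norm (cinner (\<xi> n) (blinfun_apply x (\<eta> n))))"
    by (rule summable_comparison_test'[OF s1]) (use bnd in simp)
  then show "summable (\<lambda>n. cinner (\<xi> n) (blinfun_apply x (\<eta> n)))"
    by (rule summable_norm_cancel)
  have "cmod (\<Sum>n. cinner (\<xi> n) (blinfun_apply x (\<eta> n)))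
      \<le> (\<Sum>n. norm (cinner (\<xi> n) (blinfun_apply x (\<eta> n))))"
    using s2 by (rule summable_norm)
  also have "\<dots> \<le> (\<Sum>n. norm (\<xi> n) * norm (\<eta> n) * norm x)"
    by (rule suminf_le[OF bnd s2 s1])
  also have "\<dots> = (\<Sum>n. norm (\<xi> n) * norm (\<eta> n)) * norm x"
    using sm by (simp add: suminf_mult2)
  finally show "cmod (\<Sum>n. cinner (\<xi> n) (blinfun_apply x (\<eta> n)))
      \<le> (\<Sum>n. norm (\<xi> n) * norm (\<eta> n)) * norm x" .
qed

lemma normal_functionalE:
  assumes "\<phi> \<in> normal_functionals"
  obtains \<xi> \<eta> :: "nat \<Rightarrow> 'h::chilbert_space" where
    "summable (\<lambda>n. (norm (\<xi> n))\<^sup>2)" "summable (\<lambda>n. (norm (\<eta> n))\<^sup>2)"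
    "\<And>x. \<phi> x = (\<Sum>n. cinner (\<xi> n) (blinfun_apply x (\<eta> n)))"
  using assms unfolding normal_functionals_def by auto

lemma normal_functionalI:
  fixes \<xi> \<eta> :: "nat \<Rightarrow> 'h::chilbert_space"
  assumes "summable (\<lambda>n. (norm (\<xi> n))\<^sup>2)" "summable (\<lambda>n. (norm (\<eta> n))\<^sup>2)"
    "\<And>x. \<phi> x = (\<Sum>n. cinner (\<xi> n) (blinfun_apply x (\<eta> n)))"
  shows "\<phi> \<in> normal_functionals"
  using assms unfolding normal_functionals_def by blast

lemma normal_functional_add_arg:
  assumes "\<phi> \<in> normal_functionals" shows "\<phi> (x + y) = \<phi> x + \<phi> y"
  using assms
proof (rule normal_functionalE)
  fix \<xi> \<eta> :: "nat \<Rightarrow> 'a"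
  assume *: "summable (\<lambda>n. (norm (\<xi> n))\<^sup>2)" "summable (\<lambda>n. (norm (\<eta> n))\<^sup>2)"
    and \<phi>: "\<And>x. \<phi> x = (\<Sum>n. cinner (\<xi> n) (blinfun_apply x (\<eta> n)))"
  show ?thesis
    unfolding \<phi> suminf_add[OF normal_functional_summable(2)[OF *] normal_functional_summable(2)[OF *]]
    by (simp add: blinfun.add_left cinner_add_right)
qed

lemma normal_functional_scale_op:
  assumes "\<phi> \<in> normal_functionals" shows "\<phi> (scale_op c x) = c * \<phi> x"
  using assms
proof (rule normal_functionalE)
  fix \<xi> \<eta> :: "nat \<Rightarrow> 'a"
  assume *: "summable (\<lambda>n. (norm (\<xi> n))\<^sup>2)" "summable (\<lambda>n. (norm (\<eta> n))\<^sup>2)"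
    and \<phi>: "\<And>x. \<phi> x = (\<Sum>n. cinner (\<xi> n) (blinfun_apply x (\<eta> n)))"
  show ?thesis
    unfolding \<phi> suminf_mult[OF normal_functional_summable(2)[OF *], symmetric]
    by (simp add: scale_op_apply cinner_scaleC_right)
qed

lemma scale_op_of_real: "scale_op (complex_of_real r) x = r *\<^sub>R x"
  by (rule blinfun_eqI) (simp add: scale_op_apply scaleC_of_real blinfun.scaleR_left)

lemma normal_functional_scaleR:
  assumes "\<phi> \<in> normal_functionals" shows "\<phi> (r *\<^sub>R x) = complex_of_real r * \<phi> x"
  using normal_functional_scale_op[OF assms, of "complex_of_real r" x] by (simp add: scale_op_of_real)

lemma normal_functional_diff_arg:
  assumes "\<phi> \<in> normal_functionals" shows "\<phi> (x - y) = \<phi> x - \<phi> y"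
  using normal_functional_add_arg[OF assms, of x "-y"] normal_functional_scaleR[OF assms, of "-1" y]
  by simp

lemma normal_functional_bound:
  assumes "\<phi> \<in> normal_functionals"
  obtains C where "0 \<le> C" "\<And>x. cmod (\<phi> x) \<le> C * norm x"
  using assms
proof (rule normal_functionalE)
  fix \<xi> \<eta> :: "nat \<Rightarrow> 'a"
  assume *: "summable (\<lambda>n. (norm (\<xi> n))\<^sup>2)" "summable (\<lambda>n. (norm (\<eta> n))\<^sup>2)"
    and \<phi>: "\<And>x. \<phi> x = (\<Sum>n. cinner (\<xi> n) (blinfun_apply x (\<eta> n)))"
  show thesis
  proof (rule that)
    show "0 \<le> (\<Sum>n. norm (\<xi> n) * norm (\<eta> n))"
      by (intro suminf_nonneg normal_functional_summable(1)[OF *]) simp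
    show "cmod (\<phi> x) \<le> (\<Sum>n. norm (\<xi> n) * norm (\<eta> n)) * norm x" for x
      unfolding \<phi> by (rule normal_functional_summable(3)[OF *])
  qed
qed

lemma normal_functional_vector: "(\<lambda>x. cinner \<xi> (blinfun_apply x \<eta>)) \<in> normal_functionals"
proof (rule normal_functionalI)
  show "summable (\<lambda>n. (norm (if n = 0 then \<xi> else 0))\<^sup>2)"
    and "summable (\<lambda>n. (norm (if n = 0 then \<eta> else 0))\<^sup>2)"
    by (rule summable_finite[of "{0::nat}"]; simp)+
  show "cinner \<xi> (blinfun_apply x \<eta>)
      = (\<Sum>n. cinner (if n = (0::nat) then \<xi> else 0) (blinfun_apply x (if n = 0 then \<eta> else 0)))" for x
    by (subst suminf_finite[of "{0}"]) auto
qed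

lemma normal_functional_cmult:
  assumes "\<phi> \<in> normal_functionals" shows "(\<lambda>x. c * \<phi> x) \<in> normal_functionals"
  using assms
proof (rule normal_functionalE)
  fix \<xi> \<eta> :: "nat \<Rightarrow> 'a"
  assume *: "summable (\<lambda>n. (norm (\<xi> n))\<^sup>2)" "summable (\<lambda>n. (norm (\<eta> n))\<^sup>2)"
    and \<phi>: "\<And>x. \<phi> x = (\<Sum>n. cinner (\<xi> n) (blinfun_apply x (\<eta> n)))"
  show ?thesis
  proof (rule normal_functionalI)
    show "summable (\<lambda>n. (norm (cnj c *\<^sub>C \<xi> n))\<^sup>2)"
      using summable_mult[OF *(1), of "(cmod c)\<^sup>2"] by (simp add: norm_scaleC power_mult_distrib)
    show "c * \<phi> x = (\<Sum>n. cinner (cnj c *\<^sub>C \<xi> n) (blinfun_apply x (\<eta> n)))" for x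
      unfolding \<phi> suminf_mult[OF normal_functional_summable(2)[OF *], symmetric]
      by (simp add: cinner_scaleC_left)
  qed (rule *(2))
qed

text \<open>Interleaving merges two square-summable families into one, which is how a sum of normal functionals
  becomes a single series.\<close>

lemma sums_interleave:
  fixes f g :: "nat \<Rightarrow> complex"
  assumes "f sums x" "g sums y"
  shows "(\<lambda>n. if even n then f (n div 2) else g ((n - 1) div 2)) sums (x + y)"
  using assms unfolding sums_complex_iff add.commute[of x y]
  by (auto simp: if_distrib[of Re] if_distrib[of Im] intro!: sums_if)

lemma normal_functional_add:
  fixes \<phi> \<psi> :: "'h::chilbert_space op \<Rightarrow> complex"
  assumes "\<phi> \<in> normal_functionals" "\<psi> \<in> normal_functionals"
  shows "(\<lambda>x. \<phi> x + \<psi> x) \<in> normal_functionals"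
proof -
  obtain \<xi> \<eta> :: "nat \<Rightarrow> 'h" where *: "summable (\<lambda>n. (norm (\<xi> n))\<^sup>2)" "summable (\<lambda>n. (norm (\<eta> n))\<^sup>2)"
    and \<phi>: "\<And>x. \<phi> x = (\<Sum>n. cinner (\<xi> n) (blinfun_apply x (\<eta> n)))"
    using assms(1) by (rule normal_functionalE) blast
  obtain \<xi>' \<eta>' :: "nat \<Rightarrow> 'h" where sp: "summable (\<lambda>n. (norm (\<xi>' n))\<^sup>2)" "summable (\<lambda>n. (norm (\<eta>' n))\<^sup>2)"
    and \<psi>: "\<And>x. \<psi> x = (\<Sum>n. cinner (\<xi>' n) (blinfun_apply x (\<eta>' n)))"
    using assms(2) by (rule normal_functionalE) blast
  have sm: "summable (\<lambda>n. (norm (if even n then a (n div 2) else b ((n - 1) div 2)))\<^sup>2)"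
    if "summable (\<lambda>n. (norm (a n))\<^sup>2)" "summable (\<lambda>n. (norm (b n))\<^sup>2)" for a b :: "nat \<Rightarrow> 'h"
    using sums_if[OF summable_sums[OF that(2)] summable_sums[OF that(1)]]
      sums_if[OF summable_sums[OF that(1)] summable_sums[OF that(2)]]
    by (simp add: sums_iff if_distrib[of norm] if_distrib[of "\<lambda>x. x\<^sup>2"] cong: if_cong)
  show ?thesis
  proof (rule normal_functionalI[OF sm[OF *(1) sp(1)] sm[OF *(2) sp(2)]])
    fix x
    have "(\<lambda>n. if even n then cinner (\<xi> (n div 2)) (blinfun_apply x (\<eta> (n div 2)))
        else cinner (\<xi>' ((n - 1) div 2)) (blinfun_apply x (\<eta>' ((n - 1) div 2)))) sums (\<phi> x + \<psi> x)"
      unfolding \<phi> \<psi> by (intro sums_interleave summable_sums normal_functional_summable(2) * sp)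
    also have "(\<lambda>n. if even n then cinner (\<xi> (n div 2)) (blinfun_apply x (\<eta> (n div 2)))
        else cinner (\<xi>' ((n - 1) div 2)) (blinfun_apply x (\<eta>' ((n - 1) div 2)))) =
      (\<lambda>n. cinner (if even n then \<xi> (n div 2) else \<xi>' ((n - 1) div 2))
         (blinfun_apply x (if even n then \<eta> (n div 2) else \<eta>' ((n - 1) div 2))))"
      by auto
    finally show "\<phi> x + \<psi> x = (\<Sum>n. cinner (if even n then \<xi> (n div 2) else \<xi>' ((n - 1) div 2))
         (blinfun_apply x (if even n then \<eta> (n div 2) else \<eta>' ((n - 1) div 2))))"
      by (simp add: sums_iff)
  qed
qed

text \<open>Left multiplication by \<open>m\<close> moves to the first vectors as \<open>m\<^sup>*\<close>, which stay square-summable.\<close>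

lemma normal_functional_left_mult:
  fixes m :: "'h::chilbert_space op"
  assumes "\<phi> \<in> normal_functionals" and adj: "is_adjoint m m'"
  shows "(\<lambda>x. \<phi> (m o\<^sub>L x)) \<in> normal_functionals"
  using assms(1)
proof (rule normal_functionalE)
  fix \<xi> \<eta> :: "nat \<Rightarrow> 'h"
  assume *: "summable (\<lambda>n. (norm (\<xi> n))\<^sup>2)" "summable (\<lambda>n. (norm (\<eta> n))\<^sup>2)"
    and \<phi>: "\<And>x. \<phi> x = (\<Sum>n. cinner (\<xi> n) (blinfun_apply x (\<eta> n)))"
  show ?thesis
  proof (rule normal_functionalI)
    show "summable (\<lambda>n. (norm (blinfun_apply m' (\<xi> n)))\<^sup>2)"
    proof (rule summable_comparison_test')
      show "summable (\<lambda>n. (norm m')\<^sup>2 * (norm (\<xi> n))\<^sup>2)" using *(1) by (rule summable_mult)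
      show "norm ((norm (blinfun_apply m' (\<xi> n)))\<^sup>2) \<le> (norm m')\<^sup>2 * (norm (\<xi> n))\<^sup>2" for n
        using norm_blinfun[of m' "\<xi> n"] by (simp add: power_mono flip: power_mult_distrib)
    qed
    show "\<phi> (m o\<^sub>L x) = (\<Sum>n. cinner (blinfun_apply m' (\<xi> n)) (blinfun_apply x (\<eta> n)))" for x
      using is_adjoint_sym[OF adj] unfolding \<phi> is_adjoint_def by simp
  qed (rule *(2))
qed


section \<open>The weak-* topology\<close>

lemma normal_functional_continuous:
  assumes "\<phi> \<in> normal_functionals"
  shows "continuous_map (weak_star M) euclidean \<phi>"
  unfolding weak_star_def
proof (rule continuous_map_from_subtopology)
  show "continuous_map (topology_generated_by {{x. \<phi> x \<in> U} | \<phi> U. \<phi> \<in> normal_functionals \<and> open U})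
      euclidean \<phi>" (is "continuous_map ?X _ _")
    unfolding continuous_map_def
  proof (intro conjI allI impI)
    have top: "topspace ?X = UNIV"
      using assms by (auto simp: topology_generated_by_topspace intro!: exI[of _ UNIV])
    fix U :: "complex set" assume "openin euclidean U"
    then have "openin ?X {x. \<phi> x \<in> U}"
      using assms by (intro topology_generated_by_Basis) auto
    then show "openin ?X {x \<in> topspace ?X. \<phi> x \<in> U}" unfolding top by simp
  qed auto
qed

lemma topspace_weak_star: "topspace (weak_star M) = M"
  unfolding weak_star_def
  by (auto simp: topology_generated_by_topspace intro!: exI[of _ UNIV] exI[of _ "\<lambda>x. cinner 0 (blinfun_apply x 0)"]
      normal_functional_vector)

lemma limitin_weak_starD:
  assumes "limitin (weak_star M) g y F" "\<phi> \<in> normal_functionals"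
  shows "((\<lambda>t. \<phi> (g t)) \<longlongrightarrow> \<phi> y) F"
  using continuous_map_limit[OF normal_functional_continuous[OF assms(2)] assms(1)]
  by (simp add: o_def)

text \<open>Already the vector functionals \<open>x \<mapsto> \<langle>\<xi>, x \<eta>\<rangle>\<close> separate operators.\<close>

lemma normal_functionals_separate:
  assumes "\<And>\<phi>. \<phi> \<in> normal_functionals \<Longrightarrow> \<phi> x = \<phi> y"
  shows "x = y"
  using assms[OF normal_functional_vector] by (intro blinfun_eqI cinner_eqI)

lemma limitin_weak_star_unique:
  assumes "limitin (weak_star M) g y F" "limitin (weak_star M) g z F" "F \<noteq> bot"
  shows "y = z"
  using tendsto_unique[OF assms(3) limitin_weak_starD[OF assms(1)] limitin_weak_starD[OF assms(2)]]
  by (rule normal_functionals_separate)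

text \<open>Intersections of finitely many subbasic sets form a base, so a weak-* neighbourhood constrains
  only finitely many functionals.\<close>

lemma generate_topology_on_finite_basis:
  assumes "generate_topology_on S U" "x \<in> U"
  shows "\<exists>F\<subseteq>S. finite F \<and> x \<in> \<Inter>F \<and> \<Inter>F \<subseteq> U"
  using assms
proof (induction)
  case (Int a b)
  then obtain F G where "F \<subseteq> S" "finite F" "x \<in> \<Inter>F" "\<Inter>F \<subseteq> a" "G \<subseteq> S" "finite G" "x \<in> \<Inter>G" "\<Inter>G \<subseteq> b"
    by blast
  then show ?case by (intro exI[of _ "F \<union> G"]) auto
next
  case (UN K)
  then show ?case by (meson UnionE Union_upper order_trans)
next
  case (Basis s)
  then show ?case by (intro exI[of _ "{s}"]) auto
qed auto

definition complex_subspace :: "'h::chilbert_space op set \<Rightarrow> bool" where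
  "complex_subspace V \<longleftrightarrow> 0 \<in> V \<and> (\<forall>x\<in>V. \<forall>y\<in>V. x + y \<in> V) \<and> (\<forall>c. \<forall>x\<in>V. scale_op c x \<in> V)"

definition complex_linear_on :: "'h::chilbert_space op set \<Rightarrow> ('h op \<Rightarrow> complex) \<Rightarrow> bool" where
  "complex_linear_on V \<psi> \<longleftrightarrow>
     (\<forall>x\<in>V. \<forall>y\<in>V. \<psi> (x + y) = \<psi> x + \<psi> y) \<and> (\<forall>c. \<forall>x\<in>V. \<psi> (scale_op c x) = c * \<psi> x)"

text \<open>A functional that vanishes on the common kernel of finitely many functionals is one of their linear
  combinations. The induction splits off one functional \<open>\<theta>\<close>: on its kernel the claim is known, and
  the difference to the functional found there factors through \<open>\<theta>\<close>.\<close>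

lemma linear_combination_of_kernels:
  assumes "finite F" "F \<subseteq> normal_functionals" "complex_subspace V" "complex_linear_on V \<psi>"
    and "\<And>x. x \<in> V \<Longrightarrow> (\<And>\<phi>. \<phi> \<in> F \<Longrightarrow> \<phi> x = 0) \<Longrightarrow> \<psi> x = 0"
  shows "\<exists>\<phi>\<in>normal_functionals. \<forall>x\<in>V. \<psi> x = \<phi> x"
  using assms
proof (induction F arbitrary: V)
  case empty
  have "(\<lambda>x. cinner 0 (blinfun_apply x 0)) \<in> (normal_functionals :: ('a op \<Rightarrow> complex) set)"
    by (rule normal_functional_vector)
  then show ?case using empty by (intro bexI) auto
next
  case (insert \<theta> F)
  have \<theta>: "\<theta> \<in> normal_functionals" using insert by simp
  note [simp] = normal_functional_add_arg[OF \<theta>] normal_functional_scale_op[OF \<theta>]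
  define K where "K = {x \<in> V. \<theta> x = 0}"
  have "\<theta> 0 = 0" using normal_functional_add_arg[OF \<theta>, of 0 0] by simp
  then have "complex_subspace K" "complex_linear_on K \<psi>"
    using insert.prems by (auto simp: complex_subspace_def complex_linear_on_def K_def)
  moreover have "\<psi> x = 0" if "x \<in> K" "\<And>\<phi>. \<phi> \<in> F \<Longrightarrow> \<phi> x = 0" for x
    using that insert.prems(4)[of x] by (auto simp: K_def)
  ultimately obtain \<phi> where \<phi>: "\<phi> \<in> normal_functionals" "\<And>x. x \<in> K \<Longrightarrow> \<psi> x = \<phi> x"
    using insert.IH[of K] insert.prems by auto
  show ?case
  proof (cases "K = V")
    case True
    then show ?thesis using \<phi> by auto
  next
    case False
    then obtain e where e: "e \<in> V" "\<theta> e \<noteq> 0" by (auto simp: K_def)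
    define d where "d = (\<psi> e - \<phi> e) / \<theta> e"
    have "\<psi> x = \<phi> x + d * \<theta> x" if x: "x \<in> V" for x
    proof -
      let ?c = "- \<theta> x / \<theta> e"
      have "x + scale_op ?c e \<in> K"
        using x e insert.prems(2) by (auto simp: K_def complex_subspace_def)
      then have "\<psi> (x + scale_op ?c e) = \<phi> (x + scale_op ?c e)" by (rule \<phi>)
      moreover have "\<psi> (x + scale_op ?c e) = \<psi> x + ?c * \<psi> e"
        using x e insert.prems(2,3) by (simp add: complex_subspace_def complex_linear_on_def)
      moreover have "\<phi> (x + scale_op ?c e) = \<phi> x + ?c * \<phi> e"
        by (simp add: normal_functional_add_arg[OF \<phi>(1)] normal_functional_scale_op[OF \<phi>(1)])
      ultimately have "\<psi> x + ?c * \<psi> e = \<phi> x + ?c * \<phi> e" by simp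
      then show ?thesis using e by (simp add: d_def field_simps)
    qed
    then show ?thesis
      using normal_functional_add[OF \<phi>(1) normal_functional_cmult[OF \<theta>, of d]] by (intro bexI) auto
  qed
qed

text \<open>The set where \<open>\<bar>\<psi>\<bar> < 1\<close> contains a basic neighbourhood of zero. The common kernel of the finitely many
  functionals defining it is a subspace on which \<open>\<psi>\<close> is bounded, hence zero. This makes the composition
  of a normal functional with a normal map normal again, so that such compositions can be taken under
  weak-* integrals.\<close>

theorem weak_star_continuous_functional_normal:
  assumes V: "complex_subspace V" and lin: "complex_linear_on V \<psi>"
    and cont: "continuous_map (weak_star V) euclidean \<psi>"
  shows "\<exists>\<phi>\<in>normal_functionals. \<forall>x\<in>V. \<psi> x = \<phi> x"
proof -
  define B :: "'a op set set" where
    "B = {{x. \<phi> x \<in> U} | \<phi> U. \<phi> \<in> normal_functionals \<and> open U}"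
  have "0 \<in> V" using V by (simp add: complex_subspace_def)
  have "\<psi> 0 = 0"
    using lin \<open>0 \<in> V\<close> unfolding complex_linear_on_def by (metis add_cancel_right_right)
  have "openin (weak_star V) {x \<in> V. \<psi> x \<in> ball 0 1}"
    using openin_continuous_map_preimage[OF cont, of "ball 0 1"]
    by (simp only: topspace_weak_star open_openin[symmetric] open_ball)
  then have "\<exists>W. generate_topology_on B W \<and> {x \<in> V. \<psi> x \<in> ball 0 1} = W \<inter> V"
    by (simp only: weak_star_def B_def openin_subtopology openin_topology_generated_by_iff)
  then obtain W where W: "generate_topology_on B W" "{x \<in> V. \<psi> x \<in> ball 0 1} = W \<inter> V"
    by (elim exE conjE)
  have "0 \<in> {x \<in> V. \<psi> x \<in> ball 0 1}" using \<open>0 \<in> V\<close> \<open>\<psi> 0 = 0\<close> by simp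
  then have "0 \<in> W" unfolding W(2) by (rule IntD1)
  then obtain F where F: "F \<subseteq> B" "finite F" "0 \<in> \<Inter>F" "\<Inter>F \<subseteq> W"
    using generate_topology_on_finite_basis[OF W(1) \<open>0 \<in> W\<close>] by blast
  have "\<forall>s\<in>F. \<exists>\<phi> U. \<phi> \<in> normal_functionals \<and> s = {x. \<phi> x \<in> U}"
  proof
    fix s assume "s \<in> F"
    then have "s \<in> B" using F(1) by (rule rev_subsetD)
    then show "\<exists>\<phi> U. \<phi> \<in> normal_functionals \<and> s = {x. \<phi> x \<in> U}" unfolding B_def mem_Collect_eq by metis
  qed
  then obtain f g where fg: "\<And>s. s \<in> F \<Longrightarrow> f s \<in> normal_functionals"
      "\<And>s. s \<in> F \<Longrightarrow> s = {x. f s x \<in> g s}"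
    by metis
  have "\<psi> x = 0" if x: "x \<in> V" and ker: "\<And>\<phi>. \<phi> \<in> f ` F \<Longrightarrow> \<phi> x = 0" for x
  proof (rule ccontr)
    assume "\<psi> x \<noteq> 0"
    \<comment> \<open>The whole line through \<open>x\<close> lies in the neighbourhood, yet \<open>\<psi>\<close> is unbounded on it.\<close>
    define y where "y = scale_op (2 / \<psi> x) x"
    have "y \<in> V" using x V by (simp add: complex_subspace_def y_def)
    have "y \<in> s" if s: "s \<in> F" for s
    proof -
      have "f s y = 0" using ker[of "f s"] s by (simp add: y_def normal_functional_scale_op[OF fg(1)])
      moreover have "f s 0 = 0" using normal_functional_add_arg[OF fg(1)[OF s], of 0 0] by simp
      moreover have "0 \<in> s" using F(3) s by (rule InterD)
      then have "0 \<in> {x. f s x \<in> g s}" by (subst (asm) fg(2)[OF s])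
      ultimately have "y \<in> {x. f s x \<in> g s}" by simp
      then show ?thesis by (subst fg(2)[OF s])
    qed
    then have "y \<in> \<Inter>F" by (rule InterI)
    then have "y \<in> W \<inter> V" using F(4) \<open>y \<in> V\<close> by (intro IntI subsetD[OF F(4)])
    then have "y \<in> {x \<in> V. \<psi> x \<in> ball 0 1}" unfolding W(2) .
    moreover have "\<psi> y = 2" using lin x \<open>\<psi> x \<noteq> 0\<close> by (simp add: complex_linear_on_def y_def)
    ultimately show False by simp
  qed
  then show ?thesis
    using F(2) fg(1) by (intro linear_combination_of_kernels[OF _ _ V lin, of "f ` F"]) auto
qed

section \<open>Von Neumann algebras and unital completely positive maps\<close>

lemma commutantD: "y \<in> commutant S \<Longrightarrow> y \<in> bounded_ops"
  "y \<in> commutant S \<Longrightarrow> x \<in> S \<Longrightarrow> blinfun_apply x (blinfun_apply y \<xi>) = blinfun_apply y (blinfun_apply x \<xi>)"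
  by (auto simp: commutant_def dest!: bspec arg_cong[where f = "\<lambda>z. blinfun_apply z \<xi>"])

lemma commutantI:
  assumes "y \<in> bounded_ops"
    and "\<And>x \<xi>. x \<in> S \<Longrightarrow> blinfun_apply x (blinfun_apply y \<xi>) = blinfun_apply y (blinfun_apply x \<xi>)"
  shows "y \<in> commutant S"
  using assms by (auto simp: commutant_def intro!: blinfun_eqI)

text \<open>Cauchy--Schwarz for the positive form \<open>\<langle>\<xi>, x \<eta>\<rangle>\<close>, applied to \<open>\<xi>\<close> and \<open>\<eta> = x \<xi>\<close>. It reduces norm
  bounds for variances to bounds for their quadratic forms.\<close>

lemma op_norm_le_of_form:
  fixes x :: "'h::chilbert_space op"
  assumes sa: "is_adjoint x x" and "0 \<le> C"
    and pos: "\<And>\<xi>. 0 \<le> Re (cinner \<xi> (blinfun_apply x \<xi>))"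
    and le: "\<And>\<xi>. Re (cinner \<xi> (blinfun_apply x \<xi>)) \<le> C * (norm \<xi>)\<^sup>2"
  shows "norm x \<le> C"
proof (rule norm_blinfun_bound[OF \<open>0 \<le> C\<close>])
  fix \<xi>
  let ?q = "\<lambda>\<xi>. Re (cinner \<xi> (blinfun_apply x \<xi>))"
  let ?\<eta> = "blinfun_apply x \<xi>"
  have "(2 * (norm ?\<eta>)\<^sup>2)\<^sup>2 \<le> 4 * ?q \<xi> * ?q ?\<eta>"
  proof (rule nonneg_quadratic_discriminant)
    fix r :: real
    have "Re (cinner \<xi> (blinfun_apply x ?\<eta>)) = (norm ?\<eta>)\<^sup>2"
      using sa unfolding is_adjoint_def by (metis Re_cinner_self)
    then have "?q (\<xi> + r *\<^sub>R ?\<eta>) = ?q \<xi> + r * (2 * (norm ?\<eta>)\<^sup>2) + r\<^sup>2 * ?q ?\<eta>"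
      by (simp add: blinfun.add_right blinfun.scaleR_right cinner_simps Re_cinner_self
          power2_eq_square algebra_simps cinner_self)
    then show "0 \<le> ?q \<xi> + r * (2 * (norm ?\<eta>)\<^sup>2) + r\<^sup>2 * ?q ?\<eta>" using pos by metis
  qed
  also have "\<dots> \<le> 4 * (C * (norm \<xi>)\<^sup>2) * (C * (norm ?\<eta>)\<^sup>2)"
    using le pos \<open>0 \<le> C\<close> by (intro mult_mono) auto
  finally have "(norm ?\<eta>)\<^sup>2 * (norm ?\<eta>)\<^sup>2 \<le> (C * norm \<xi>)\<^sup>2 * (norm ?\<eta>)\<^sup>2"
    by (simp add: power2_eq_square algebra_simps)
  then have "(norm ?\<eta>)\<^sup>2 \<le> (C * norm \<xi>)\<^sup>2"
    using mult_right_le_imp_le[of "(norm ?\<eta>)\<^sup>2" "(norm ?\<eta>)\<^sup>2" "(C * norm \<xi>)\<^sup>2"]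
    by (cases "norm ?\<eta> = 0") simp_all
  then show "norm ?\<eta> \<le> C * norm \<xi>"
    using \<open>0 \<le> C\<close> by (simp add: power2_le_iff_abs_le)
qed

definition ucp :: "'h::chilbert_space op set \<Rightarrow> ('h op \<Rightarrow> 'h op) \<Rightarrow> bool" where
  "ucp M S \<longleftrightarrow> linear_map_on M S \<and> completely_positive_on M S \<and> S id_blinfun = id_blinfun"

locale vna =
  fixes M :: "'h::chilbert_space op set"
  assumes vna: "von_neumann_algebra M"
begin

lemma M_bounded: "x \<in> M \<Longrightarrow> x \<in> bounded_ops"
  using vna by (auto simp: von_neumann_algebra_def)

lemma M_bicommutant: "commutant (commutant M) = M"
  using vna by (simp add: von_neumann_algebra_def)

lemma is_adjoint_adj: "x \<in> M \<Longrightarrow> is_adjoint x (adj x)"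
  using vna adj_eqI unfolding von_neumann_algebra_def by metis

lemma adj_M [simp]: "x \<in> M \<Longrightarrow> adj x \<in> M"
  using vna adj_eqI unfolding von_neumann_algebra_def by metis

lemma adj_adj [simp]: "x \<in> M \<Longrightarrow> adj (adj x) = x"
  by (rule adj_eqI[OF is_adjoint_sym[OF is_adjoint_adj]])

lemma cinner_adj: "x \<in> M \<Longrightarrow> cinner \<xi> (blinfun_apply (adj x) \<eta>) = cinner (blinfun_apply x \<xi>) \<eta>"
  using is_adjoint_adj[of x] by (simp add: is_adjoint_def)

lemma M_iff: "x \<in> M \<longleftrightarrow> x \<in> bounded_ops \<and>
    (\<forall>y\<in>commutant M. \<forall>\<xi>. blinfun_apply y (blinfun_apply x \<xi>) = blinfun_apply x (blinfun_apply y \<xi>))"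
proof
  assume "x \<in> M"
  then have "x \<in> commutant (commutant M)" by (simp only: M_bicommutant)
  from commutantD(1)[OF this] commutantD(2)[OF this] show "x \<in> bounded_ops \<and>
    (\<forall>y\<in>commutant M. \<forall>\<xi>. blinfun_apply y (blinfun_apply x \<xi>) = blinfun_apply x (blinfun_apply y \<xi>))"
    by (intro conjI ballI allI)
next
  assume "x \<in> bounded_ops \<and>
    (\<forall>y\<in>commutant M. \<forall>\<xi>. blinfun_apply y (blinfun_apply x \<xi>) = blinfun_apply x (blinfun_apply y \<xi>))"
  then have "x \<in> commutant (commutant M)" by (intro commutantI) simp_all
  then show "x \<in> M" by (simp only: M_bicommutant)
qed

lemma commutant_scaleC: "y \<in> commutant M \<Longrightarrow> blinfun_apply y (c *\<^sub>C \<xi>) = c *\<^sub>C blinfun_apply y \<xi>"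
  by (rule bounded_opsD[OF commutantD(1)])

lemma M_id [simp]: "id_blinfun \<in> M"
  unfolding M_iff by (simp add: bounded_ops_def)

lemma M_zero [simp]: "0 \<in> M"
  unfolding M_iff using scaleC_scaleR[of _ 0 "0 :: 'h"]
  by (simp add: bounded_ops_def blinfun.zero_left blinfun.zero_right)

lemma M_add [simp]: "x \<in> M \<Longrightarrow> y \<in> M \<Longrightarrow> x + y \<in> M"
  unfolding M_iff by (simp add: bounded_ops_def blinfun.add_left blinfun.add_right scaleC_add_right)

lemma M_scale_op [simp]: "x \<in> M \<Longrightarrow> scale_op c x \<in> M"
  unfolding M_iff
  by (simp add: bounded_ops_def scale_op_apply scaleC_scaleC mult.commute commutant_scaleC)

lemma M_scaleR [simp]: "x \<in> M \<Longrightarrow> r *\<^sub>R x \<in> M"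
  using M_scale_op[of x "complex_of_real r"] by (simp add: scale_op_of_real)

lemma M_minus [simp]: "x \<in> M \<Longrightarrow> - x \<in> M"
  using M_scaleR[of x "-1"] by simp

lemma M_diff [simp]: "x \<in> M \<Longrightarrow> y \<in> M \<Longrightarrow> x - y \<in> M"
  using M_add[of x "- y"] by simp

lemma M_compose [simp]: "x \<in> M \<Longrightarrow> y \<in> M \<Longrightarrow> x o\<^sub>L y \<in> M"
  unfolding M_iff by (simp add: bounded_ops_def)

lemma complex_subspace_M: "complex_subspace M"
  by (simp add: complex_subspace_def)

lemma adj_add: "x \<in> M \<Longrightarrow> y \<in> M \<Longrightarrow> adj (x + y) = adj x + adj y"
  by (rule adj_eqI) (simp add: is_adjoint_def blinfun.add_left cinner_simps cinner_adj)

lemma adj_diff: "x \<in> M \<Longrightarrow> y \<in> M \<Longrightarrow> adj (x - y) = adj x - adj y"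
  by (rule adj_eqI) (simp add: is_adjoint_def blinfun.diff_left cinner_simps cinner_adj)

lemma adj_scaleR: "x \<in> M \<Longrightarrow> adj (r *\<^sub>R x) = r *\<^sub>R adj x"
  by (rule adj_eqI) (simp add: is_adjoint_def blinfun.scaleR_left cinner_simps cinner_adj)

lemma adj_compose: "x \<in> M \<Longrightarrow> y \<in> M \<Longrightarrow> adj (x o\<^sub>L y) = adj y o\<^sub>L adj x"
  by (rule adj_eqI) (simp add: is_adjoint_def cinner_adj)

lemma norm_adj_le:
  assumes x: "x \<in> M" shows "norm (adj x) \<le> norm x"
proof (rule norm_blinfun_bound[OF norm_ge_zero])
  fix \<xi>
  show "norm (blinfun_apply (adj x) \<xi>) \<le> norm x * norm \<xi>"
  proof (rule norm_le_of_cinner)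
    fix \<eta>
    have "cmod (cinner \<eta> (blinfun_apply (adj x) \<xi>)) \<le> norm (blinfun_apply x \<eta>) * norm \<xi>"
      unfolding cinner_adj[OF x] by (rule cinner_le_norm)
    also have "\<dots> \<le> norm x * norm \<eta> * norm \<xi>" by (rule mult_right_mono[OF norm_blinfun norm_ge_zero])
    finally show "cmod (cinner \<eta> (blinfun_apply (adj x) \<xi>)) \<le> norm x * norm \<xi> * norm \<eta>"
      by (simp only: mult_ac)
  qed simp
qed

lemma norm_adj:
  assumes x: "x \<in> M" shows "norm (adj x) = norm x"
proof (rule antisym)
  show "norm (adj x) \<le> norm x" by (rule norm_adj_le[OF x])
  show "norm x \<le> norm (adj x)" using norm_adj_le[OF adj_M[OF x]] by (simp only: adj_adj[OF x])
qed

lemma cinner_abs_sq: "x \<in> M \<Longrightarrow> cinner \<xi> (blinfun_apply (abs_sq x) \<xi>) = complex_of_real ((norm (blinfun_apply x \<xi>))\<^sup>2)"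
  by (simp add: cinner_adj cinner_self)

lemma norm_abs_sq_le: "x \<in> M \<Longrightarrow> norm (abs_sq x) \<le> (norm x)\<^sup>2"
  using norm_blinfun_compose[of "adj x" x] by (simp add: norm_adj power2_eq_square)

end

locale ucp_map = vna +
  fixes S :: "'h::chilbert_space op \<Rightarrow> 'h op"
  assumes ucp: "ucp M S"
begin

lemma S_M [simp]: "x \<in> M \<Longrightarrow> S x \<in> M"
  and S_add: "x \<in> M \<Longrightarrow> y \<in> M \<Longrightarrow> S (x + y) = S x + S y"
  and S_scale_op: "x \<in> M \<Longrightarrow> S (scale_op c x) = scale_op c (S x)"
  and S_id [simp]: "S id_blinfun = id_blinfun"
  using ucp by (simp_all add: ucp_def linear_map_on_def)

lemma S_scaleR: "x \<in> M \<Longrightarrow> S (r *\<^sub>R x) = r *\<^sub>R S x"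
  using S_scale_op[of x "complex_of_real r"] by (simp add: scale_op_of_real)

lemma S_diff: "x \<in> M \<Longrightarrow> y \<in> M \<Longrightarrow> S (x - y) = S x - S y"
  using S_add[of x "- y"] S_scaleR[of y "-1"] by simp

lemma completely_positive:
  assumes "\<And>i j. i < n \<Longrightarrow> j < n \<Longrightarrow> x i j \<in> M" "positive_op_matrix n x"
  shows "positive_op_matrix n (\<lambda>i j. S (x i j))"
proof -
  have "completely_positive_on M S" using ucp by (simp add: ucp_def)
  from spec[OF spec[OF this[unfolded completely_positive_on_def], of n], of x]
  show ?thesis using assms by simp
qed

lemma S_positive:
  assumes "x \<in> M" "\<And>\<xi>. cinner \<xi> (blinfun_apply x \<xi>) \<in> \<real>\<^sub>\<ge>\<^sub>0"
  shows "cinner \<xi> (blinfun_apply (S x) \<xi>) \<in> \<real>\<^sub>\<ge>\<^sub>0"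
proof -
  have single: "positive_op_matrix 1 (\<lambda>_ _. y) \<longleftrightarrow> (\<forall>\<zeta>. cinner \<zeta> (blinfun_apply y \<zeta>) \<in> \<real>\<^sub>\<ge>\<^sub>0)"
    for y :: "'h op"
  proof
    assume *: "positive_op_matrix 1 (\<lambda>_ _. y)"
    show "\<forall>\<zeta>. cinner \<zeta> (blinfun_apply y \<zeta>) \<in> \<real>\<^sub>\<ge>\<^sub>0"
    proof
      fix \<zeta>
      show "cinner \<zeta> (blinfun_apply y \<zeta>) \<in> \<real>\<^sub>\<ge>\<^sub>0"
        using spec[OF *[unfolded positive_op_matrix_def], of "\<lambda>_. \<zeta>"] by simp
    qed
  qed (simp add: positive_op_matrix_def)
  have "positive_op_matrix 1 (\<lambda>_ _. S x)"
  proof (rule completely_positive)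
    show "positive_op_matrix 1 (\<lambda>_ _. x)" unfolding single using assms(2) by blast
  qed (rule assms(1))
  then show ?thesis unfolding single by simp
qed

text \<open>The matrix with rows \<open>(1, x)\<close> and \<open>(x\<^sup>*, x\<^sup>*x)\<close> is positive, since its quadratic form is
  \<open>\<parallel>\<xi> + x \<eta>\<parallel>\<^sup>2\<close>. Its image under \<open>S\<close> is positive as well; that the form is real makes \<open>S\<close> commute
  with adjoints, and the choice \<open>\<xi> = - S x \<eta>\<close> gives the Schwarz inequality.\<close>

lemma S_two_positive:
  assumes x: "x \<in> M"
  shows "cinner \<xi> \<xi> + cinner \<xi> (blinfun_apply (S x) \<eta>) + cinner \<eta> (blinfun_apply (S (adj x)) \<xi>)
      + cinner \<eta> (blinfun_apply (S (abs_sq x)) \<eta>) \<in> \<real>\<^sub>\<ge>\<^sub>0"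
proof -
  define X where "X i j = (if i = 0 then if j = 0 then id_blinfun else x
      else if j = 0 then adj x else abs_sq x)" for i j :: nat
  have sum2: "(\<Sum>i<2. \<Sum>j<2. f i j) = f 0 0 + f 0 1 + f 1 0 + f 1 1"
    for f :: "nat \<Rightarrow> nat \<Rightarrow> complex"
    by (simp add: numeral_2_eq_2)
  have "positive_op_matrix 2 X"
    unfolding positive_op_matrix_def sum2
  proof
    fix \<zeta> :: "nat \<Rightarrow> 'h"
    have "cinner (\<zeta> 0) (blinfun_apply (X 0 0) (\<zeta> 0)) + cinner (\<zeta> 0) (blinfun_apply (X 0 1) (\<zeta> 1))
      + cinner (\<zeta> 1) (blinfun_apply (X 1 0) (\<zeta> 0)) + cinner (\<zeta> 1) (blinfun_apply (X 1 1) (\<zeta> 1))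
      = complex_of_real ((norm (\<zeta> 0 + blinfun_apply x (\<zeta> 1)))\<^sup>2)"
      using x unfolding cinner_self[symmetric] by (simp add: X_def cinner_adj cinner_simps)
    then show "cinner (\<zeta> 0) (blinfun_apply (X 0 0) (\<zeta> 0)) + cinner (\<zeta> 0) (blinfun_apply (X 0 1) (\<zeta> 1))
      + cinner (\<zeta> 1) (blinfun_apply (X 1 0) (\<zeta> 0)) + cinner (\<zeta> 1) (blinfun_apply (X 1 1) (\<zeta> 1)) \<in> \<real>\<^sub>\<ge>\<^sub>0"
      by (simp add: complex_nonneg_Reals_iff)
  qed
  moreover have "\<forall>i<2. \<forall>j<2. X i j \<in> M" using x by (simp add: X_def)
  ultimately have "positive_op_matrix 2 (\<lambda>i j. S (X i j))"
    by (intro completely_positive) simp_all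
  from this[unfolded positive_op_matrix_def sum2, rule_format, of "\<lambda>i. if i = 0 then \<xi> else \<eta>"]
  show ?thesis by (simp add: X_def)
qed

text \<open>Replacing \<open>\<eta>\<close> by \<open>i \<eta>\<close> turns the vanishing of an imaginary part into that of a real part; together they
  say that the two off-diagonal terms are conjugate.\<close>

lemma S_is_adjoint:
  assumes x: "x \<in> M" shows "is_adjoint (S x) (S (adj x))"
proof -
  have eq: "cinner \<eta> (blinfun_apply (S (adj x)) \<xi>) = cnj (cinner \<xi> (blinfun_apply (S x) \<eta>))" for \<xi> \<eta>
  proof -
    let ?a = "cinner \<xi> (blinfun_apply (S x) \<eta>)" and ?b = "cinner \<eta> (blinfun_apply (S (adj x)) \<xi>)"
    have re: "Im (cinner \<zeta> (blinfun_apply (S (abs_sq x)) \<zeta>)) = 0" for \<zeta>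
      using S_two_positive[OF x, of 0 \<zeta>] by (simp add: complex_nonneg_Reals_iff)
    have bd: "S x \<in> bounded_ops" using M_bounded x by simp
    have "Im ?a + Im ?b = 0"
      using S_two_positive[OF x, of \<xi> \<eta>] re[of \<eta>] by (simp add: complex_nonneg_Reals_iff cinner_self)
    moreover have "Re ?a - Re ?b = 0"
      using S_two_positive[OF x, of \<xi> "\<i> *\<^sub>C \<eta>"] re[of "\<i> *\<^sub>C \<eta>"] bounded_opsD[OF bd]
      by (simp add: complex_nonneg_Reals_iff cinner_self cinner_simps)
    ultimately show ?thesis by (intro complex_eqI) auto
  qed
  show ?thesis
    unfolding is_adjoint_def
  proof (intro allI)
    fix \<xi> \<eta>
    show "cinner (blinfun_apply (S x) \<xi>) \<eta> = cinner \<xi> (blinfun_apply (S (adj x)) \<eta>)"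
      using eq[where \<xi> = \<eta> and \<eta> = \<xi>] cinner_commute[of "blinfun_apply (S x) \<xi>" \<eta>] by simp
  qed
qed

lemma S_adj: "x \<in> M \<Longrightarrow> S (adj x) = adj (S x)"
  using adj_eqI[OF S_is_adjoint] by simp

theorem schwarz:
  assumes x: "x \<in> M"
  shows "(norm (blinfun_apply (S x) \<xi>))\<^sup>2 \<le> Re (cinner \<xi> (blinfun_apply (S (abs_sq x)) \<xi>))"
proof -
  have "cinner \<xi> (blinfun_apply (S (adj x)) (blinfun_apply (S x) \<xi>)) = complex_of_real ((norm (blinfun_apply (S x) \<xi>))\<^sup>2)"
    using x by (simp add: S_adj cinner_adj cinner_self)
  then show ?thesis
    using S_two_positive[OF x, of "- blinfun_apply (S x) \<xi>" \<xi>]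
    by (simp add: complex_nonneg_Reals_iff cinner_simps cinner_self blinfun.minus_right)
qed

text \<open>The operator \<open>\<parallel>x\<parallel>\<^sup>2 - x\<^sup>*x\<close> is positive, and \<open>S\<close> is unital.\<close>

lemma S_abs_sq_le:
  assumes x: "x \<in> M"
  shows "Re (cinner \<xi> (blinfun_apply (S (abs_sq x)) \<xi>)) \<le> (norm x)\<^sup>2 * (norm \<xi>)\<^sup>2"
proof -
  let ?y = "(norm x)\<^sup>2 *\<^sub>R id_blinfun - abs_sq x"
  have "cinner \<zeta> (blinfun_apply ?y \<zeta>) \<in> \<real>\<^sub>\<ge>\<^sub>0" for \<zeta>
  proof -
    have "cinner \<zeta> (blinfun_apply ?y \<zeta>)
        = complex_of_real ((norm x)\<^sup>2 * (norm \<zeta>)\<^sup>2 - (norm (blinfun_apply x \<zeta>))\<^sup>2)"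
      using cinner_abs_sq[OF x, of \<zeta>]
      by (simp add: blinfun.diff_left blinfun.scaleR_left cinner_diff_right cinner_scaleR_right cinner_self)
    moreover have "(norm (blinfun_apply x \<zeta>))\<^sup>2 \<le> (norm x)\<^sup>2 * (norm \<zeta>)\<^sup>2"
      using norm_blinfun[of x \<zeta>] by (simp add: power_mono flip: power_mult_distrib)
    ultimately show ?thesis by (simp only: complex_nonneg_Reals_iff Re_complex_of_real Im_complex_of_real) simp
  qed
  then have "cinner \<xi> (blinfun_apply (S ?y) \<xi>) \<in> \<real>\<^sub>\<ge>\<^sub>0"
    using x by (intro S_positive) auto
  moreover have "S ?y = (norm x)\<^sup>2 *\<^sub>R id_blinfun - S (abs_sq x)"
    using x by (simp add: S_diff S_scaleR)
  ultimately show ?thesis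
    by (simp add: complex_nonneg_Reals_iff blinfun.diff_left blinfun.scaleR_left cinner_diff_right
        cinner_scaleR_right cinner_self)
qed

lemma contraction:
  assumes x: "x \<in> M" shows "norm (S x) \<le> norm x"
proof (rule norm_blinfun_bound)
  fix \<xi>
  have "(norm (blinfun_apply (S x) \<xi>))\<^sup>2 \<le> (norm x * norm \<xi>)\<^sup>2"
    using schwarz[OF x, of \<xi>] S_abs_sq_le[OF x, of \<xi>] by (simp add: power_mult_distrib)
  then show "norm (blinfun_apply (S x) \<xi>) \<le> norm x * norm \<xi>"
    by (rule power2_le_imp_le) simp
qed simp

lemma norm_S_le_sqrt:
  assumes x: "x \<in> M" shows "norm (S x) \<le> sqrt (norm (S (abs_sq x)))"
proof (rule norm_blinfun_bound)
  fix \<xi>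
  have "(norm (blinfun_apply (S x) \<xi>))\<^sup>2 \<le> Re (cinner \<xi> (blinfun_apply (S (abs_sq x)) \<xi>))"
    by (rule schwarz[OF x])
  also have "\<dots> \<le> norm \<xi> * norm (blinfun_apply (S (abs_sq x)) \<xi>)"
    using Re_cinner_le_norm abs_le_D1 by blast
  also have "\<dots> \<le> norm \<xi> * (norm (S (abs_sq x)) * norm \<xi>)"
    by (intro mult_left_mono norm_blinfun) simp
  also have "\<dots> = (sqrt (norm (S (abs_sq x))) * norm \<xi>)\<^sup>2"
    by (simp add: power_mult_distrib power2_eq_square)
  finally show "norm (blinfun_apply (S x) \<xi>) \<le> sqrt (norm (S (abs_sq x))) * norm \<xi>"
    by (rule power2_le_imp_le) simp
qed simp

end

section \<open>The one-sided stable law of index one half\<close>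

text \<open>An antiderivative of the Gaussian: the kernel and its convolutions have antiderivatives in terms of it.\<close>

definition gauss_int :: "real \<Rightarrow> real" where
  "gauss_int z = (LBINT x=0..ereal z. exp (- x\<^sup>2))"

lemma gauss_int_deriv: "(gauss_int has_real_derivative exp (- z\<^sup>2)) (at z)"
proof -
  define R where "R = \<bar>z\<bar> + 1"
  have "((\<lambda>u. LBINT x=ereal 0..ereal u. exp (- x\<^sup>2)) has_vector_derivative exp (- z\<^sup>2)) (at z within {-R..R})"
    by (rule interval_integral_FTC2) (auto simp: R_def intro!: continuous_intros)
  then have "((\<lambda>u. LBINT x=0..ereal u. exp (- x\<^sup>2)) has_real_derivative exp (- z\<^sup>2)) (at z within {-R..R})"
    by (simp add: has_real_derivative_iff_has_vector_derivative zero_ereal_def)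
  moreover have "at z within {-R..R} = at z"
    by (rule at_within_Icc_at) (auto simp: R_def)
  ultimately show ?thesis by (simp add: gauss_int_def[abs_def])
qed

lemma gauss_int_at_top: "(gauss_int \<longlongrightarrow> sqrt pi / 2) at_top"
proof -
  let ?f = "\<lambda>x::real. indicator {0..} x *\<^sub>R exp (- x\<^sup>2)"
  have b: "has_bochner_integral lborel ?f (sqrt pi / 2)" by (rule gaussian_moment_0)
  have "((\<lambda>y. \<integral>x. indicator {..y} x *\<^sub>R ?f x \<partial>lborel) \<longlongrightarrow> (\<integral>x. ?f x \<partial>lborel)) at_top"
    using b by (intro tendsto_integral_at_top) (auto simp: has_bochner_integral_iff)
  then have "((\<lambda>y. \<integral>x. indicator {..y} x *\<^sub>R ?f x \<partial>lborel) \<longlongrightarrow> sqrt pi / 2) at_top"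
    unfolding has_bochner_integral_integral_eq[OF b] .
  moreover have "\<forall>\<^sub>F y in at_top. (\<integral>x. indicator {..y} x *\<^sub>R ?f x \<partial>lborel) = gauss_int y"
    using eventually_ge_at_top[of 0]
  proof eventually_elim
    case (elim y)
    have "gauss_int y = (LBINT x=ereal 0..ereal y. exp (- x\<^sup>2))" by (simp add: gauss_int_def zero_ereal_def)
    also have "\<dots> = (LBINT x:{0..y}. exp (- x\<^sup>2))" using elim by (simp add: interval_integral_Icc)
    also have "\<dots> = (\<integral>x. indicator {..y} x *\<^sub>R ?f x \<partial>lborel)"
      unfolding set_lebesgue_integral_def
      by (intro Bochner_Integration.integral_cong) (auto simp: indicator_def)
    finally show ?case by simp
  qed
  ultimately show ?thesis by (rule Lim_transform_eventually)
qed

lemma gauss_int_minus: "gauss_int (- z) = - gauss_int z"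
proof -
  have "gauss_int (- z) = (LBINT x=0..ereal (-z). exp (- (-x)\<^sup>2))" by (simp add: gauss_int_def)
  also have "\<dots> = (LBINT x=ereal z..0. exp (- x\<^sup>2))"
    using interval_integral_reflect[of "ereal z" 0 "\<lambda>x. exp (- x\<^sup>2)"] by simp
  also have "\<dots> = - gauss_int z"
    unfolding gauss_int_def by (rule interval_integral_endpoints_reverse)
  finally show ?thesis .
qed

lemma gauss_int_at_bot: "(gauss_int \<longlongrightarrow> - (sqrt pi / 2)) at_bot"
  using tendsto_minus[OF gauss_int_at_top] unfolding filterlim_at_bot_mirror
  by (simp add: gauss_int_minus)

lemma gauss_int_0 [simp]: "gauss_int 0 = 0"
  using gauss_int_minus[of 0] by simp

lemma poisson_kernel_sqrt:
  assumes "0 < u"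
  shows "poisson_kernel t u = t / (2 * sqrt pi) * exp (- (t\<^sup>2 / (4 * u))) / (sqrt u) ^ 3"
proof -
  have "u powr (3 / 2) = u powr (1 / 2) * (u powr (1 / 2) * u powr (1 / 2))"
    by (simp only: powr_add[symmetric]) simp
  also have "\<dots> = (sqrt u) ^ 3" using assms by (simp add: powr_half_sqrt power3_eq_cube)
  finally have "u powr (- 3 / 2) = 1 / (sqrt u) ^ 3"
    using powr_minus_divide[of u "3 / 2"] by simp
  then show ?thesis by (simp add: poisson_kernel_def field_simps)
qed

lemma poisson_kernel_nonneg: "0 \<le> t \<Longrightarrow> 0 \<le> poisson_kernel t u"
  by (simp add: poisson_kernel_def)

lemma poisson_kernel_measurable [measurable]: "poisson_kernel t \<in> borel_measurable borel"
  unfolding poisson_kernel_def[abs_def] by measurable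

lemma poisson_kernel_cont: "0 < u \<Longrightarrow> isCont (poisson_kernel t) u"
  unfolding poisson_kernel_def[abs_def] by (intro continuous_intros) auto

text \<open>The substitution \<open>z = t / (2 \<surd>u)\<close> turns the kernel into a multiple of the Gaussian on \<open>(0, \<infinity>)\<close>.\<close>

lemma poisson_kernel_total:
  assumes "0 < t"
  shows "set_integrable lborel {0<..} (poisson_kernel t)" "(LBINT u:{0<..}. poisson_kernel t u) = 1"
proof -
  let ?G = "\<lambda>u. - (2 / sqrt pi) * gauss_int (t / (2 * sqrt u))"
  have deriv: "DERIV ?G u :> poisson_kernel t u" if "0 < u" for u
  proof -
    have "((\<lambda>u. t / (2 * sqrt u)) has_real_derivative - t / (4 * (sqrt u) ^ 3)) (at u)"
      using that
      by (auto intro!: derivative_eq_intros simp: field_simps power3_eq_cube)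
    from DERIV_chain2[OF gauss_int_deriv this]
    have "DERIV ?G u :> - (2 / sqrt pi) * (exp (- (t / (2 * sqrt u))\<^sup>2) * (- t / (4 * (sqrt u) ^ 3)))"
      by (rule DERIV_cmult)
    moreover have "(t / (2 * sqrt u))\<^sup>2 = t\<^sup>2 / (4 * u)"
      using that by (simp add: power_divide power_mult_distrib)
    ultimately show ?thesis
      using that by (simp add: poisson_kernel_sqrt field_simps)
  qed
  have lim0: "(?G \<longlongrightarrow> - (2 / sqrt pi) * (sqrt pi / 2)) (at_right 0)"
  proof (intro tendsto_mult tendsto_const filterlim_compose[OF gauss_int_at_top])
    show "filterlim (\<lambda>u. t / (2 * sqrt u)) at_top (at_right 0)"
    proof (rule LIM_at_top_divide[OF tendsto_const])
      show "((\<lambda>u. 2 * sqrt u) \<longlongrightarrow> 0) (at_right 0)" by (auto intro!: tendsto_eq_intros)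
    qed (use assms in \<open>auto simp: eventually_at_filter\<close>)
  qed
  have limI: "(?G \<longlongrightarrow> - (2 / sqrt pi) * gauss_int 0) at_top"
  proof (intro tendsto_mult tendsto_const isCont_tendsto_compose[OF DERIV_isCont[OF gauss_int_deriv]])
    show "((\<lambda>u. t / (2 * sqrt u)) \<longlongrightarrow> 0) at_top"
      by (intro tendsto_divide_0[OF tendsto_const] filterlim_at_top_imp_at_infinity
          filterlim_tendsto_pos_mult_at_top[OF tendsto_const] sqrt_at_top) simp
  qed
  have "0 < x \<and> DERIV ?G x :> poisson_kernel t x" if "0 < ereal x" for x
    using that deriv[of x] by (simp add: zero_ereal_def)
  note FTC = interval_integral_FTC_nonneg[of 0 \<infinity> ?G "poisson_kernel t",
      OF _ conjunct2[OF this] poisson_kernel_cont[OF conjunct1[OF this]]]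
  have L: "((?G \<circ> real_of_ereal) \<longlongrightarrow> - (2 / sqrt pi) * (sqrt pi / 2)) (at_right 0)"
    using lim0 by (simp only: ereal_tendsto_simps1 zero_ereal_def)
  have R: "((?G \<circ> real_of_ereal) \<longlongrightarrow> - (2 / sqrt pi) * gauss_int 0) (at_left \<infinity>)"
    using limI by (simp only: ereal_tendsto_simps1)
  have nn: "AE u in lborel. 0 < ereal u \<longrightarrow> ereal u < \<infinity> \<longrightarrow> 0 \<le> poisson_kernel t u"
    using assms by (simp add: poisson_kernel_nonneg)
  have *: "set_integrable lborel (einterval 0 \<infinity>) (poisson_kernel t)"
    "(LBINT u=0..\<infinity>. poisson_kernel t u) = - (2 / sqrt pi) * gauss_int 0 - (- (2 / sqrt pi) * (sqrt pi / 2))"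
    using FTC(1)[OF _ _ _ nn L R] FTC(2)[OF _ _ _ nn L R] by simp_all
  have e: "einterval 0 \<infinity> = {0::real<..}" by (auto simp: einterval_def zero_ereal_def)
  show "set_integrable lborel {0<..} (poisson_kernel t)" using *(1) by (simp add: e)
  show "(LBINT u:{0<..}. poisson_kernel t u) = 1"
    using *(2) by (simp add: interval_integral_to_infinity_eq zero_ereal_def)
qed

text \<open>Put \<open>A = \<surd>u\<close>, \<open>B = \<surd>(w - u)\<close> and \<open>W = \<surd>w\<close>, so that \<open>A\<^sup>2 + B\<^sup>2 = W\<^sup>2\<close>. The squares of
  \<open>z\<^sub>\<minusplus> = (t A/B \<minusplus> s B/A) / (2 W)\<close> differ from the exponent \<open>t\<^sup>2/(4 B\<^sup>2) + s\<^sup>2/(4 A\<^sup>2)\<close> of the product of the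
  two kernels by the constants \<open>(s \<plusminus> t)\<^sup>2/(4 w)\<close>, so the product has an explicit antiderivative: a
  combination of Gaussian integrals at \<open>z\<^sub>-\<close> and \<open>z\<^sub>+\<close>. As \<open>u\<close> runs through \<open>(0, w)\<close>, the argument \<open>z\<^sub>-\<close>
  sweeps the whole line, while \<open>z\<^sub>+\<close> starts and ends at infinity and contributes nothing.\<close>

lemma poisson_kernel_convolution:
  assumes t: "0 < t" and s: "0 < s" and w: "0 < w"
  shows "set_integrable lborel {0<..<w} (\<lambda>u. poisson_kernel t (w - u) * poisson_kernel s u)"
    and "(LBINT u:{0<..<w}. poisson_kernel t (w - u) * poisson_kernel s u) = poisson_kernel (t + s) w"
proof -
  define W where "W = sqrt w"
  have W: "W > 0" "W\<^sup>2 = w" using w by (auto simp: W_def)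
  define zm where "zm u = (t * (sqrt u / sqrt (w - u)) - s * (sqrt (w - u) / sqrt u)) / (2 * W)" for u
  define zp where "zp u = (t * (sqrt u / sqrt (w - u)) + s * (sqrt (w - u) / sqrt u)) / (2 * W)" for u
  define cm where "cm = (s + t) / (2 * pi * W ^ 3) * exp (- ((s + t)\<^sup>2 / (4 * w)))"
  define cp where "cp = (s - t) / (2 * pi * W ^ 3) * exp (- ((s - t)\<^sup>2 / (4 * w)))"
  let ?f = "\<lambda>u. poisson_kernel t (w - u) * poisson_kernel s u"
  let ?G = "\<lambda>u. cm * gauss_int (zm u) + cp * gauss_int (zp u)"
  have deriv: "DERIV ?G u :> ?f u" if u: "0 < u" "u < w" for u
  proof -
    define A B where "A = sqrt u" and "B = sqrt (w - u)"
    have AB: "A > 0" "B > 0" "u = A\<^sup>2" "w - u = B\<^sup>2" "w = A\<^sup>2 + B\<^sup>2"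
      using u by (auto simp: A_def B_def)
    have sAB: "sqrt u = A" "sqrt (w - u) = B" by (simp_all add: A_def B_def)
    have W2: "W\<^sup>2 = A\<^sup>2 + B\<^sup>2" using W(2) AB(5) by simp
    define X Y where "X = 1 / (A * B ^ 3)" and "Y = 1 / (A ^ 3 * B)"
    have dA: "(sqrt has_real_derivative 1 / (2 * A)) (at u)"
      using DERIV_real_sqrt[OF u(1)] by (simp add: A_def field_simps)
    have dB: "((\<lambda>u. sqrt (w - u)) has_real_derivative - 1 / (2 * B)) (at u)"
      using u by (auto intro!: derivative_eq_intros simp: B_def field_simps)
    have d1: "((\<lambda>u. sqrt u / sqrt (w - u)) has_real_derivative W\<^sup>2 / 2 * X) (at u)"
    proof -
      have "((\<lambda>u. sqrt u / sqrt (w - u)) has_real_derivative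
          (1 / (2 * A) * sqrt (w - u) - sqrt u * (- 1 / (2 * B))) / (sqrt (w - u) * sqrt (w - u))) (at u)"
        using u by (intro DERIV_divide dA dB) auto
      also have "(1 / (2 * A) * sqrt (w - u) - sqrt u * (- 1 / (2 * B))) / (sqrt (w - u) * sqrt (w - u))
          = W\<^sup>2 / 2 * X"
        unfolding sAB W2 X_def using AB(1,2)
        by (simp add: field_simps power2_eq_square power3_eq_cube)
      finally show ?thesis .
    qed
    have d2: "((\<lambda>u. sqrt (w - u) / sqrt u) has_real_derivative - (W\<^sup>2 / 2 * Y)) (at u)"
    proof -
      have "((\<lambda>u. sqrt (w - u) / sqrt u) has_real_derivative
          (- 1 / (2 * B) * sqrt u - sqrt (w - u) * (1 / (2 * A))) / (sqrt u * sqrt u)) (at u)"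
        using u by (intro DERIV_divide dA dB) auto
      also have "(- 1 / (2 * B) * sqrt u - sqrt (w - u) * (1 / (2 * A))) / (sqrt u * sqrt u)
          = - (W\<^sup>2 / 2 * Y)"
        unfolding sAB W2 Y_def using AB(1,2)
        by (simp add: field_simps power2_eq_square power3_eq_cube)
      finally show ?thesis .
    qed
    have dm: "(zm has_real_derivative (t * (W\<^sup>2 / 2 * X) - s * (- (W\<^sup>2 / 2 * Y))) / (2 * W)) (at u)"
      unfolding zm_def[abs_def] by (intro DERIV_cdivide DERIV_diff DERIV_cmult d1 d2)
    have dp: "(zp has_real_derivative (t * (W\<^sup>2 / 2 * X) + s * (- (W\<^sup>2 / 2 * Y))) / (2 * W)) (at u)"
      unfolding zp_def[abs_def] by (intro DERIV_cdivide DERIV_add DERIV_cmult d1 d2)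
    have D: "DERIV ?G u :> cm * (exp (- (zm u)\<^sup>2) * ((t * (W\<^sup>2 / 2 * X) - s * (- (W\<^sup>2 / 2 * Y))) / (2 * W)))
       + cp * (exp (- (zp u)\<^sup>2) * ((t * (W\<^sup>2 / 2 * X) + s * (- (W\<^sup>2 / 2 * Y))) / (2 * W)))"
      by (intro DERIV_add DERIV_cmult DERIV_chain2[OF gauss_int_deriv] dm dp)
    define E where "E = exp (- (t\<^sup>2 / (4 * B\<^sup>2) + s\<^sup>2 / (4 * A\<^sup>2)))"
    have em: "exp (- ((s + t)\<^sup>2 / (4 * w))) * exp (- (zm u)\<^sup>2) = E"
    proof -
      have "(s + t)\<^sup>2 / (4 * w) + (zm u)\<^sup>2 = t\<^sup>2 / (4 * B\<^sup>2) + s\<^sup>2 / (4 * A\<^sup>2)"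
      proof -
        have "(s + t)\<^sup>2 + (t * (A / B) - s * (B / A))\<^sup>2 = w * (t\<^sup>2 / B\<^sup>2 + s\<^sup>2 / A\<^sup>2)"
          unfolding AB(5) using AB(1,2) by (simp add: field_simps power2_eq_square)
        then have "((s + t)\<^sup>2 + (t * (A / B) - s * (B / A))\<^sup>2) / (4 * w) = (t\<^sup>2 / B\<^sup>2 + s\<^sup>2 / A\<^sup>2) / 4"
          using w by simp
        then show ?thesis
          unfolding zm_def sAB power_divide power_mult_distrib W(2) by (simp add: add_divide_distrib)
      qed
      then show ?thesis by (simp add: E_def exp_add[symmetric])
    qed
    have ep: "exp (- ((s - t)\<^sup>2 / (4 * w))) * exp (- (zp u)\<^sup>2) = E"
    proof -
      have "(s - t)\<^sup>2 / (4 * w) + (zp u)\<^sup>2 = t\<^sup>2 / (4 * B\<^sup>2) + s\<^sup>2 / (4 * A\<^sup>2)"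
      proof -
        have "(s - t)\<^sup>2 + (t * (A / B) + s * (B / A))\<^sup>2 = w * (t\<^sup>2 / B\<^sup>2 + s\<^sup>2 / A\<^sup>2)"
          unfolding AB(5) using AB(1,2) by (simp add: field_simps power2_eq_square)
        then have "((s - t)\<^sup>2 + (t * (A / B) + s * (B / A))\<^sup>2) / (4 * w) = (t\<^sup>2 / B\<^sup>2 + s\<^sup>2 / A\<^sup>2) / 4"
          using w by simp
        then show ?thesis
          unfolding zp_def sAB power_divide power_mult_distrib W(2) by (simp add: add_divide_distrib)
      qed
      then show ?thesis by (simp add: E_def exp_add[symmetric])
    qed
    have fm: "(t * (W\<^sup>2 / 2 * X) - s * (- (W\<^sup>2 / 2 * Y))) / (2 * W) = W / 4 * (t * X + s * Y)"
      and fp: "(t * (W\<^sup>2 / 2 * X) + s * (- (W\<^sup>2 / 2 * Y))) / (2 * W) = W / 4 * (t * X - s * Y)"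
      using W(1) by (simp_all add: field_simps power2_eq_square)
    have "cm * (exp (- (zm u)\<^sup>2) * ((t * (W\<^sup>2 / 2 * X) - s * (- (W\<^sup>2 / 2 * Y))) / (2 * W)))
       + cp * (exp (- (zp u)\<^sup>2) * ((t * (W\<^sup>2 / 2 * X) + s * (- (W\<^sup>2 / 2 * Y))) / (2 * W)))
       = (s + t) / (2 * pi * W ^ 3) * (exp (- ((s + t)\<^sup>2 / (4 * w))) * exp (- (zm u)\<^sup>2)) * (W / 4 * (t * X + s * Y))
       + (s - t) / (2 * pi * W ^ 3) * (exp (- ((s - t)\<^sup>2 / (4 * w))) * exp (- (zp u)\<^sup>2)) * (W / 4 * (t * X - s * Y))"
      unfolding fm fp cm_def cp_def by (simp only: mult.assoc)
    also have "\<dots> = E * ((s + t) / (2 * pi * W ^ 3) * (W / 4 * (t * X + s * Y))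
        + (s - t) / (2 * pi * W ^ 3) * (W / 4 * (t * X - s * Y)))"
      unfolding em ep by (simp add: algebra_simps)
    also have "(s + t) / (2 * pi * W ^ 3) * (W / 4 * (t * X + s * Y))
        + (s - t) / (2 * pi * W ^ 3) * (W / 4 * (t * X - s * Y)) = s * t / (4 * pi) * ((X + Y) / W\<^sup>2)"
      using W(1) by (simp add: divide_simps power2_eq_square power3_eq_cube) (simp add: algebra_simps)
    also have "(X + Y) / W\<^sup>2 = 1 / (A ^ 3 * B ^ 3)"
    proof -
      have "X + Y = (A\<^sup>2 + B\<^sup>2) / (A ^ 3 * B ^ 3)"
        unfolding X_def Y_def using AB(1,2) by (simp add: field_simps power2_eq_square power3_eq_cube)
      moreover have "A\<^sup>2 + B\<^sup>2 \<noteq> 0" using AB(1,2) by simp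
      ultimately show ?thesis unfolding W2 by simp
    qed
    also have "E * (s * t / (4 * pi) * (1 / (A ^ 3 * B ^ 3))) = ?f u"
    proof -
      have p1: "poisson_kernel t (w - u) = t / (2 * sqrt pi) * exp (- (t\<^sup>2 / (4 * B\<^sup>2))) / B ^ 3"
        using poisson_kernel_sqrt[of "w - u" t, unfolded sAB] u AB(2) by (simp add: AB(4))
      have p2: "poisson_kernel s u = s / (2 * sqrt pi) * exp (- (s\<^sup>2 / (4 * A\<^sup>2))) / A ^ 3"
        using poisson_kernel_sqrt[of u s, unfolded sAB] u AB(1) by (simp add: AB(3))
      have pp: "sqrt pi * (sqrt pi * x) = pi * x" for x by (simp flip: mult.assoc)
      have EE: "E = exp (- (t\<^sup>2 / (4 * B\<^sup>2))) * exp (- (s\<^sup>2 / (4 * A\<^sup>2)))"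
        by (simp add: E_def mult_exp_exp)
      show ?thesis unfolding p1 p2 EE using AB(1,2)
        by (simp add: divide_simps pp)
    qed
    finally show ?thesis using D by simp
  qed
  have cont: "isCont ?f u" if "0 < u" "u < w" for u
    using that by (intro continuous_mult isCont_o2[OF _ poisson_kernel_cont] continuous_intros poisson_kernel_cont) auto
  have lim_ratio0: "((\<lambda>u. sqrt u / sqrt (w - u)) \<longlongrightarrow> 0) (at_right 0)"
    using w by (auto intro!: tendsto_eq_intros)
  have inf_ratio0: "filterlim (\<lambda>u. sqrt (w - u) / sqrt u) at_top (at_right 0)"
  proof (rule LIM_at_top_divide)
    show "((\<lambda>u. sqrt (w - u)) \<longlongrightarrow> sqrt w) (at_right 0)" by (auto intro!: tendsto_eq_intros)
    show "(sqrt \<longlongrightarrow> 0) (at_right 0)" by (auto intro!: tendsto_eq_intros)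
  qed (use w in \<open>auto simp: eventually_at_filter\<close>)
  have lim_ratio1: "((\<lambda>u. sqrt (w - u) / sqrt u) \<longlongrightarrow> 0) (at_left w)"
    using w by (auto intro!: tendsto_eq_intros)
  have inf_ratio1: "filterlim (\<lambda>u. sqrt u / sqrt (w - u)) at_top (at_left w)"
  proof (rule LIM_at_top_divide)
    show "(sqrt \<longlongrightarrow> sqrt w) (at_left w)" by (auto intro!: tendsto_eq_intros)
    show "((\<lambda>u. sqrt (w - u)) \<longlongrightarrow> 0) (at_left w)" by (auto intro!: tendsto_eq_intros)
  qed (use w in \<open>auto simp: eventually_at_filter\<close>)
  have split_m: "zm = (\<lambda>u. t / (2 * W) * (sqrt u / sqrt (w - u)) + (- (s / (2 * W))) * (sqrt (w - u) / sqrt u))"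
    and split_p: "zp = (\<lambda>u. t / (2 * W) * (sqrt u / sqrt (w - u)) + s / (2 * W) * (sqrt (w - u) / sqrt u))"
    by (auto simp: zm_def zp_def add_divide_distrib diff_divide_distrib ac_simps intro!: ext)
  have pos: "t / (2 * W) > 0" "s / (2 * W) > 0" using t s W by auto
  have "filterlim (\<lambda>u. - (t / (2 * W)) * (sqrt u / sqrt (w - u)) + s / (2 * W) * (sqrt (w - u) / sqrt u)) at_top (at_right 0)"
    by (rule filterlim_tendsto_add_at_top[OF tendsto_mult[OF tendsto_const lim_ratio0]
        filterlim_tendsto_pos_mult_at_top[OF tendsto_const pos(2) inf_ratio0]])
  then have m0: "filterlim zm at_bot (at_right 0)"
    unfolding filterlim_uminus_at_bot by (simp add: split_m)
  have p0: "filterlim zp at_top (at_right 0)"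
    unfolding split_p using pos
    by (intro filterlim_tendsto_add_at_top[OF tendsto_mult[OF tendsto_const lim_ratio0]]
        filterlim_tendsto_pos_mult_at_top[OF tendsto_const _ inf_ratio0]) auto
  have m1: "filterlim zm at_top (at_left w)"
    unfolding split_m using pos
    by (subst add.commute, intro filterlim_tendsto_add_at_top[OF tendsto_mult[OF tendsto_const lim_ratio1]]
        filterlim_tendsto_pos_mult_at_top[OF tendsto_const _ inf_ratio1]) auto
  have p1: "filterlim zp at_top (at_left w)"
    unfolding split_p using pos
    by (subst add.commute, intro filterlim_tendsto_add_at_top[OF tendsto_mult[OF tendsto_const lim_ratio1]]
        filterlim_tendsto_pos_mult_at_top[OF tendsto_const _ inf_ratio1]) auto
  have lim0: "(?G \<longlongrightarrow> cm * (- (sqrt pi / 2)) + cp * (sqrt pi / 2)) (at_right 0)"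
    by (intro tendsto_intros filterlim_compose[OF gauss_int_at_bot m0] filterlim_compose[OF gauss_int_at_top p0])
  have lim1: "(?G \<longlongrightarrow> cm * (sqrt pi / 2) + cp * (sqrt pi / 2)) (at_left w)"
    by (intro tendsto_intros filterlim_compose[OF gauss_int_at_top m1] filterlim_compose[OF gauss_int_at_top p1])
  have in_range: "DERIV ?G x :> ?f x" "isCont ?f x" if "ereal 0 < ereal x" "ereal x < ereal w" for x
    using that deriv[of x] cont[of x] by simp_all
  have L: "((?G \<circ> real_of_ereal) \<longlongrightarrow> cm * (- (sqrt pi / 2)) + cp * (sqrt pi / 2)) (at_right (ereal 0))"
    using lim0 by (simp only: ereal_tendsto_simps1)
  have R: "((?G \<circ> real_of_ereal) \<longlongrightarrow> cm * (sqrt pi / 2) + cp * (sqrt pi / 2)) (at_left (ereal w))"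
    using lim1 by (simp only: ereal_tendsto_simps1)
  have nn: "AE u in lborel. ereal 0 < ereal u \<longrightarrow> ereal u < ereal w \<longrightarrow> 0 \<le> ?f u"
    using t s by (simp add: poisson_kernel_nonneg)
  have less: "ereal 0 < ereal w" using w by simp
  note * = interval_integral_FTC_nonneg[OF less in_range nn L R, simplified]
  show "set_integrable lborel {0<..<w} ?f" using *(1) by simp
  have "(LBINT u:{0<..<w}. ?f u) = cm * sqrt pi"
    using interval_integral_FTC_nonneg(2)[OF less in_range nn L R] w by (simp add: interval_integral_Ioo)
  also have "\<dots> = poisson_kernel (t + s) w"
  proof -
    have "cm * sqrt pi = (s + t) / (2 * pi * W ^ 3) * sqrt pi * exp (- ((s + t)\<^sup>2 / (4 * w)))"
      by (simp add: cm_def)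
    also have "(s + t) / (2 * pi * W ^ 3) * sqrt pi = (t + s) / (2 * sqrt pi) / W ^ 3"
      by (simp add: divide_simps add.commute)
    finally show ?thesis
      unfolding poisson_kernel_sqrt[OF w] W_def[symmetric] by (simp add: add.commute)
  qed
  finally show "(LBINT u:{0<..<w}. ?f u) = poisson_kernel (t + s) w" .
qed

text \<open>The law of the one-sided \<open>1/2\<close>-stable subordinator at time \<open>t\<close>. Working with this probability measure
  turns the subordination integrals into expectations of bounded functions.\<close>

definition subordinator :: "real \<Rightarrow> real measure" where
  "subordinator t = density lborel (\<lambda>u. ennreal (indicator {0<..} u * poisson_kernel t u))"

lemma sets_subordinator [measurable_cong, simp]: "sets (subordinator t) = sets borel"
  and space_subordinator [simp]: "space (subordinator t) = UNIV"
  by (simp_all add: subordinator_def)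

lemma indicator_kernel_nonneg: "0 < t \<Longrightarrow> 0 \<le> indicator {0<..} u * poisson_kernel t u"
  by (simp add: poisson_kernel_nonneg)

lemma prob_space_subordinator:
  assumes "0 < t" shows "prob_space (subordinator t)"
proof
  have "emeasure (subordinator t) (space (subordinator t))
      = (\<integral>\<^sup>+u. ennreal (indicator {0<..} u * poisson_kernel t u) \<partial>lborel)"
    by (simp add: subordinator_def emeasure_density)
  also have "\<dots> = ennreal (\<integral>u. indicator {0<..} u * poisson_kernel t u \<partial>lborel)"
    using poisson_kernel_total(1)[OF assms] indicator_kernel_nonneg[OF assms]
    by (intro nn_integral_eq_integral) (auto simp: set_integrable_def)
  also have "\<dots> = 1"
    using poisson_kernel_total(2)[OF assms] by (simp add: set_lebesgue_integral_def)
  finally show "emeasure (subordinator t) (space (subordinator t)) = 1" .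
qed

lemma AE_subordinator_pos: "0 < t \<Longrightarrow> AE u in subordinator t. 0 < u"
  unfolding subordinator_def
  by (subst AE_density) (auto simp: indicator_def split: if_splits)

lemma
  fixes f :: "real \<Rightarrow> 'b::{banach, second_countable_topology}"
  assumes [measurable]: "f \<in> borel_measurable borel" and t: "0 < t"
  shows integrable_subordinator_iff:
      "integrable (subordinator t) f \<longleftrightarrow> set_integrable lborel {0<..} (\<lambda>u. poisson_kernel t u *\<^sub>R f u)"
    and integral_subordinator:
      "(\<integral>u. f u \<partial>subordinator t) = (LBINT u:{0<..}. poisson_kernel t u *\<^sub>R f u)"
  unfolding subordinator_def set_integrable_def set_lebesgue_integral_def
  using indicator_kernel_nonneg[OF t]
  by (simp_all add: integrable_density integral_density)

lemma integrable_subordinator_bounded: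
  fixes f :: "real \<Rightarrow> 'b::{banach, second_countable_topology}"
  assumes "f \<in> borel_measurable borel" "0 < t" "\<And>u. norm (f u) \<le> B"
  shows "integrable (subordinator t) f"
proof -
  interpret prob_space "subordinator t" using assms by (simp add: prob_space_subordinator)
  show ?thesis using assms by (intro integrable_const_bound[of _ B]) auto
qed

lemma subordinator_convolution:
  assumes t: "0 < t" and s: "0 < s"
  shows "(subordinator t \<star> subordinator s) = subordinator (t + s)"
proof -
  interpret T: prob_space "subordinator t" by (rule prob_space_subordinator[OF t])
  interpret S: prob_space "subordinator s" by (rule prob_space_subordinator[OF s])
  let ?p = "\<lambda>t u. indicator {0<..} u * poisson_kernel t u :: real"
  have "(\<integral>\<^sup>+u. ennreal (?p t (w - u)) * ennreal (?p s u) \<partial>lborel) = ennreal (?p (t + s) w)" for w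
  proof (cases "0 < w")
    case True
    let ?f = "\<lambda>u. poisson_kernel t (w - u) * poisson_kernel s u"
    have "(\<integral>\<^sup>+u. ennreal (?p t (w - u)) * ennreal (?p s u) \<partial>lborel)
        = (\<integral>\<^sup>+u. ennreal (indicator {0<..<w} u *\<^sub>R ?f u) \<partial>lborel)"
      using s t by (intro nn_integral_cong)
        (auto simp: indicator_def ennreal_mult[symmetric] poisson_kernel_nonneg)
    also have "\<dots> = ennreal (\<integral>u. indicator {0<..<w} u *\<^sub>R ?f u \<partial>lborel)"
      using poisson_kernel_convolution(1)[OF t s True] s t
      by (intro nn_integral_eq_integral) (auto simp: set_integrable_def poisson_kernel_nonneg)
    also have "\<dots> = ennreal (?p (t + s) w)"
      using poisson_kernel_convolution(2)[OF t s True] True by (simp add: set_lebesgue_integral_def)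
    finally show ?thesis .
  next
    case False
    have zero: "ennreal (?p t (w - u)) * ennreal (?p s u) = 0" for u
      using False by (auto simp: indicator_def)
    show ?thesis unfolding zero using False by simp
  qed
  then show ?thesis
    unfolding subordinator_def
    using T.finite_measure_axioms S.finite_measure_axioms
    by (subst convolution_density) (simp_all add: subordinator_def)
qed

text \<open>The semigroup law of the Poisson semigroup, in the form in which it is used: adding independent
  subordinator times.\<close>

lemma subordinator_integral_add:
  fixes k :: "real \<Rightarrow> complex"
  assumes [measurable]: "k \<in> borel_measurable borel" and t: "0 < t" and s: "0 < s"
    and bound: "\<And>u. norm (k u) \<le> B"
  shows "(\<integral>u. (\<integral>v. k (u + v) \<partial>subordinator s) \<partial>subordinator t) = (\<integral>w. k w \<partial>subordinator (t + s))"
proof -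
  interpret T: prob_space "subordinator t" by (rule prob_space_subordinator[OF t])
  interpret S: prob_space "subordinator s" by (rule prob_space_subordinator[OF s])
  interpret P: pair_prob_space "subordinator t" "subordinator s" ..
  have [measurable]: "(\<lambda>(u, v). k (u + v)) \<in> borel_measurable (subordinator t \<Otimes>\<^sub>M subordinator s)"
    by measurable
  have int: "integrable (subordinator t \<Otimes>\<^sub>M subordinator s) (\<lambda>(u, v). k (u + v))"
    by (rule P.P.integrable_const_bound[of _ B]) (auto simp: bound)
  have "(\<integral>w. k w \<partial>subordinator (t + s)) = (\<integral>z. k (case z of (u, v) \<Rightarrow> u + v) \<partial>(subordinator t \<Otimes>\<^sub>M subordinator s))"
    unfolding subordinator_convolution[OF t s, symmetric] convolution_def
    by (subst integral_distr) auto
  also have "(\<lambda>z. k (case z of (u, v) \<Rightarrow> u + v)) = (\<lambda>(u, v). k (u + v))"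
    by (rule ext) (simp only: split_paired_all prod.case)
  also have "(\<integral>z. (\<lambda>(u, v). k (u + v)) z \<partial>(subordinator t \<Otimes>\<^sub>M subordinator s))
      = (\<integral>u. (\<integral>v. k (u + v) \<partial>subordinator s) \<partial>subordinator t)"
    using P.integral_fst'[OF int] by (simp only: prod.case)
  finally show ?thesis by (rule sym)
qed

text \<open>The density \<open>p\<^sub>t(u)\<close> is \<open>t\<close> times a decreasing function of \<open>t\<close>, hence \<open>p\<^sub>2\<^sub>t \<le> 2 p\<^sub>t\<close>.\<close>

lemma subordinator_integral_double_le:
  fixes k :: "real \<Rightarrow> real"
  assumes [measurable]: "k \<in> borel_measurable borel" and t: "0 < t"
    and bound: "\<And>u. \<bar>k u\<bar> \<le> B" and nonneg: "\<And>u. 0 \<le> k u"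
  shows "(\<integral>u. k u \<partial>subordinator (2 * t)) \<le> 2 * (\<integral>u. k u \<partial>subordinator t)"
proof -
  have i: "set_integrable lborel {0<..} (\<lambda>u. poisson_kernel r u *\<^sub>R k u)" if "0 < r" for r
  proof -
    have "integrable (subordinator r) k"
      by (rule integrable_subordinator_bounded[OF assms(1) that, of B]) (simp only: real_norm_def bound)
    then show ?thesis by (simp only: integrable_subordinator_iff[OF assms(1) that])
  qed
  have le: "poisson_kernel (2 * t) u \<le> 2 * poisson_kernel t u" if "0 < u" for u
  proof -
    have "t\<^sup>2 / (4 * u) \<le> (2 * t)\<^sup>2 / (4 * u)"
      using that by (intro divide_right_mono) (auto simp: power_mult_distrib)
    then have "exp (- (2 * t)\<^sup>2 / (4 * u)) \<le> exp (- t\<^sup>2 / (4 * u))" by simp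
    then have "1 / (2 * sqrt pi) * (2 * t) * u powr (- 3 / 2) * exp (- (2 * t)\<^sup>2 / (4 * u))
      \<le> 1 / (2 * sqrt pi) * (2 * t) * u powr (- 3 / 2) * exp (- t\<^sup>2 / (4 * u))"
      using t by (intro mult_left_mono) auto
    then show ?thesis by (simp add: poisson_kernel_def mult_ac)
  qed
  have "(LBINT u:{0<..}. poisson_kernel (2 * t) u *\<^sub>R k u)
      \<le> (LBINT u:{0<..}. 2 * (poisson_kernel t u *\<^sub>R k u))"
  proof (rule set_integral_mono)
    show "set_integrable lborel {0<..} (\<lambda>u. 2 * (poisson_kernel t u *\<^sub>R k u))"
      using i[OF t] by (rule set_integrable_mult_right)
    show "poisson_kernel (2 * t) u *\<^sub>R k u \<le> 2 * (poisson_kernel t u *\<^sub>R k u)" if "u \<in> {0<..}" for u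
      using mult_right_mono[OF le[of u] nonneg[of u]] that by simp
  qed (use i[of "2 * t"] t in simp)
  then show ?thesis
    using t by (simp add: integral_subordinator)
qed

text \<open>The densities satisfy \<open>v\<^sup>2 p\<^sub>v(v\<^sup>2 r) = p\<^sub>1(r)\<close>: the random time scales like \<open>v\<^sup>2\<close>.\<close>

lemma subordinator_scale:
  assumes v: "0 < v"
  shows "subordinator v = distr (subordinator 1) borel (\<lambda>r. v\<^sup>2 * r)"
proof (rule measure_eqI)
  fix A assume "A \<in> sets (subordinator v)"
  then have [measurable]: "A \<in> sets borel" by simp
  let ?p = "\<lambda>t u. indicator {0<..} u * poisson_kernel t u :: real"
  have p: "v\<^sup>2 * ?p v (v\<^sup>2 * r) = ?p 1 r" for r
  proof (cases "0 < r")
    case True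
    have "sqrt (v\<^sup>2 * r) = v * sqrt r" using v by (simp add: real_sqrt_mult)
    moreover have "v\<^sup>2 / (4 * (v\<^sup>2 * r)) = 1 / (4 * r)" using v by simp
    ultimately show ?thesis
      using True v by (simp add: poisson_kernel_sqrt zero_less_mult_iff power_mult_distrib)
        (simp add: power2_eq_square power3_eq_cube)
  qed (use v in \<open>simp add: zero_less_mult_iff\<close>)
  have "emeasure (subordinator v) A = (\<integral>\<^sup>+u. ennreal (?p v u) * indicator A u \<partial>lborel)"
    by (simp add: subordinator_def emeasure_density)
  also have "\<dots> = ennreal \<bar>v\<^sup>2\<bar> * (\<integral>\<^sup>+r. ennreal (?p v (0 + v\<^sup>2 * r)) * indicator A (0 + v\<^sup>2 * r) \<partial>lborel)"
    using v by (subst nn_integral_real_affine[where c = "v\<^sup>2" and t = 0]) auto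
  also have "\<dots> = (\<integral>\<^sup>+r. ennreal (?p 1 r) * indicator A (v\<^sup>2 * r) \<partial>lborel)"
    using v by (subst nn_integral_cmult[symmetric])
      (auto simp: p[symmetric] ennreal_mult indicator_kernel_nonneg mult.assoc intro!: nn_integral_cong)
  also have "\<dots> = (\<integral>\<^sup>+r. indicator A (v\<^sup>2 * r) \<partial>subordinator 1)"
    by (simp add: subordinator_def nn_integral_density)
  also have "\<dots> = emeasure (distr (subordinator 1) borel (\<lambda>r. v\<^sup>2 * r)) A"
    by (subst nn_integral_indicator[symmetric], simp, subst nn_integral_distr) auto
  finally show "emeasure (subordinator v) A = emeasure (distr (subordinator 1) borel (\<lambda>r. v\<^sup>2 * r)) A" .
qed simp

lemma integral_subordinator_scale:
  fixes f :: "real \<Rightarrow> 'b::{banach, second_countable_topology}"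
  assumes "0 < v" "f \<in> borel_measurable borel"
  shows "(\<integral>u. f u \<partial>subordinator v) = (\<integral>r. f (v\<^sup>2 * r) \<partial>subordinator 1)"
    and "integrable (subordinator v) f \<longleftrightarrow> integrable (subordinator 1) (\<lambda>r. f (v\<^sup>2 * r))"
  unfolding subordinator_scale[OF assms(1)] using assms(2)
  by (simp_all add: integral_distr integrable_distr_eq)

text \<open>The density behaves like \<open>r\<^sup>-\<^sup>3\<^sup>/\<^sup>2\<close> at infinity, which forces \<open>b < 1/2\<close>, and vanishes faster than any
  power at zero. The lower bound on \<open>b\<close> lets one cubic estimate of the exponential suffice near zero.\<close>

lemma subordinator_moment_integrable:
  assumes b: "-1 \<le> b" "b < 1 / 2"
  shows "integrable (subordinator 1) (\<lambda>r. r powr b)"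
proof -
  have tail: "set_integrable lborel {1<..} (\<lambda>r::real. r powr (b - 3 / 2))"
  proof -
    have "set_integrable lborel (einterval 1 \<infinity>) (\<lambda>r::real. r powr (b - 3 / 2))"
    proof (rule interval_integral_FTC_nonneg(1)[where F = "\<lambda>r. r powr (b - 1 / 2) / (b - 1 / 2)"])
      show "DERIV (\<lambda>r. r powr (b - 1 / 2) / (b - 1 / 2)) x :> x powr (b - 3 / 2)" if "1 < ereal x" for x
      proof -
        have "x > 0" using that by simp
        then have "((\<lambda>r. r powr (b - 1 / 2)) has_real_derivative (b - 1 / 2) * x powr (b - 1 / 2 - 1)) (at x)"
          by (rule has_real_derivative_powr)
        from DERIV_cdivide[OF this, of "b - 1 / 2"] show ?thesis using b by simp
      qed
      show "isCont (\<lambda>r. r powr (b - 3 / 2)) x" if "1 < ereal x" for x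
        using that by (intro continuous_intros) auto
      show "(((\<lambda>r. r powr (b - 1 / 2) / (b - 1 / 2)) \<circ> real_of_ereal) \<longlongrightarrow> 1 / (b - 1 / 2)) (at_right 1)"
        unfolding one_ereal_def ereal_tendsto_simps1 using b by (auto intro!: tendsto_eq_intros)
      show "(((\<lambda>r. r powr (b - 1 / 2) / (b - 1 / 2)) \<circ> real_of_ereal) \<longlongrightarrow> 0) (at_left \<infinity>)"
        unfolding ereal_tendsto_simps1
        using b by (intro tendsto_divide_zero tendsto_neg_powr filterlim_ident) auto
    qed auto
    moreover have "einterval 1 \<infinity> = {1::real<..}" by (auto simp: einterval_def one_ereal_def)
    ultimately show ?thesis by simp
  qed
  have "set_integrable lborel {0<..1} (\<lambda>r::real. 1728)"
    by (simp add: set_integrable_def)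
  note int = Bochner_Integration.integrable_add[OF tail[unfolded set_integrable_def] this[unfolded set_integrable_def]]
  have ptw: "\<bar>poisson_kernel 1 r * r powr b\<bar> \<le> indicator {1<..} r *\<^sub>R r powr (b - 3 / 2) + indicator {0<..1} r *\<^sub>R 1728"
    if r: "0 < r" for r
  proof -
    let ?c = "1 / (2 * sqrt pi)"
    have "1 \<le> sqrt pi" using pi_gt3 by simp
    then have "?c \<le> 1 / 1" by (intro divide_left_mono) (linarith, auto)
    then have c: "0 \<le> ?c" "?c \<le> 1" by auto
    have K: "poisson_kernel 1 r * r powr b = ?c * (exp (- 1 / (4 * r)) * r powr (b - 3 / 2))"
      by (simp add: poisson_kernel_def powr_add[symmetric])
    have nn: "0 \<le> exp (- 1 / (4 * r)) * r powr (b - 3 / 2)" by simp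
    have le1: "\<bar>poisson_kernel 1 r * r powr b\<bar> \<le> exp (- 1 / (4 * r)) * r powr (b - 3 / 2)"
      unfolding K using mult_right_mono[OF c(2) nn] c(1) nn by simp
    show ?thesis
    proof (cases "1 < r")
      case True
      have "exp (- 1 / (4 * r)) * r powr (b - 3 / 2) \<le> 1 * r powr (b - 3 / 2)"
        using r by (intro mult_right_mono) auto
      from order_trans[OF le1 this] show ?thesis using True by simp
    next
      case False
      \<comment> \<open>The cube of \<open>x \<le> exp x\<close> at \<open>x = 1 / (12 r)\<close>; the constant is \<open>12\<^sup>3\<close>.\<close>
      have "(1 / (12 * r)) ^ 3 \<le> exp (1 / (12 * r)) ^ 3"
        using r by (intro power_mono order_trans[OF _ exp_ge_add_one_self]) auto
      also have "\<dots> = exp (1 / (4 * r))"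
        using r by (simp add: exp_of_nat_mult[symmetric])
      finally have "exp (- 1 / (4 * r)) \<le> 1728 * r ^ 3"
        using r by (simp add: exp_minus field_simps power3_eq_cube)
      then have "exp (- 1 / (4 * r)) * r powr (b - 3 / 2) \<le> 1728 * r ^ 3 * r powr (b - 3 / 2)"
        by (intro mult_right_mono) auto
      also have "\<dots> = 1728 * r powr (b + 3 / 2)"
      proof -
        have "r ^ 3 * r powr (b - 3 / 2) = r powr (3 + (b - 3 / 2))"
          unfolding powr_add using r by simp
        then show ?thesis by (simp add: mult.assoc add.commute)
      qed
      also have "\<dots> \<le> 1728" using r False b by (simp add: powr_le_one_le powr_le1)
      finally show ?thesis using le1 False r by simp
    qed
  qed
  have "set_integrable lborel {0<..} (\<lambda>r. poisson_kernel 1 r *\<^sub>R r powr b)"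
    unfolding set_integrable_def
  proof (rule Bochner_Integration.integrable_bound[OF int])
    show "AE r in lborel. norm (indicator {0<..} r *\<^sub>R (poisson_kernel 1 r *\<^sub>R r powr b))
        \<le> norm (indicator {1<..} r *\<^sub>R r powr (b - 3 / 2) + indicator {0<..1} r *\<^sub>R (1728::real))"
    proof (rule AE_I2)
      fix r :: real
      show "norm (indicator {0<..} r *\<^sub>R (poisson_kernel 1 r *\<^sub>R r powr b))
          \<le> norm (indicator {1<..} r *\<^sub>R r powr (b - 3 / 2) + indicator {0<..1} r *\<^sub>R (1728::real))"
        using ptw[of r] by (cases "0 < r") (auto simp: indicator_def)
    qed
  qed measurable
  then show ?thesis by (simp add: integrable_subordinator_iff)
qed

lemma subordinator_moment:
  assumes v: "0 < v" and b: "-1 \<le> b" "b < 1 / 2"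
  shows "integrable (subordinator v) (\<lambda>r. r powr b)"
    and "(\<integral>r. r powr b \<partial>subordinator v) = v powr (2 * b) * (\<integral>r. r powr b \<partial>subordinator 1)"
proof -
  have ae: "AE r in subordinator 1. (v\<^sup>2 * r) powr b = v powr (2 * b) * r powr b"
    using AE_subordinator_pos[of 1, simplified]
  proof (eventually_elim)
    case (elim r)
    have "(v\<^sup>2) powr b = (v powr 2) powr b" using v by simp
    then have "(v\<^sup>2) powr b = v powr (2 * b)" by (simp only: powr_powr)
    then show ?case using elim v by (simp add: powr_mult)
  qed
  have "integrable (subordinator 1) (\<lambda>r. v powr (2 * b) * r powr b)"
    using subordinator_moment_integrable[OF b] by simp
  then have "integrable (subordinator 1) (\<lambda>r. (v\<^sup>2 * r) powr b)"
    by (subst integrable_cong_AE[OF _ _ ae]) auto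
  then show "integrable (subordinator v) (\<lambda>r. r powr b)"
    using integral_subordinator_scale(2)[OF v, of "\<lambda>r. r powr b"] by simp
  have "(\<integral>r. r powr b \<partial>subordinator v) = (\<integral>r. (v\<^sup>2 * r) powr b \<partial>subordinator 1)"
    using integral_subordinator_scale(1)[OF v, of "\<lambda>r. r powr b"] by simp
  also have "\<dots> = (\<integral>r. v powr (2 * b) * r powr b \<partial>subordinator 1)"
    by (rule integral_cong_AE[OF _ _ ae]) auto
  finally show "(\<integral>r. r powr b \<partial>subordinator v) = v powr (2 * b) * (\<integral>r. r powr b \<partial>subordinator 1)"
    by simp
qed

text \<open>Two probability densities differ in \<open>L\<^sup>1\<close> by twice the integral of the positive part of their
  difference. For the density \<open>p\<close> and its translate this part is controlled by
  \<open>p(r + u) \<ge> (r/(r + u))\<^sup>3\<^sup>/\<^sup>2 p(r)\<close>, because the exponential factor increases. So the law moves in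
  total variation by at most a multiple of \<open>u\<close> times the moment of order \<open>-1\<close>.\<close>

lemma subordinator_shift:
  fixes k :: "real \<Rightarrow> complex"
  assumes [measurable]: "k \<in> borel_measurable borel" and v: "0 < v" and u: "0 \<le> u"
    and bound: "\<And>r. norm (k r) \<le> B"
  shows "norm ((\<integral>r. k (r + u) \<partial>subordinator v) - (\<integral>r. k r \<partial>subordinator v))
      \<le> 4 * u * B * (\<integral>r. r powr (-1) \<partial>subordinator v)"
proof -
  define p where "p r = indicator {0<..} r * poisson_kernel v r" for r :: real
  have [measurable]: "p \<in> borel_measurable borel" unfolding p_def by measurable
  have B: "0 \<le> B" using bound[of 0] norm_ge_zero order_trans by blast
  have pnn: "0 \<le> p r" for r using v by (simp add: p_def poisson_kernel_nonneg)
  have p_int: "integrable lborel p" "integral\<^sup>L lborel p = 1"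
    using poisson_kernel_total[OF v] unfolding set_integrable_def set_lebesgue_integral_def p_def by simp_all
  have ps_int: "integrable lborel (\<lambda>r. p (r + u))" "(\<integral>r. p (r + u) \<partial>lborel) = 1"
    using lborel_integrable_real_affine[OF p_int(1), of 1 u] lborel_integral_real_affine[of 1 p u] p_int(2)
    by (simp_all add: add.commute)
  have k_int: "integrable lborel (\<lambda>r. g r *\<^sub>R h r)"
    if "integrable lborel g" "h \<in> borel_measurable borel" "\<And>r. norm (h r) \<le> B" for g :: "real \<Rightarrow> real" and h :: "real \<Rightarrow> complex"
  proof (rule Bochner_Integration.integrable_bound)
    show "integrable lborel (\<lambda>r. B * g r)" using that(1) by simp
    show "AE r in lborel. norm (g r *\<^sub>R h r) \<le> norm (B * g r)"
    proof (rule AE_I2)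
      fix r
      have "\<bar>g r\<bar> * norm (h r) \<le> \<bar>g r\<bar> * B" by (intro mult_left_mono that(3)) simp
      then show "norm (g r *\<^sub>R h r) \<le> norm (B * g r)" using B by (simp add: abs_mult mult.commute)
    qed
    show "(\<lambda>r. g r *\<^sub>R h r) \<in> borel_measurable lborel" using that(1,2) by measurable
  qed
  have I: "(\<integral>r. h r \<partial>subordinator v) = (\<integral>r. p r *\<^sub>R h r \<partial>lborel)" if "h \<in> borel_measurable borel" for h :: "real \<Rightarrow> complex"
    using integral_subordinator[OF that v] by (simp add: set_lebesgue_integral_def p_def)
  have "(\<integral>r. k r \<partial>subordinator v) = (\<integral>r. p (r + u) *\<^sub>R k (r + u) \<partial>lborel)"
    using lborel_integral_real_affine[of 1 "\<lambda>r. p r *\<^sub>R k r" u] by (simp add: I add.commute)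
  then have "(\<integral>r. k (r + u) \<partial>subordinator v) - (\<integral>r. k r \<partial>subordinator v)
      = (\<integral>r. (p r - p (r + u)) *\<^sub>R k (r + u) \<partial>lborel)"
    using k_int[OF p_int(1), of "\<lambda>r. k (r + u)"] k_int[OF ps_int(1), of "\<lambda>r. k (r + u)"] bound
    by (simp add: I scaleR_left_diff_distrib Bochner_Integration.integral_diff)
  also have "norm \<dots> \<le> (\<integral>r. norm ((p r - p (r + u)) *\<^sub>R k (r + u)) \<partial>lborel)"
    by (rule integral_norm_bound)
  also have "\<dots> \<le> (\<integral>r. B * (2 * max 0 (p r - p (r + u)) - (p r - p (r + u))) \<partial>lborel)"
  proof (rule integral_mono)
    show "integrable lborel (\<lambda>r. norm ((p r - p (r + u)) *\<^sub>R k (r + u)))"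
      using k_int[of "\<lambda>r. p r - p (r + u)" "\<lambda>r. k (r + u)"] p_int ps_int bound by (intro integrable_norm) auto
    show "integrable lborel (\<lambda>r. B * (2 * max 0 (p r - p (r + u)) - (p r - p (r + u))))"
      using p_int ps_int by auto
    show "norm ((p r - p (r + u)) *\<^sub>R k (r + u)) \<le> B * (2 * max 0 (p r - p (r + u)) - (p r - p (r + u)))" for r
    proof -
      have "norm ((p r - p (r + u)) *\<^sub>R k (r + u)) \<le> \<bar>p r - p (r + u)\<bar> * B"
        using bound by (simp add: mult_left_mono)
      also have "\<bar>p r - p (r + u)\<bar> = 2 * max 0 (p r - p (r + u)) - (p r - p (r + u))" by (simp add: max_def)
      finally show ?thesis by (simp add: mult.commute)
    qed
  qed
  also have "\<dots> = 2 * B * (\<integral>r. max 0 (p r - p (r + u)) \<partial>lborel)"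
    using p_int ps_int by (simp add: Bochner_Integration.integral_diff)
  also have "\<dots> \<le> 2 * B * (\<integral>r. 2 * u * (p r * r powr (-1)) \<partial>lborel)"
  proof (intro mult_left_mono integral_mono)
    have "integrable (subordinator v) (\<lambda>r. r powr (-1))" by (rule subordinator_moment(1)[OF v]) auto
    then have "integrable lborel (\<lambda>r. p r * r powr (-1))"
      using v by (simp add: integrable_subordinator_iff set_integrable_def p_def mult.assoc)
    then show "integrable lborel (\<lambda>r. 2 * u * (p r * r powr (-1)))" by (rule integrable_mult_right)
    show "integrable lborel (\<lambda>r. max 0 (p r - p (r + u)))" using p_int ps_int by auto
    show "max 0 (p r - p (r + u)) \<le> 2 * u * (p r * r powr (-1))" for r
    proof (cases "0 < r")
      case False
      then have "p r = 0" by (simp add: p_def)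
      then show ?thesis using pnn[of "r + u"] by simp
    next
      case True
      define x where "x = r / (r + u)"
      have x: "0 < x" "x \<le> 1" using True u by (auto simp: x_def)
      have pr: "p r = 1 / (2 * sqrt pi) * v * exp (- v\<^sup>2 / (4 * r)) * r powr (- 3 / 2)"
        and pru: "p (r + u) = 1 / (2 * sqrt pi) * v * exp (- v\<^sup>2 / (4 * (r + u))) * (r + u) powr (- 3 / 2)"
        using True u by (simp_all add: p_def poisson_kernel_def)
      have r: "r = x * (r + u)" using True u by (simp add: x_def)
      have "x\<^sup>2 \<le> x powr (3 / 2)"
        using powr_mono'[of "3/2" 2 x] x by simp
      have "(r + u) powr (- 3 / 2) = x powr (3 / 2) * r powr (- 3 / 2)"
      proof -
        have "r powr (- 3 / 2) = x powr (- 3 / 2) * (r + u) powr (- 3 / 2)"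
          using x True u by (subst r) (simp add: powr_mult)
        then show ?thesis using x by (simp add: powr_minus field_simps)
      qed
      moreover have "exp (- v\<^sup>2 / (4 * r)) \<le> exp (- v\<^sup>2 / (4 * (r + u)))"
        using True u by (simp add: frac_le)
      ultimately have "p (r + u) \<ge> 1 / (2 * sqrt pi) * v * exp (- v\<^sup>2 / (4 * r)) * (x powr (3 / 2) * r powr (- 3 / 2))"
        unfolding pru using v by (simp add: divide_right_mono mult_right_mono)
      then have "x powr (3 / 2) * p r \<le> p (r + u)" by (simp add: pr mult_ac)
      moreover have "x\<^sup>2 * p r \<le> x powr (3 / 2) * p r"
        using \<open>x\<^sup>2 \<le> x powr (3 / 2)\<close> pnn by (rule mult_right_mono)
      ultimately have "p r - p (r + u) \<le> (1 - x\<^sup>2) * p r" by (simp add: algebra_simps)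
      also have "\<dots> \<le> (2 * u / r) * p r"
      proof (rule mult_right_mono[OF _ pnn])
        have "1 - x\<^sup>2 = (1 - x) * (1 + x)" by (simp add: power2_eq_square algebra_simps)
        also have "\<dots> \<le> (1 - x) * 2" using x by (intro mult_left_mono) auto
        also have "1 - x = u / (r + u)" using True u by (simp add: x_def field_simps)
        also have "\<dots> \<le> u / r" using True u by (intro divide_left_mono) auto
        finally show "1 - x\<^sup>2 \<le> 2 * u / r" by (simp add: mult.commute)
      qed
      finally have "p r - p (r + u) \<le> 2 * u * (p r * r powr (-1))"
        using True by (simp add: powr_minus_divide)
      moreover have "0 \<le> 2 * u * (p r * r powr (-1))" using u pnn by simp
      ultimately show ?thesis by simp
    qed
  qed (use B in simp)
  also have "(\<integral>r. 2 * u * (p r * r powr (-1)) \<partial>lborel) = 2 * u * (\<integral>r. r powr (-1) \<partial>subordinator v)"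
  proof -
    have "(\<integral>r. r powr (-1) \<partial>subordinator v) = (\<integral>r. p r * r powr (-1) \<partial>lborel)"
      using integral_subordinator[of "\<lambda>r. r powr (-1)" v] v
      by (simp add: set_lebesgue_integral_def p_def mult.assoc)
    then show ?thesis by (simp only: Bochner_Integration.integral_mult_right_zero)
  qed
  finally show ?thesis by (simp add: mult_ac)
qed

section \<open>The subordinated Poisson semigroup\<close>

text \<open>The function is the pointwise limit of step functions that take its values at the grid points
  immediately to the right. Orbits of the semigroup are weakly right continuous directly from the
  semigroup law.\<close>

lemma right_continuous_measurable:
  fixes g :: "real \<Rightarrow> complex"
  assumes "\<And>u. (g \<longlongrightarrow> g u) (at_right u)"
  shows "g \<in> borel_measurable borel"
proof (rule borel_measurable_LIMSEQ_metric)
  let ?r = "\<lambda>n u. (real_of_int \<lfloor>real (Suc n) * u\<rfloor> + 1) / real (Suc n)"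
  show "(\<lambda>u. g (?r n u)) \<in> borel_measurable borel" for n
  proof -
    have "(\<lambda>u. \<lfloor>real (Suc n) * u\<rfloor>) \<in> measurable borel (count_space UNIV)" by measurable
    from measurable_compose[OF this, of "\<lambda>k. g ((real_of_int k + 1) / real (Suc n))" borel]
    show ?thesis by simp
  qed
  show "(\<lambda>n. g (?r n u)) \<longlonglongrightarrow> g u" for u
  proof (rule filterlim_compose[OF assms])
    have gt: "u < ?r n u" for n
    proof -
      have "real (Suc n) * u < real_of_int \<lfloor>real (Suc n) * u\<rfloor> + 1" by linarith
      then show ?thesis by (simp add: field_simps)
    qed
    have le: "?r n u \<le> u + 1 / real (Suc n)" for n
    proof -
      have "?r n u \<le> (real (Suc n) * u + 1) / real (Suc n)"
        by (intro divide_right_mono add_right_mono of_int_floor_le) simp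
      also have "\<dots> = u + 1 / real (Suc n)" by (simp add: add_divide_distrib del: of_nat_Suc)
      finally show ?thesis .
    qed
    have "(\<lambda>n. u + 1 / real (Suc n)) \<longlonglongrightarrow> u + 0"
      by (intro tendsto_intros LIMSEQ_inverse_real_of_nat[unfolded inverse_eq_divide])
    then have "(\<lambda>n. ?r n u) \<longlonglongrightarrow> u"
      using gt le by (intro tendsto_sandwich[of "\<lambda>_. u" "\<lambda>n. ?r n u" sequentially "\<lambda>n. u + 1 / real (Suc n)"])
        (auto intro!: always_eventually less_imp_le)
    then show "filterlim (\<lambda>n. ?r n u) (at_right u) sequentially"
      unfolding filterlim_at using gt by (auto intro!: always_eventually simp: less_imp_neq[symmetric])
  qed
qed

lemma sesquilinear_form_operator:
  fixes B :: "'h::chilbert_space \<Rightarrow> 'h \<Rightarrow> complex"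
  assumes add_left: "\<And>x y z. B (x + y) z = B x z + B y z"
    and scale_left: "\<And>c x z. B (c *\<^sub>C x) z = cnj c * B x z"
    and add_right: "\<And>x y z. B x (y + z) = B x y + B x z"
    and scale_right: "\<And>c x z. B x (c *\<^sub>C z) = c * B x z"
    and bound: "\<And>x y. cmod (B x y) \<le> C * norm x * norm y" and "0 \<le> C"
  obtains Y :: "'h op" where "Y \<in> bounded_ops" "\<And>\<xi> \<eta>. cinner \<xi> (blinfun_apply Y \<eta>) = B \<xi> \<eta>"
proof -
  have "\<exists>z. \<forall>\<xi>. B \<xi> \<eta> = cinner \<xi> z" for \<eta>
  proof (rule riesz_representation[of "\<lambda>\<xi>. cnj (B \<xi> \<eta>)" "C * norm \<eta>"])
    fix z assume z: "\<And>\<xi>. cnj (B \<xi> \<eta>) = cinner z \<xi>"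
    have "B \<xi> \<eta> = cinner \<xi> z" for \<xi>
      using arg_cong[OF z[of \<xi>], of cnj] cinner_commute[of \<xi> z] by simp
    then show "\<exists>z. \<forall>\<xi>. B \<xi> \<eta> = cinner \<xi> z" by blast
  qed (use bound in \<open>simp_all add: add_left scale_left mult_ac\<close>)
  then obtain y where y: "\<And>\<xi> \<eta>. B \<xi> \<eta> = cinner \<xi> (y \<eta>)" by metis
  have y_add: "y (\<eta> + \<zeta>) = y \<eta> + y \<zeta>" for \<eta> \<zeta>
    by (rule cinner_eqI) (simp add: y[symmetric] cinner_simps add_right)
  have y_scale: "y (c *\<^sub>C \<eta>) = c *\<^sub>C y \<eta>" for c \<eta>
    by (rule cinner_eqI) (simp add: y[symmetric] cinner_simps scale_right)
  have y_norm: "norm (y \<eta>) \<le> norm \<eta> * C" for \<eta>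
    by (rule norm_le_of_cinner) (use bound \<open>0 \<le> C\<close> in \<open>simp_all add: y[symmetric] mult_ac\<close>)
  have "bounded_linear y"
    by (rule bounded_linear_intro[of y C]) (use y_add y_scale y_norm in \<open>simp_all flip: scaleC_of_real\<close>)
  then have "blinfun_apply (Blinfun y) = y" by (rule bounded_linear_Blinfun_apply)
  then show thesis
    by (intro that[of "Blinfun y"]) (simp_all add: bounded_ops_def y_scale y)
qed

locale markov = vna M for M :: "'h::chilbert_space op set" +
  fixes \<tau> :: "'h op \<Rightarrow> complex" and T :: "real \<Rightarrow> 'h op \<Rightarrow> 'h op"
  assumes markov: "markov_semigroup M \<tau> T"
begin

lemma T_ucp: "0 \<le> t \<Longrightarrow> ucp_map M (T t)"
  using markov by (intro ucp_map.intro vna_axioms ucp_map_axioms.intro) (simp add: ucp_def markov_semigroup_def)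

lemma T_M [simp]: "0 \<le> t \<Longrightarrow> f \<in> M \<Longrightarrow> T t f \<in> M"
  by (rule ucp_map.S_M[OF T_ucp])

lemma T_semigroup: "0 \<le> t \<Longrightarrow> 0 \<le> s \<Longrightarrow> f \<in> M \<Longrightarrow> T t (T s f) = T (t + s) f"
  using markov by (simp add: markov_semigroup_def)

lemma T_contraction: "0 \<le> t \<Longrightarrow> f \<in> M \<Longrightarrow> norm (T t f) \<le> norm f"
  by (rule ucp_map.contraction[OF T_ucp])

lemma T_weak_star_continuous: "0 \<le> t \<Longrightarrow> continuous_map (weak_star M) (weak_star M) (T t)"
  using markov by (simp add: markov_semigroup_def)

lemma T_limit_0:
  assumes "\<phi> \<in> normal_functionals" "f \<in> M"
  shows "((\<lambda>t. \<phi> (T t f)) \<longlongrightarrow> \<phi> f) (at_right 0)"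
proof (rule limitin_weak_starD[OF _ assms(1)])
  show "limitin (weak_star M) (\<lambda>t. T t f) f (at_right 0)"
    using markov assms(2) by (simp add: markov_semigroup_def)
qed

lemma T_normal:
  assumes \<phi>: "\<phi> \<in> normal_functionals" and t: "0 \<le> t"
  obtains \<psi> where "\<psi> \<in> normal_functionals" "\<And>x. x \<in> M \<Longrightarrow> \<phi> (T t x) = \<psi> x"
proof -
  interpret ucp_map M "T t" by (rule T_ucp[OF t])
  have "complex_linear_on M (\<lambda>x. \<phi> (T t x))"
    by (simp add: complex_linear_on_def S_add S_scale_op normal_functional_add_arg[OF \<phi>]
        normal_functional_scale_op[OF \<phi>])
  moreover have "continuous_map (weak_star M) euclidean (\<lambda>x. \<phi> (T t x))"
    using continuous_map_compose[OF T_weak_star_continuous[OF t] normal_functional_continuous[OF \<phi>]]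
    by (simp add: o_def)
  ultimately have "\<exists>\<psi>\<in>normal_functionals. \<forall>x\<in>M. \<phi> (T t x) = \<psi> x"
    by (rule weak_star_continuous_functional_normal[OF complex_subspace_M])
  then show thesis using that by blast
qed

text \<open>The orbits are extended to negative times by \<open>\<bar>u\<bar>\<close>, so that they may be integrated against
  measures on the real line.\<close>

lemma orbit_measurable [measurable]:
  assumes \<phi>: "\<phi> \<in> normal_functionals" and f: "f \<in> M"
  shows "(\<lambda>u. \<phi> (T \<bar>u\<bar> f)) \<in> borel_measurable borel"
proof -
  let ?k = "\<lambda>u. \<phi> (T (max 0 u) f)"
  have "?k \<in> borel_measurable borel"
  proof (rule right_continuous_measurable)
    fix u :: real
    show "(?k \<longlongrightarrow> ?k u) (at_right u)"
    proof (cases "0 \<le> u")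
      case True
      have "((\<lambda>h. \<phi> (T h (T u f))) \<longlongrightarrow> \<phi> (T u f)) (at_right 0)"
        using True f by (intro T_limit_0 \<phi>) simp
      moreover have "\<forall>\<^sub>F h in at_right 0. \<phi> (T h (T u f)) = ?k (h + u)"
        using True f by (auto simp: eventually_at_filter T_semigroup intro!: always_eventually)
      ultimately have "((\<lambda>h. ?k (h + u)) \<longlongrightarrow> \<phi> (T u f)) (at_right 0)"
        by (rule Lim_transform_eventually)
      then show ?thesis using True by (simp add: filterlim_at_right_to_0[of _ _ u])
    next
      case False
      then have "\<forall>\<^sub>F x in at_right u. ?k u = ?k x"
        using eventually_at_right_real[of u 0]
        by (auto elim!: eventually_mono)
      then show ?thesis by (rule Lim_transform_eventually[OF tendsto_const])
    qed
  qed
  then have "(\<lambda>u. ?k \<bar>u\<bar>) \<in> borel_measurable borel" by measurable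
  then show ?thesis by simp
qed

lemma orbit_bound:
  assumes "\<phi> \<in> normal_functionals" "f \<in> M"
  obtains B where "0 \<le> B" "\<And>u. cmod (\<phi> (T \<bar>u\<bar> f)) \<le> B"
proof -
  obtain C where C: "0 \<le> C" "\<And>x. cmod (\<phi> x) \<le> C * norm x"
    using normal_functional_bound[OF assms(1)] by blast
  show thesis
  proof (rule that[of "C * norm f"])
    show "cmod (\<phi> (T \<bar>u\<bar> f)) \<le> C * norm f" for u
      using C(2)[of "T \<bar>u\<bar> f"] mult_left_mono[OF T_contraction[of "\<bar>u\<bar>" f] C(1)] assms(2) by simp
  qed (use C in simp)
qed

lemma orbit_integrable:
  assumes "\<phi> \<in> normal_functionals" "f \<in> M" "0 < t"
  shows "integrable (subordinator t) (\<lambda>u. \<phi> (T \<bar>u\<bar> f))"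
proof -
  obtain B where "0 \<le> B" "\<And>u. cmod (\<phi> (T \<bar>u\<bar> f)) \<le> B" using orbit_bound[OF assms(1,2)] by blast
  then show ?thesis using assms by (intro integrable_subordinator_bounded[of _ t B] orbit_measurable) auto
qed

text \<open>The weak integral defines a bounded sesquilinear form, hence an operator. It commutes with the commutant
  because every \<open>T\<^sub>u f\<close> does, so it lies in the algebra by the bicommutant property. For a general
  normal functional the series and the integral are interchanged.\<close>

lemma poisson_value_exists:
  assumes f: "f \<in> M" and t: "0 < t"
  shows "\<exists>y\<in>M. \<forall>\<phi>\<in>normal_functionals. \<phi> y = (\<integral>u. \<phi> (T \<bar>u\<bar> f) \<partial>subordinator t)"
proof -
  interpret prob_space "subordinator t" by (rule prob_space_subordinator[OF t])
  have int: "integrable (subordinator t) (\<lambda>u. cinner \<xi> (blinfun_apply (T \<bar>u\<bar> f) \<eta>))" for \<xi> \<eta>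
    by (rule orbit_integrable[OF normal_functional_vector f t])
  have Tf: "T \<bar>u\<bar> f \<in> M" for u using f by simp
  define B where "B \<xi> \<eta> = (\<integral>u. cinner \<xi> (blinfun_apply (T \<bar>u\<bar> f) \<eta>) \<partial>subordinator t)" for \<xi> \<eta>
  have pt: "cmod (cinner \<xi> (blinfun_apply (T \<bar>u\<bar> f) \<eta>)) \<le> norm f * norm \<xi> * norm \<eta>" for u \<xi> \<eta>
  proof -
    have "cmod (cinner \<xi> (blinfun_apply (T \<bar>u\<bar> f) \<eta>)) \<le> norm \<xi> * norm (blinfun_apply (T \<bar>u\<bar> f) \<eta>)"
      by (rule cinner_le_norm)
    also have "\<dots> \<le> norm \<xi> * (norm (T \<bar>u\<bar> f) * norm \<eta>)"
      by (intro mult_left_mono norm_blinfun) simp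
    also have "\<dots> \<le> norm \<xi> * (norm f * norm \<eta>)"
      using f by (intro mult_left_mono mult_right_mono T_contraction) auto
    finally show ?thesis by (simp add: mult_ac)
  qed
  obtain y where y: "y \<in> bounded_ops" "\<And>\<xi> \<eta>. cinner \<xi> (blinfun_apply y \<eta>) = B \<xi> \<eta>"
  proof (rule sesquilinear_form_operator[of B "norm f"])
    show "cmod (B \<xi> \<eta>) \<le> norm f * norm \<xi> * norm \<eta>" for \<xi> \<eta>
    proof -
      have "cmod (B \<xi> \<eta>) \<le> (\<integral>u. norm f * norm \<xi> * norm \<eta> \<partial>subordinator t)"
        unfolding B_def using int pt by (intro order_trans[OF integral_norm_bound] integral_mono integrable_norm) auto
      also have "\<dots> = norm f * norm \<xi> * norm \<eta>" using prob_space by simp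
      finally show ?thesis .
    qed
    show "B (c *\<^sub>C \<xi>) \<eta> = cnj c * B \<xi> \<eta>" for c \<xi> \<eta> by (simp add: B_def cinner_simps)
    show "B \<xi> (c *\<^sub>C \<eta>) = c * B \<xi> \<eta>" for c \<xi> \<eta>
      by (simp add: B_def bounded_opsD[OF M_bounded[OF Tf]] cinner_simps)
  qed (use int in \<open>simp_all add: B_def cinner_simps blinfun.add_right\<close>)
  have "y \<in> M"
    unfolding M_iff
  proof (intro conjI ballI allI)
    fix z \<eta> assume z: "z \<in> commutant M"
    show "blinfun_apply z (blinfun_apply y \<eta>) = blinfun_apply y (blinfun_apply z \<eta>)"
    proof (rule cinner_eqI)
      fix \<xi>
      obtain \<zeta> where \<zeta>: "\<And>w. cinner \<xi> (blinfun_apply z w) = cinner \<zeta> w"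
      proof (rule riesz_representation[of "\<lambda>w. cinner \<xi> (blinfun_apply z w)" "norm \<xi> * norm z"])
        show "cmod (cinner \<xi> (blinfun_apply z w)) \<le> norm \<xi> * norm z * norm w" for w
          using cinner_le_norm[of \<xi> "blinfun_apply z w"] mult_left_mono[OF norm_blinfun[of z w], of "norm \<xi>"]
          by (simp add: mult.assoc)
      qed (simp_all add: blinfun.add_right cinner_simps commutant_scaleC[OF z])
      have "cinner \<xi> (blinfun_apply z (blinfun_apply y \<eta>)) = B \<zeta> \<eta>" by (simp add: \<zeta> y)
      also have "\<dots> = B \<xi> (blinfun_apply z \<eta>)"
        unfolding B_def \<zeta>[symmetric] commutantD(2)[OF z Tf] ..
      also have "\<dots> = cinner \<xi> (blinfun_apply y (blinfun_apply z \<eta>))" by (simp add: y)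
      finally show "cinner \<xi> (blinfun_apply z (blinfun_apply y \<eta>)) = cinner \<xi> (blinfun_apply y (blinfun_apply z \<eta>))" .
    qed
  qed (rule y(1))
  moreover have "\<phi> y = (\<integral>u. \<phi> (T \<bar>u\<bar> f) \<partial>subordinator t)" if "\<phi> \<in> normal_functionals" for \<phi>
    using that
  proof (rule normal_functionalE)
    fix \<xi> \<eta> :: "nat \<Rightarrow> 'h"
    assume *: "summable (\<lambda>n. (norm (\<xi> n))\<^sup>2)" "summable (\<lambda>n. (norm (\<eta> n))\<^sup>2)"
      and \<phi>: "\<And>x. \<phi> x = (\<Sum>n. cinner (\<xi> n) (blinfun_apply x (\<eta> n)))"
    have sm: "summable (\<lambda>n. norm f * norm (\<xi> n) * norm (\<eta> n))"
      using summable_mult[OF normal_functional_summable(1)[OF *], of "norm f"] by (simp add: mult.assoc)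
    have "\<phi> y = (\<Sum>n. \<integral>u. cinner (\<xi> n) (blinfun_apply (T \<bar>u\<bar> f) (\<eta> n)) \<partial>subordinator t)"
      by (simp add: \<phi> y B_def)
    also have "\<dots> = (\<integral>u. (\<Sum>n. cinner (\<xi> n) (blinfun_apply (T \<bar>u\<bar> f) (\<eta> n))) \<partial>subordinator t)"
    proof (rule integral_suminf[symmetric, OF int])
      show "AE u in subordinator t. summable (\<lambda>n. norm (cinner (\<xi> n) (blinfun_apply (T \<bar>u\<bar> f) (\<eta> n))))"
        by (intro AE_I2 summable_comparison_test'[OF sm]) (simp add: pt)
      show "summable (\<lambda>n. \<integral>u. norm (cinner (\<xi> n) (blinfun_apply (T \<bar>u\<bar> f) (\<eta> n))) \<partial>subordinator t)"
      proof (rule summable_comparison_test'[OF sm])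
        fix n :: nat
        have "(\<integral>u. norm (cinner (\<xi> n) (blinfun_apply (T \<bar>u\<bar> f) (\<eta> n))) \<partial>subordinator t)
            \<le> (\<integral>u. norm f * norm (\<xi> n) * norm (\<eta> n) \<partial>subordinator t)"
          using int pt by (intro integral_mono integrable_norm) auto
        then show "norm (\<integral>u. norm (cinner (\<xi> n) (blinfun_apply (T \<bar>u\<bar> f) (\<eta> n))) \<partial>subordinator t)
            \<le> norm f * norm (\<xi> n) * norm (\<eta> n)"
          using prob_space by simp
      qed
    qed
    finally show ?thesis by (simp add: \<phi>)
  qed
  ultimately show ?thesis by blast
qed

definition P :: "real \<Rightarrow> 'h op \<Rightarrow> 'h op" where "P = poisson_semigroup M T"

lemma
  assumes f: "f \<in> M" and t: "0 < t"
  shows P_M [simp]: "P t f \<in> M"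
    and P_integral: "\<And>\<phi>. \<phi> \<in> normal_functionals \<Longrightarrow> \<phi> (P t f) = (\<integral>u. \<phi> (T \<bar>u\<bar> f) \<partial>subordinator t)"
proof -
  have value_iff: "is_poisson_value M T t f y \<longleftrightarrow>
      y \<in> M \<and> (\<forall>\<phi>\<in>normal_functionals. \<phi> y = (\<integral>u. \<phi> (T \<bar>u\<bar> f) \<partial>subordinator t))" for y
  proof -
    have "set_integrable lborel {0<..} (\<lambda>u. complex_of_real (poisson_kernel t u) * \<phi> (T u f))"
      and "(LINT u:{0<..}|lborel. complex_of_real (poisson_kernel t u) * \<phi> (T u f))
        = (\<integral>u. \<phi> (T \<bar>u\<bar> f) \<partial>subordinator t)" if \<phi>: "\<phi> \<in> normal_functionals" for \<phi>
    proof -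
      have eq: "indicator {0<..} u *\<^sub>R (complex_of_real (poisson_kernel t u) * \<phi> (T u f))
          = indicator {0<..} u *\<^sub>R (poisson_kernel t u *\<^sub>R \<phi> (T \<bar>u\<bar> f))" for u :: real
        by (simp add: indicator_def scaleR_conv_of_real)
      show "set_integrable lborel {0<..} (\<lambda>u. complex_of_real (poisson_kernel t u) * \<phi> (T u f))"
        using orbit_integrable[OF \<phi> f t]
        unfolding integrable_subordinator_iff[OF orbit_measurable[OF \<phi> f] t] set_integrable_def eq .
      show "(LINT u:{0<..}|lborel. complex_of_real (poisson_kernel t u) * \<phi> (T u f))
        = (\<integral>u. \<phi> (T \<bar>u\<bar> f) \<partial>subordinator t)"
        unfolding integral_subordinator[OF orbit_measurable[OF \<phi> f] t] set_lebesgue_integral_def eq ..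
    qed
    then show ?thesis unfolding is_poisson_value_def by auto
  qed
  obtain y where y: "is_poisson_value M T t f y"
    using poisson_value_exists[OF f t] unfolding value_iff by blast
  have "z = y" if "is_poisson_value M T t f z" for z
    using that y unfolding value_iff by (intro normal_functionals_separate) auto
  with y have "(THE y. is_poisson_value M T t f y) = y" by (rule the_equality)
  then have "is_poisson_value M T t f (P t f)"
    using y t by (simp add: P_def poisson_semigroup_def)
  then show "P t f \<in> M"
    and "\<And>\<phi>. \<phi> \<in> normal_functionals \<Longrightarrow> \<phi> (P t f) = (\<integral>u. \<phi> (T \<bar>u\<bar> f) \<partial>subordinator t)"
    unfolding value_iff by auto
qed

lemma P_linear:
  assumes t: "0 < t" shows "linear_map_on M (P t)"
  unfolding linear_map_on_def
proof (intro conjI ballI allI)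
  note [simp] = normal_functional_add_arg normal_functional_scale_op P_integral[OF _ t]
    orbit_integrable[OF _ _ t] P_M[OF _ t] ucp_map.S_add[OF T_ucp] ucp_map.S_scale_op[OF T_ucp]
  show "P t f \<in> M" if "f \<in> M" for f using that by simp
  show "P t (f + g) = P t f + P t g" if "f \<in> M" "g \<in> M" for f g
    using that by (intro normal_functionals_separate) simp
  show "P t (scale_op c f) = scale_op c (P t f)" if "f \<in> M" for c f
    using that by (intro normal_functionals_separate) simp
qed

lemma P_id: "0 < t \<Longrightarrow> P t id_blinfun = id_blinfun"
  by (rule normal_functionals_separate)
    (simp add: P_integral ucp_map.S_id[OF T_ucp] prob_space.prob_space[OF prob_space_subordinator, simplified])

text \<open>Along the orbit, the quadratic form of a positive matrix is a nonnegative function \<open>k\<close> of time, and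
  for every \<open>t\<close> the form of its image under \<open>P\<^sub>t\<close> is the mean of the same \<open>k\<close>. This transfers
  positivity from densities to maps, for \<open>P\<^sub>t\<close> and for \<open>2 P\<^sub>t - P\<^sub>2\<^sub>t\<close> alike.\<close>

lemma positive_op_matrix_orbit:
  assumes x: "\<And>i j. i < n \<Longrightarrow> j < n \<Longrightarrow> x i j \<in> M" and pos: "positive_op_matrix n x"
  obtains k B where "k \<in> borel_measurable borel" "\<And>u. \<bar>k u\<bar> \<le> B" "\<And>u. 0 \<le> k u"
    "\<And>t. 0 < t \<Longrightarrow> (\<Sum>i<n. \<Sum>j<n. cinner (\<xi> i) (blinfun_apply (P t (x i j)) (\<xi> j)))
        = complex_of_real (\<integral>u. k u \<partial>subordinator t)"
proof -
  let ?h = "\<lambda>u. \<Sum>i<n. \<Sum>j<n. cinner (\<xi> i) (blinfun_apply (T \<bar>u\<bar> (x i j)) (\<xi> j))"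
  let ?k = "\<lambda>u. Re (?h u)"
  have nn: "?h u \<in> \<real>\<^sub>\<ge>\<^sub>0" for u
    using ucp_map.completely_positive[OF T_ucp[of "\<bar>u\<bar>"] x pos] by (simp add: positive_op_matrix_def)
  have hk: "?h u = complex_of_real (?k u)" for u
    using nn[of u] by (intro complex_eqI) (simp_all add: complex_nonneg_Reals_iff)
  note m = orbit_measurable[OF normal_functional_vector x]
  have "\<exists>B. \<forall>i<n. \<forall>j<n. \<forall>u. cmod (cinner (\<xi> i) (blinfun_apply (T \<bar>u\<bar> (x i j)) (\<xi> j))) \<le> B i j"
  proof -
    have "\<exists>b. \<forall>u. cmod (cinner (\<xi> i) (blinfun_apply (T \<bar>u\<bar> (x i j)) (\<xi> j))) \<le> b" if "i < n" "j < n" for i j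
      using orbit_bound[OF normal_functional_vector x[OF that]] by metis
    then show ?thesis by metis
  qed
  then obtain B where B: "\<And>i j u. i < n \<Longrightarrow> j < n \<Longrightarrow> cmod (cinner (\<xi> i) (blinfun_apply (T \<bar>u\<bar> (x i j)) (\<xi> j))) \<le> B i j"
    by blast
  show thesis
  proof (rule that)
    show "?k \<in> borel_measurable borel"
      by (intro borel_measurable_Re[THEN measurable_compose[rotated]] borel_measurable_sum m) auto
    show "\<bar>?k u\<bar> \<le> (\<Sum>i<n. \<Sum>j<n. B i j)" for u
    proof -
      have "\<bar>?k u\<bar> \<le> cmod (?h u)" by (rule abs_Re_le_cmod)
      also have "\<dots> \<le> (\<Sum>i<n. \<Sum>j<n. B i j)"
        by (intro order_trans[OF norm_sum] sum_mono B) auto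
      finally show ?thesis .
    qed
    show "0 \<le> ?k u" for u using nn[of u] by (simp add: complex_nonneg_Reals_iff)
    fix t :: real assume t: "0 < t"
    have "(\<Sum>i<n. \<Sum>j<n. cinner (\<xi> i) (blinfun_apply (P t (x i j)) (\<xi> j))) = (\<integral>u. ?h u \<partial>subordinator t)"
    proof -
      have i: "integrable (subordinator t) (\<lambda>u. cinner (\<xi> i) (blinfun_apply (T \<bar>u\<bar> (x i j)) (\<xi> j)))"
        if "i < n" "j < n" for i j
        by (rule orbit_integrable[OF normal_functional_vector x[OF that] t])
      have "(\<integral>u. ?h u \<partial>subordinator t)
          = (\<Sum>i<n. \<integral>u. (\<Sum>j<n. cinner (\<xi> i) (blinfun_apply (T \<bar>u\<bar> (x i j)) (\<xi> j))) \<partial>subordinator t)"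
        by (rule Bochner_Integration.integral_sum) (auto intro!: Bochner_Integration.integrable_sum i)
      also have "\<dots> = (\<Sum>i<n. \<Sum>j<n. \<integral>u. cinner (\<xi> i) (blinfun_apply (T \<bar>u\<bar> (x i j)) (\<xi> j)) \<partial>subordinator t)"
        by (intro sum.cong refl Bochner_Integration.integral_sum) (auto intro!: i)
      finally show ?thesis using x by (simp add: P_integral[OF _ t normal_functional_vector])
    qed
    also have "\<dots> = (\<integral>u. complex_of_real (?k u) \<partial>subordinator t)"
      by (rule Bochner_Integration.integral_cong[OF refl hk])
    also have "\<dots> = complex_of_real (\<integral>u. ?k u \<partial>subordinator t)" by (rule integral_complex_of_real)
    finally show "(\<Sum>i<n. \<Sum>j<n. cinner (\<xi> i) (blinfun_apply (P t (x i j)) (\<xi> j)))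
        = complex_of_real (\<integral>u. ?k u \<partial>subordinator t)" .
  qed
qed

lemma P_ucp:
  assumes t: "0 < t" shows "ucp_map M (P t)"
proof (intro ucp_map.intro vna_axioms ucp_map_axioms.intro)
  have "completely_positive_on M (P t)"
    unfolding completely_positive_on_def
  proof (intro allI impI)
    fix n and x :: "nat \<Rightarrow> nat \<Rightarrow> 'h op"
    assume x: "(\<forall>i<n. \<forall>j<n. x i j \<in> M) \<and> positive_op_matrix n x"
    show "positive_op_matrix n (\<lambda>i j. P t (x i j))"
      unfolding positive_op_matrix_def
    proof
      fix \<xi> :: "nat \<Rightarrow> 'h"
      show "(\<Sum>i<n. \<Sum>j<n. cinner (\<xi> i) (blinfun_apply (P t (x i j)) (\<xi> j))) \<in> \<real>\<^sub>\<ge>\<^sub>0"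
        by (rule positive_op_matrix_orbit[of n x \<xi>]) (use x t in \<open>auto simp: complex_nonneg_Reals_iff\<close>)
    qed
  qed
  then show "ucp M (P t)" using P_linear[OF t] P_id[OF t] by (simp add: ucp_def)
qed

text \<open>Here the inequality \<open>p\<^sub>2\<^sub>t \<le> 2 p\<^sub>t\<close> between the subordination densities becomes complete
  positivity.\<close>

lemma doubled_difference_ucp:
  assumes t: "0 < t" shows "ucp_map M (\<lambda>x. 2 *\<^sub>R P t x - P (2 * t) x)"
proof (intro ucp_map.intro vna_axioms ucp_map_axioms.intro)
  interpret A: ucp_map M "P t" by (rule P_ucp[OF t])
  interpret B: ucp_map M "P (2 * t)" using t by (intro P_ucp) simp
  have scale_add: "scale_op c (x + y) = scale_op c x + scale_op c y"
    and scale_diff: "scale_op c (x - y) = scale_op c x - scale_op c y"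
    and scale_scaleR: "scale_op c (r *\<^sub>R x) = r *\<^sub>R scale_op c x" for c r and x y :: "'h op"
    by (rule blinfun_eqI; simp add: scale_op_apply blinfun.add_left blinfun.diff_left blinfun.scaleR_left
        scaleC_add_right scaleC_diff_right scaleC_scaleR)+
  have "completely_positive_on M (\<lambda>x. 2 *\<^sub>R P t x - P (2 * t) x)"
    unfolding completely_positive_on_def
  proof (intro allI impI)
    fix n and x :: "nat \<Rightarrow> nat \<Rightarrow> 'h op"
    assume x: "(\<forall>i<n. \<forall>j<n. x i j \<in> M) \<and> positive_op_matrix n x"
    show "positive_op_matrix n (\<lambda>i j. 2 *\<^sub>R P t (x i j) - P (2 * t) (x i j))"
      unfolding positive_op_matrix_def
    proof
      fix \<xi> :: "nat \<Rightarrow> 'h"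
      obtain k B where k: "k \<in> borel_measurable borel" "\<And>u. \<bar>k u\<bar> \<le> B" "\<And>u. 0 \<le> k u"
        and K: "\<And>t. 0 < t \<Longrightarrow> (\<Sum>i<n. \<Sum>j<n. cinner (\<xi> i) (blinfun_apply (P t (x i j)) (\<xi> j)))
          = complex_of_real (\<integral>u. k u \<partial>subordinator t)"
        using x by (rule_tac positive_op_matrix_orbit[of n x \<xi>]) auto
      have "(\<Sum>i<n. \<Sum>j<n. cinner (\<xi> i) (blinfun_apply (2 *\<^sub>R P t (x i j) - P (2 * t) (x i j)) (\<xi> j)))
          = complex_of_real (2 * (\<integral>u. k u \<partial>subordinator t) - (\<integral>u. k u \<partial>subordinator (2 * t)))"
        using K[OF t] K[of "2 * t"] t
        by (simp add: blinfun.diff_left blinfun.scaleR_left cinner_simps sum_subtractf sum_distrib_left[symmetric])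
      then show "(\<Sum>i<n. \<Sum>j<n. cinner (\<xi> i) (blinfun_apply (2 *\<^sub>R P t (x i j) - P (2 * t) (x i j)) (\<xi> j))) \<in> \<real>\<^sub>\<ge>\<^sub>0"
        using subordinator_integral_double_le[OF k(1) t k(2,3)] by (simp only: complex_nonneg_Reals_iff) simp
    qed
  qed
  then show "ucp M (\<lambda>x. 2 *\<^sub>R P t x - P (2 * t) x)"
    unfolding ucp_def linear_map_on_def
    by (simp add: A.S_add B.S_add A.S_scale_op B.S_scale_op scale_add scale_diff scale_scaleR scaleR_add_right scaleR_2)
qed

text \<open>Since \<open>\<phi> \<circ> T\<^sub>u\<close> agrees on the algebra with a normal functional, \<open>T\<^sub>u\<close> passes under the integral defining
  \<open>P\<^sub>s\<close>; the double integral then only sees the sum of the two times.\<close>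

lemma P_semigroup:
  assumes t: "0 < t" and s: "0 < s" and f: "f \<in> M"
  shows "P t (P s f) = P (t + s) f"
proof (rule normal_functionals_separate)
  fix \<phi> :: "'h op \<Rightarrow> complex" assume \<phi>: "\<phi> \<in> normal_functionals"
  interpret S: prob_space "subordinator s" by (rule prob_space_subordinator[OF s])
  define k where "k w = \<phi> (T \<bar>w\<bar> f)" for w
  have k [measurable]: "k \<in> borel_measurable borel" unfolding k_def using \<phi> f by (rule orbit_measurable)
  obtain B where B: "\<And>w. cmod (k w) \<le> B" using orbit_bound[OF \<phi> f] unfolding k_def by blast
  define F where "F u = (\<integral>v. k (u + v) \<partial>subordinator s)" for u
  have F [measurable]: "F \<in> borel_measurable borel" unfolding F_def by measurable
  have "\<phi> (T \<bar>u\<bar> (P s f)) = F \<bar>u\<bar>" for u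
  proof -
    obtain \<psi> where \<psi>: "\<psi> \<in> normal_functionals" "\<And>x. x \<in> M \<Longrightarrow> \<phi> (T \<bar>u\<bar> x) = \<psi> x"
      using T_normal[OF \<phi>, of "\<bar>u\<bar>"] by auto
    have "\<phi> (T \<bar>u\<bar> (P s f)) = (\<integral>v. \<psi> (T \<bar>v\<bar> f) \<partial>subordinator s)"
      using f s by (simp add: \<psi> P_integral)
    also have "\<dots> = (\<integral>v. k (\<bar>u\<bar> + \<bar>v\<bar>) \<partial>subordinator s)"
      using f by (simp add: \<psi>(2)[symmetric] T_semigroup k_def)
    also have "\<dots> = F \<bar>u\<bar>"
      unfolding F_def using AE_subordinator_pos[OF s]
      by (intro integral_cong_AE) (auto elim!: eventually_mono)
    finally show ?thesis .
  qed
  then have "\<phi> (P t (P s f)) = (\<integral>u. F \<bar>u\<bar> \<partial>subordinator t)"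
    using f s t \<phi> by (simp add: P_integral)
  also have "\<dots> = (\<integral>u. F u \<partial>subordinator t)"
    using AE_subordinator_pos[OF t] by (intro integral_cong_AE) (auto elim!: eventually_mono)
  also have "\<dots> = (\<integral>w. k w \<partial>subordinator (t + s))"
    unfolding F_def by (rule subordinator_integral_add[OF k t s B])
  also have "\<dots> = \<phi> (P (t + s) f)"
    using f s t \<phi> by (simp add: P_integral k_def)
  finally show "\<phi> (P t (P s f)) = \<phi> (P (t + s) f)" .
qed

text \<open>After rescaling, all \<open>P\<^sub>t\<close> are integrals against the law at time \<open>1\<close>, and dominated convergence
  applies.\<close>

lemma P_limit_0:
  assumes \<phi>: "\<phi> \<in> normal_functionals" and f: "f \<in> M" and t: "\<And>n. 0 < t n" "t \<longlonglongrightarrow> 0"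
  shows "(\<lambda>n. \<phi> (P (t n) f)) \<longlonglongrightarrow> \<phi> f"
proof -
  interpret prob_space "subordinator 1" by (rule prob_space_subordinator) simp
  obtain B where B: "\<And>w. cmod (\<phi> (T \<bar>w\<bar> f)) \<le> B" using orbit_bound[OF \<phi> f] by blast
  note [measurable] = orbit_measurable[OF \<phi> f]
  have "(\<lambda>n. \<integral>r. \<phi> (T \<bar>(t n)\<^sup>2 * r\<bar> f) \<partial>subordinator 1) \<longlonglongrightarrow> (\<integral>r. \<phi> f \<partial>subordinator 1)"
  proof (rule integral_dominated_convergence[where w = "\<lambda>_. B"])
    show "AE r in subordinator 1. (\<lambda>n. \<phi> (T \<bar>(t n)\<^sup>2 * r\<bar> f)) \<longlonglongrightarrow> \<phi> f"
      using AE_subordinator_pos[of 1, simplified]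
    proof eventually_elim
      case (elim r)
      have "filterlim (\<lambda>n. \<bar>(t n)\<^sup>2 * r\<bar>) (at_right 0) sequentially"
        unfolding filterlim_at
      proof
        show "\<forall>\<^sub>F n in sequentially. \<bar>(t n)\<^sup>2 * r\<bar> \<in> {0<..} \<and> \<bar>(t n)\<^sup>2 * r\<bar> \<noteq> 0"
          using t(1) elim by (intro always_eventually) (auto simp: less_imp_neq[symmetric])
        have "(\<lambda>n. \<bar>(t n)\<^sup>2 * r\<bar>) \<longlonglongrightarrow> \<bar>0\<^sup>2 * r\<bar>" by (intro tendsto_intros t(2))
        then show "(\<lambda>n. \<bar>(t n)\<^sup>2 * r\<bar>) \<longlonglongrightarrow> 0" by simp
      qed
      then show ?case by (rule filterlim_compose[OF T_limit_0[OF \<phi> f]])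
    qed
  qed (use B in simp_all)
  moreover have "(\<integral>r. \<phi> (T \<bar>(t n)\<^sup>2 * r\<bar> f) \<partial>subordinator 1) = \<phi> (P (t n) f)" for n
    using integral_subordinator_scale(1)[OF t(1) orbit_measurable[OF \<phi> f]] by (simp add: P_integral f \<phi> t(1))
  moreover have "(\<integral>r. \<phi> f \<partial>subordinator 1) = \<phi> f" using prob_space by simp
  ultimately show ?thesis by simp
qed

end

section \<open>Telescoping over dyadic scales\<close>

text \<open>A sequence that tends weakly to zero is bounded by the sum of its increments, here a geometric
  series of ratio \<open>2\<^sup>-\<^sup>\<alpha>\<close>.\<close>

lemma norm_le_dyadic_increments:
  fixes x :: "nat \<Rightarrow> 'h::chilbert_space op"
  assumes \<alpha>: "0 < \<alpha>" and t: "0 < t" and B: "0 \<le> B"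
    and incr: "\<And>j. norm (x j - x (Suc j)) \<le> B * (t / 2 ^ Suc j) powr \<alpha>"
    and lim: "\<And>\<xi> \<eta>. (\<lambda>j. cinner \<xi> (blinfun_apply (x j) \<eta>)) \<longlonglongrightarrow> 0"
  shows "norm (x 0) \<le> B / (2 powr \<alpha> - 1) * t powr \<alpha>"
proof -
  define r where "r = 2 powr (- \<alpha>)"
  define K where "K = B / (2 powr \<alpha> - 1) * t powr \<alpha>"
  have g1: "1 < 2 powr \<alpha>" using \<alpha> by simp
  have r: "0 < r" "r < 1" "r * 2 powr \<alpha> = 1"
    using \<alpha> by (auto simp: r_def powr_minus inverse_less_1_iff)
  have K: "K * (1 - r) = B * t powr \<alpha> * r"
  proof -
    have "1 - r = r * (2 powr \<alpha> - 1)" using r(3) by (simp add: algebra_simps)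
    then show ?thesis using \<alpha> by (simp add: K_def)
  qed
  have "0 \<le> K" using B g1 by (simp add: K_def)
  have scale: "(t / 2 ^ j) powr \<alpha> = t powr \<alpha> * r ^ j" for j
  proof (induction j)
    case (Suc j)
    have "(t / 2 ^ Suc j) powr \<alpha> = (t / 2 ^ j * (1 / 2)) powr \<alpha>" by (simp add: mult.commute)
    also have "\<dots> = (t / 2 ^ j) powr \<alpha> * (1 / 2) powr \<alpha>" using t by (intro powr_mult) 
    also have "(1 / 2) powr \<alpha> = r" by (simp add: r_def powr_minus powr_divide field_simps)
    finally show ?case using Suc by simp
  qed simp
  have part: "norm (x 0 - x J) \<le> K * (1 - r ^ J)" for J
  proof (induction J)
    case (Suc J)
    have "norm (x 0 - x (Suc J)) \<le> norm (x 0 - x J) + norm (x J - x (Suc J))"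
      using norm_triangle_ineq[of "x 0 - x J" "x J - x (Suc J)"] by simp
    also have "\<dots> \<le> K * (1 - r ^ J) + B * (t powr \<alpha> * r ^ Suc J)"
      using Suc incr[of J] unfolding scale by (rule add_mono)
    also have "B * (t powr \<alpha> * r ^ Suc J) = (K * (1 - r)) * r ^ J" unfolding K by simp
    also have "K * (1 - r ^ J) + (K * (1 - r)) * r ^ J = K * (1 - r ^ Suc J)"
      by (simp add: algebra_simps)
    finally show ?case .
  qed simp
  have part': "norm (x 0 - x J) \<le> K" for J
    using part[of J] mult_left_mono[of "1 - r ^ J" 1 K] r \<open>0 \<le> K\<close> by simp
  have "cmod (cinner \<xi> (blinfun_apply (x 0) \<eta>)) \<le> norm \<xi> * (K * norm \<eta>)" for \<xi> \<eta>
  proof (rule LIMSEQ_le)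
    show "(\<lambda>J. cmod (cinner \<xi> (blinfun_apply (x 0) \<eta>) - cinner \<xi> (blinfun_apply (x J) \<eta>)))
        \<longlonglongrightarrow> cmod (cinner \<xi> (blinfun_apply (x 0) \<eta>))"
      using tendsto_norm[OF tendsto_diff[OF tendsto_const[of "cinner \<xi> (blinfun_apply (x 0) \<eta>)"] lim[of \<xi> \<eta>]]] by simp
    have "cmod (cinner \<xi> (blinfun_apply (x 0) \<eta>) - cinner \<xi> (blinfun_apply (x J) \<eta>)) \<le> norm \<xi> * (K * norm \<eta>)" for J
    proof -
      have "cmod (cinner \<xi> (blinfun_apply (x 0) \<eta>) - cinner \<xi> (blinfun_apply (x J) \<eta>))
          = cmod (cinner \<xi> (blinfun_apply (x 0 - x J) \<eta>))"
        by (simp add: blinfun.diff_left cinner_simps)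
      also have "\<dots> \<le> norm \<xi> * norm (blinfun_apply (x 0 - x J) \<eta>)" by (rule cinner_le_norm)
      also have "\<dots> \<le> norm \<xi> * (norm (x 0 - x J) * norm \<eta>)" by (intro mult_left_mono norm_blinfun) simp
      also have "\<dots> \<le> norm \<xi> * (K * norm \<eta>)" by (intro mult_left_mono mult_right_mono part') auto
      finally show ?thesis .
    qed
    then show "\<exists>N. \<forall>J\<ge>N. cmod (cinner \<xi> (blinfun_apply (x 0) \<eta>) - cinner \<xi> (blinfun_apply (x J) \<eta>))
        \<le> norm \<xi> * (K * norm \<eta>)" by blast
  qed simp
  then have "norm (blinfun_apply (x 0) \<eta>) \<le> K * norm \<eta>" for \<eta>
    using \<open>0 \<le> K\<close> by (intro norm_le_of_cinner) (simp_all add: mult.commute)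
  then show ?thesis unfolding K_def[symmetric] using \<open>0 \<le> K\<close> by (intro norm_blinfun_bound)
qed

context markov
begin

abbreviation \<Delta> :: "real \<Rightarrow> 'h op \<Rightarrow> 'h op" where "\<Delta> t \<equiv> (\<lambda>g. g - P t g)"

lemma P_0 [simp]: "P 0 f = f"
  by (simp add: P_def poisson_semigroup_def)

lemmas P_add = ucp_map.S_add[OF P_ucp]
  and P_diff = ucp_map.S_diff[OF P_ucp]
  and P_adj = ucp_map.S_adj[OF P_ucp]
  and P_contraction = ucp_map.contraction[OF P_ucp]

lemma \<Delta>_power_M: "0 < t \<Longrightarrow> f \<in> M \<Longrightarrow> (\<Delta> t ^^ k) f \<in> M"
  by (induction k) auto

lemma \<Delta>_power_diff: "0 < t \<Longrightarrow> f \<in> M \<Longrightarrow> g \<in> M \<Longrightarrow> (\<Delta> t ^^ k) (f - g) = (\<Delta> t ^^ k) f - (\<Delta> t ^^ k) g"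
  by (induction k) (auto simp: P_diff \<Delta>_power_M)

lemma \<Delta>_power_adj: "0 < t \<Longrightarrow> f \<in> M \<Longrightarrow> (\<Delta> t ^^ k) (adj f) = adj ((\<Delta> t ^^ k) f)"
  by (induction k) (auto simp: adj_diff P_adj \<Delta>_power_M)

text \<open>By the semigroup law \<open>I - P\<^sub>2\<^sub>s = (I + P\<^sub>s) (I - P\<^sub>s)\<close>, and the two factors commute.\<close>

lemma \<Delta>_power_double:
  assumes s: "0 < s" and f: "f \<in> M"
  shows "(\<Delta> (2 * s) ^^ k) f = ((\<lambda>g. g + P s g) ^^ k) ((\<Delta> s ^^ k) f)"
proof (induction k)
  case (Suc k)
  let ?S = "\<lambda>g. g + P s g"
  have S_M: "(?S ^^ n) g \<in> M" if g: "g \<in> M" for g n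
  proof (induction n)
    case (Suc n)
    show ?case unfolding funpow.simps o_apply by (rule M_add[OF Suc P_M[OF Suc s]])
  qed (simp add: g)
  have swap: "\<Delta> s (y + P s y) = \<Delta> s y + P s (\<Delta> s y)"
    and double: "\<Delta> (2 * s) y = \<Delta> s y + P s (\<Delta> s y)" if y: "y \<in> M" for y
    unfolding mult_2 P_diff[OF s y P_M[OF y s]] P_add[OF s y P_M[OF y s]] P_semigroup[OF s s y] by simp_all
  have comm: "\<Delta> s ((?S ^^ n) g) = (?S ^^ n) (\<Delta> s g)" if g: "g \<in> M" for g n
  proof (induction n)
    case (Suc n)
    have "\<Delta> s ((?S ^^ Suc n) g) = ?S (\<Delta> s ((?S ^^ n) g))"
      unfolding funpow.simps o_apply by (rule swap[OF S_M[OF g]])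
    also have "\<dots> = ?S ((?S ^^ n) (\<Delta> s g))" unfolding Suc ..
    finally show ?case unfolding funpow.simps o_apply .
  qed simp
  define h where "h = (\<Delta> s ^^ k) f"
  have h: "h \<in> M" unfolding h_def by (rule \<Delta>_power_M[OF s f])
  have "(\<Delta> (2 * s) ^^ Suc k) f = \<Delta> (2 * s) ((?S ^^ k) h)"
    unfolding funpow.simps o_apply Suc h_def ..
  also have "\<dots> = ?S (\<Delta> s ((?S ^^ k) h))" by (rule double[OF S_M[OF h]])
  also have "\<dots> = ?S ((?S ^^ k) (\<Delta> s h))" unfolding comm[OF h] ..
  finally show ?case unfolding funpow.simps o_apply h_def .
qed simp

text \<open>Expanding \<open>(I + P\<^sub>s)\<^sup>k - I\<close> leaves \<open>2\<^sup>k - 1\<close> terms, each with a factor \<open>P\<^sub>s\<close> and norm at most \<open>\<parallel>P\<^sub>s g\<parallel>\<close>.\<close>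

lemma norm_one_plus_P_power:
  assumes s: "0 < s" and g: "g \<in> M" and \<delta>: "norm (P s g) \<le> \<delta>"
  shows "norm (((\<lambda>g. g + P s g) ^^ k) g - g) \<le> (2 ^ k - 1) * \<delta>"
proof (induction k)
  case (Suc k)
  let ?S = "\<lambda>g. g + P s g"
  have SM: "(?S ^^ n) g \<in> M" for n
  proof (induction n)
    case (Suc n)
    show ?case unfolding funpow.simps o_apply by (rule M_add[OF Suc P_M[OF Suc s]])
  qed (simp add: g)
  let ?d = "(?S ^^ k) g - g"
  have d: "?d \<in> M" by (rule M_diff[OF SM g])
  have eq: "(?S ^^ Suc k) g - g = (?d + P s ?d) + P s g"
    unfolding P_diff[OF s SM g] funpow.simps o_apply by simp
  have "norm ((?S ^^ Suc k) g - g) \<le> norm (?d + P s ?d) + norm (P s g)"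
    unfolding eq by (rule norm_triangle_ineq)
  also have "\<dots> \<le> (norm ?d + norm (P s ?d)) + norm (P s g)"
    by (rule add_right_mono[OF norm_triangle_ineq])
  also have "\<dots> \<le> (norm ?d + norm ?d) + \<delta>"
    by (intro add_mono order_refl P_contraction[OF s d] \<delta>)
  also have "\<dots> \<le> (2 ^ Suc k - 1) * \<delta>" using Suc by (simp add: algebra_simps)
  finally show ?case .
qed simp

text \<open>Weakly \<open>P\<^sub>j\<^sub>t f \<rightarrow> f\<close> for each fixed \<open>j\<close>, so all terms in the expansion of \<open>(I - P\<^sub>t)\<^sup>k f\<close> have the same
  limit and cancel. The shift by \<open>j t\<close> makes the induction on \<open>k\<close> possible.\<close>

lemma \<Delta>_power_limit:
  assumes \<phi>: "\<phi> \<in> normal_functionals" and f: "f \<in> M" and t: "\<And>n. 0 < t n" "t \<longlonglongrightarrow> 0"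
  shows "(\<lambda>n. \<phi> ((\<Delta> (t n) ^^ k) (P (real j * t n) f))) \<longlonglongrightarrow> (if k = 0 then \<phi> f else 0)"
proof (induction k arbitrary: j)
  case 0
  show ?case
  proof (cases j)
    case (Suc i)
    have "(\<lambda>n. real j * t n) \<longlonglongrightarrow> real j * 0" by (intro tendsto_intros t(2))
    then show ?thesis using P_limit_0[OF \<phi> f, of "\<lambda>n. real j * t n"] t(1) Suc by simp
  qed simp
next
  case (Suc k)
  have PM: "P (real i * t n) f \<in> M" for i n
    using f t(1)[of n] by (cases i) auto
  have step: "(\<Delta> (t n) ^^ Suc k) (P (real j * t n) f)
      = (\<Delta> (t n) ^^ k) (P (real j * t n) f) - (\<Delta> (t n) ^^ k) (P (real (Suc j) * t n) f)" for n
  proof -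
    have "P (t n) (P (real j * t n) f) = P (real (Suc j) * t n) f"
    proof (cases j)
      case (Suc i)
      have "0 < real j * t n" using Suc t(1)[of n] by simp
      then have "P (t n) (P (real j * t n) f) = P (t n + real j * t n) f"
        using t(1)[of n] f by (intro P_semigroup)
      also have "t n + real j * t n = real (Suc j) * t n" by (simp add: algebra_simps)
      finally show ?thesis .
    qed simp
    then have "(\<Delta> (t n) ^^ Suc k) (P (real j * t n) f)
        = (\<Delta> (t n) ^^ k) (P (real j * t n) f - P (real (Suc j) * t n) f)"
      by (simp only: funpow_Suc_right o_def)
    then show ?thesis by (simp only: \<Delta>_power_diff[OF t(1) PM PM])
  qed
  show ?case
    unfolding step normal_functional_diff_arg[OF \<phi>]
    using tendsto_diff[OF Suc[of j] Suc[of "Suc j"]] by simp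
qed

section \<open>Campanato spaces are Lipschitz spaces\<close>

text \<open>The Lipschitz bound holds without the outer \<open>P\<^sub>t\<close> at the price of a constant: between the scales
  \<open>2 s\<close> and \<open>s\<close> the operator \<open>(I - P\<^sub>2\<^sub>s)\<^sup>k f\<close> changes by \<open>((I + P\<^sub>s)\<^sup>k - I) (I - P\<^sub>s)\<^sup>k f\<close>.\<close>

lemma \<Delta>_power_norm_le:
  assumes \<alpha>: "0 < \<alpha>" and f: "f \<in> M" and B: "0 \<le> B"
    and bound: "\<And>t. 0 < t \<Longrightarrow> norm (P t ((\<Delta> t ^^ k) f)) \<le> B * t powr \<alpha>"
    and k: "0 < k" and t: "0 < t"
  shows "norm ((\<Delta> t ^^ k) f) \<le> (2 ^ k - 1) * B / (2 powr \<alpha> - 1) * t powr \<alpha>"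
proof -
  have "norm ((\<Delta> (t / 2 ^ 0) ^^ k) f) \<le> (2 ^ k - 1) * B / (2 powr \<alpha> - 1) * t powr \<alpha>"
  proof (rule norm_le_dyadic_increments[where x = "\<lambda>j. (\<Delta> (t / 2 ^ j) ^^ k) f", OF \<alpha> t])
    show "0 \<le> (2 ^ k - 1) * B" using B by simp
    fix j :: nat
    define s where "s = t / 2 ^ Suc j"
    have s: "0 < s" "t / 2 ^ j = 2 * s" using t by (auto simp: s_def)
    have "norm ((\<Delta> (2 * s) ^^ k) f - (\<Delta> s ^^ k) f) \<le> (2 ^ k - 1) * (B * s powr \<alpha>)"
      unfolding \<Delta>_power_double[OF s(1) f]
      by (rule norm_one_plus_P_power[OF s(1) \<Delta>_power_M[OF s(1) f] bound[OF s(1)]])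
    then show "norm ((\<Delta> (t / 2 ^ j) ^^ k) f - (\<Delta> (t / 2 ^ Suc j) ^^ k) f)
        \<le> (2 ^ k - 1) * B * (t / 2 ^ Suc j) powr \<alpha>"
      by (simp only: s(2) s_def[symmetric] mult.assoc)
  next
    fix \<xi> \<eta>
    have "(\<lambda>j. t * (1 / 2) ^ j) \<longlonglongrightarrow> t * 0" by (intro tendsto_intros LIMSEQ_power_zero) simp
    then have "(\<lambda>j. t / 2 ^ j) \<longlonglongrightarrow> 0" by (simp add: power_divide)
    from \<Delta>_power_limit[OF normal_functional_vector[of \<xi> \<eta>] f _ this, of k 0] t k
    show "(\<lambda>j. cinner \<xi> (blinfun_apply ((\<Delta> (t / 2 ^ j) ^^ k) f) \<eta>)) \<longlonglongrightarrow> 0" by simp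
  qed
  then show ?thesis by simp
qed

lemma sqrt_norm_P_abs_sq_le:
  assumes "0 < t" "g \<in> M" shows "sqrt (norm (P t (abs_sq g))) \<le> norm g"
proof (rule real_le_lsqrt)
  have "norm (P t (abs_sq g)) \<le> norm (abs_sq g)" using assms by (intro P_contraction) auto
  also have "\<dots> \<le> (norm g)\<^sup>2" by (rule norm_abs_sq_le[OF assms(2)])
  finally show "norm (P t (abs_sq g)) \<le> (norm g)\<^sup>2" .
qed auto

text \<open>The Schwarz inequality leads from the column norm of \<open>f\<close> to the Lipschitz bound, which is the same for
  \<open>f\<^sup>*\<close>; contractivity leads back.\<close>

theorem campanato_adjoint_bound:
  assumes \<alpha>: "0 < \<alpha>" and f: "f \<in> M" and B: "0 \<le> B" and k: "0 < k"
    and bound: "\<And>t. 0 < t \<Longrightarrow> sqrt (norm (P t (abs_sq ((\<Delta> t ^^ k) f)))) \<le> B * t powr \<alpha>"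
    and t: "0 < t"
  shows "sqrt (norm (P t (abs_sq ((\<Delta> t ^^ k) (adj f))))) \<le> (2 ^ k - 1) * B / (2 powr \<alpha> - 1) * t powr \<alpha>"
proof -
  have "norm (P s ((\<Delta> s ^^ k) f)) \<le> B * s powr \<alpha>" if s: "0 < s" for s
    using ucp_map.norm_S_le_sqrt[OF P_ucp[OF s] \<Delta>_power_M[OF s f]] bound[OF s] by (rule order_trans)
  then have "norm ((\<Delta> t ^^ k) f) \<le> (2 ^ k - 1) * B / (2 powr \<alpha> - 1) * t powr \<alpha>"
    by (rule \<Delta>_power_norm_le[OF \<alpha> f B _ k t])
  moreover have "sqrt (norm (P t (abs_sq ((\<Delta> t ^^ k) (adj f))))) \<le> norm ((\<Delta> t ^^ k) f)"
    using sqrt_norm_P_abs_sq_le[OF t \<Delta>_power_M[OF t adj_M[OF f], of k]]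
    by (simp only: \<Delta>_power_adj[OF t f] norm_adj[OF \<Delta>_power_M[OF t f]])
  ultimately show ?thesis by simp
qed

end

text \<open>Passage from real constants to extended norms: when the supremum of the \<open>a\<close>-quotients is finite, it is
  itself an admissible constant \<open>B\<close>.\<close>

lemma seminorm_sum_transfer:
  fixes a b :: "real \<Rightarrow> real"
  assumes C: "1 \<le> C" and a: "\<And>t. 0 < t \<Longrightarrow> 0 \<le> a t"
    and transfer: "\<And>B. 0 \<le> B \<Longrightarrow> (\<And>t. 0 < t \<Longrightarrow> a t \<le> B * t powr \<alpha>) \<Longrightarrow>
      (\<And>t. 0 < t \<Longrightarrow> b t \<le> C * B * t powr \<alpha>)"
  shows "ennreal n + (SUP t\<in>{0<..}. ennreal (1 / t powr \<alpha> * b t))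
      \<le> ennreal C * (ennreal n + (SUP t\<in>{0<..}. ennreal (1 / t powr \<alpha> * a t)))"
proof (cases "(SUP t\<in>{0<..}. ennreal (1 / t powr \<alpha> * a t)) = top")
  case True
  then show ?thesis unfolding True using C by (simp add: ennreal_mult_top)
next
  case False
  define B where "B = enn2real (SUP t\<in>{0<..}. ennreal (1 / t powr \<alpha> * a t))"
  have B: "(SUP t\<in>{0<..}. ennreal (1 / t powr \<alpha> * a t)) = ennreal B" "0 \<le> B"
    using False unfolding B_def less_top by (simp_all only: ennreal_enn2real enn2real_nonneg)
  have "a t \<le> B * t powr \<alpha>" if t: "0 < t" for t
  proof -
    have "ennreal (1 / t powr \<alpha> * a t) \<le> ennreal B"
      unfolding B(1)[symmetric] using t by (intro SUP_upper) simp
    then have "1 / t powr \<alpha> * a t \<le> B" using B(2) by simp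
    then show ?thesis using t by (simp add: field_simps)
  qed
  then have b: "b t \<le> C * B * t powr \<alpha>" if "0 < t" for t using transfer[OF B(2)] that by blast
  have "(SUP t\<in>{0<..}. ennreal (1 / t powr \<alpha> * b t)) \<le> ennreal (C * B)"
  proof (rule SUP_least)
    fix t :: real assume "t \<in> {0<..}"
    then show "ennreal (1 / t powr \<alpha> * b t) \<le> ennreal (C * B)"
      using b[of t] by (intro ennreal_leI) (simp add: field_simps)
  qed
  moreover have "ennreal n \<le> ennreal C * ennreal n"
    using mult_right_mono[of 1 "ennreal C" "ennreal n"] C by simp
  ultimately show ?thesis
    unfolding B(1) distrib_left using C B(2) by (intro add_mono) (simp_all add: ennreal_mult)
qed

context vna
begin

text \<open>Applying the one-sided comparison to \<open>f\<^sup>*\<close> yields the opposite inequality.\<close>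

lemma adjoint_comparison:
  assumes C: "1 \<le> C" and le: "\<And>f. f \<in> M \<Longrightarrow> N (adj f) \<le> ennreal C * N f"
  shows "{f \<in> M. N f < \<infinity>} = {f \<in> M. N (adj f) < \<infinity>}"
    and "X \<subseteq> M \<Longrightarrow> equivalent_norms_on X N (\<lambda>f. N (adj f))"
    and "X \<subseteq> M \<Longrightarrow> equivalent_norms_on X (\<lambda>f. N (adj f)) (\<lambda>f. max (N f) (N (adj f)))"
proof -
  have le': "N f \<le> ennreal C * N (adj f)" if "f \<in> M" for f
    using le[OF adj_M[OF that]] that by simp
  have C1: "x \<le> ennreal C * x" for x
    using mult_right_mono[of 1 "ennreal C" x] C by simp
  have fin: "ennreal C * x < \<infinity>" if "x < \<infinity>" for x
    using that by (simp add: ennreal_mult_less_top)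
  show "{f \<in> M. N f < \<infinity>} = {f \<in> M. N (adj f) < \<infinity>}"
    using le le' fin by (meson Collect_cong le_less_trans)
  show "equivalent_norms_on X N (\<lambda>f. N (adj f))" if "X \<subseteq> M"
    unfolding equivalent_norms_on_def using C le le' that by (intro exI[of _ C]) auto
  show "equivalent_norms_on X (\<lambda>f. N (adj f)) (\<lambda>f. max (N f) (N (adj f)))" if "X \<subseteq> M"
    unfolding equivalent_norms_on_def
  proof (intro exI[of _ C] conjI ballI)
    fix f assume "f \<in> X"
    then have f: "f \<in> M" using that by blast
    show "N (adj f) \<le> ennreal C * max (N f) (N (adj f))"
      using order_trans[OF max.cobounded2 C1] .
    show "max (N f) (N (adj f)) \<le> ennreal C * N (adj f)"
      using le'[OF f] C1 by (rule max.boundedI)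
  qed (use C in simp)
qed

end

context markov
begin

theorem campanato_norm_adjoint:
  assumes \<alpha>: "0 < \<alpha>" and f: "f \<in> M"
  defines "k \<equiv> nat \<lfloor>\<alpha>\<rfloor> + 1"
  shows "campanato_norm_c \<alpha> P (adj f) \<le> ennreal (max 1 ((2 ^ k - 1) / (2 powr \<alpha> - 1))) * campanato_norm_c \<alpha> P f"
  unfolding campanato_norm_c_def k_def[symmetric] norm_adj[OF f]
proof (rule seminorm_sum_transfer)
  let ?C = "max 1 ((2 ^ k - 1) / (2 powr \<alpha> - 1))"
  fix B t :: real
  assume B: "0 \<le> B" and bound: "\<And>t. 0 < t \<Longrightarrow> sqrt (norm (P t (abs_sq ((\<Delta> t ^^ k) f)))) \<le> B * t powr \<alpha>"
    and t: "0 < t"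
  have "sqrt (norm (P t (abs_sq ((\<Delta> t ^^ k) (adj f))))) \<le> (2 ^ k - 1) * B / (2 powr \<alpha> - 1) * t powr \<alpha>"
    by (rule campanato_adjoint_bound[OF \<alpha> f B _ bound t]) (simp add: k_def)
  also have "\<dots> = (2 ^ k - 1) / (2 powr \<alpha> - 1) * (B * t powr \<alpha>)" by simp
  also have "\<dots> \<le> ?C * (B * t powr \<alpha>)" using B by (intro mult_right_mono) auto
  finally show "sqrt (norm (P t (abs_sq ((\<Delta> t ^^ k) (adj f))))) \<le> ?C * B * t powr \<alpha>" by (simp add: mult.assoc)
qed auto

end

section \<open>Uniform boundedness and a one-sided mean value inequality\<close>

text \<open>The sets \<open>{x. \<forall>n. \<parallel>F\<^sub>n x\<parallel> \<le> B}\<close> are closed and cover the space, so by Baire's theorem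
  one of them contains a ball; differences of its points give a ball at the origin.\<close>

theorem uniform_boundedness:
  fixes F :: "nat \<Rightarrow> 'a::banach \<Rightarrow>\<^sub>L 'b::real_normed_vector"
  assumes pt: "\<And>x. \<exists>B. \<forall>n. norm (blinfun_apply (F n) x) \<le> B"
  shows "\<exists>B. \<forall>n. norm (F n) \<le> B"
proof -
  define A where "A k = {x. \<forall>n. norm (blinfun_apply (F n) x) \<le> real k}" for k :: nat
  have A_closed: "closed (A k)" for k
    unfolding A_def by (intro closed_Collect_all closed_Collect_le continuous_intros)
  have cover: "\<exists>k. x \<in> A k" for x
  proof -
    obtain B where B: "\<forall>n. norm (blinfun_apply (F n) x) \<le> B" using pt by blast
    obtain k :: nat where "B \<le> real k" using real_arch_simple by blast
    then show ?thesis using B unfolding A_def by (intro exI[of _ k]) (auto intro: order_trans)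
  qed
  have "\<exists>k. interior (A k) \<noteq> {}"
  proof (rule ccontr)
    assume "\<not> (\<exists>k. interior (A k) \<noteq> {})"
    then have empty: "interior (A k) = {}" for k by blast
    have "euclidean interior_of \<Union>(range A) = {}"
    proof (rule Baire_category_alt)
      show "completely_metrizable_space (euclidean :: 'a topology) \<or>
          locally_compact_space (euclidean :: 'a topology) \<and> regular_space (euclidean :: 'a topology)"
        by (simp add: completely_metrizable_space_euclidean)
      fix S assume "S \<in> range A"
      then show "closedin euclidean S \<and> euclidean interior_of S = {}"
        using A_closed empty by auto
    qed simp
    moreover have "\<Union>(range A) = UNIV" using cover by blast
    ultimately show False by simp
  qed
  then obtain k x0 where "x0 \<in> interior (A k)" by blast
  then obtain e where e: "0 < e" "cball x0 e \<subseteq> A k" unfolding mem_interior_cball by blast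
  have "norm (F n) \<le> 2 * real k / e" for n
  proof (rule norm_blinfun_bound)
    show "0 \<le> 2 * real k / e" using e by simp
    fix x :: 'a
    show "norm (blinfun_apply (F n) x) \<le> 2 * real k / e * norm x"
    proof (cases "x = 0")
      case False
      define y where "y = (e / norm x) *\<^sub>R x"
      have "norm y = e" using False e by (simp add: y_def)
      then have "x0 + y \<in> A k" using e by (intro subsetD[OF e(2)]) (simp add: dist_norm)
      moreover have "x0 \<in> A k" using e by (intro subsetD[OF e(2)]) simp
      ultimately have b: "norm (blinfun_apply (F n) (x0 + y)) \<le> real k" "norm (blinfun_apply (F n) x0) \<le> real k"
        by (simp_all add: A_def)
      have "norm (blinfun_apply (F n) y) = norm (blinfun_apply (F n) (x0 + y) - blinfun_apply (F n) x0)"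
        by (simp add: blinfun.add_right)
      also have "\<dots> \<le> 2 * real k" using b norm_triangle_ineq4 by (metis add_mono mult_2 order_trans)
      finally have "e / norm x * norm (blinfun_apply (F n) x) \<le> 2 * real k"
        using e by (simp add: y_def blinfun.scaleR_right)
      then show ?thesis using False e by (simp add: field_simps)
    qed simp
  qed
  then show ?thesis by blast
qed

text \<open>Two applications of uniform boundedness, first to the functionals \<open>\<langle>q\<^sub>n \<eta>, \<cdot>\<rangle>\<close> and then to the operators
  themselves.\<close>

lemma weakly_bounded_sequence:
  fixes q :: "nat \<Rightarrow> 'h::chilbert_space op"
  assumes weak: "\<And>\<xi> \<eta>. \<exists>B. \<forall>n. cmod (cinner \<xi> (blinfun_apply (q n) \<eta>)) \<le> B"
  shows "\<exists>B. \<forall>n. norm (q n) \<le> B"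
proof (rule uniform_boundedness)
  fix \<eta>
  define G where "G n = Blinfun (cinner (blinfun_apply (q n) \<eta>))" for n
  have G: "blinfun_apply (G n) \<xi> = cinner (blinfun_apply (q n) \<eta>) \<xi>" for n \<xi>
    unfolding G_def by (simp add: bounded_linear_Blinfun_apply cinner.bounded_linear_right)
  have "\<exists>B. \<forall>n. norm (G n) \<le> B"
  proof (rule uniform_boundedness)
    fix \<xi>
    show "\<exists>B. \<forall>n. norm (blinfun_apply (G n) \<xi>) \<le> B"
      using weak[of \<xi> \<eta>] unfolding G by (metis cinner_commute complex_mod_cnj)
  qed
  then obtain B where B: "\<And>n. norm (G n) \<le> B" by blast
  have "norm (blinfun_apply (q n) \<eta>) \<le> B" for n
  proof (rule norm_le_of_cinner)
    show "0 \<le> B" using order_trans[OF norm_ge_zero B] .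
    fix \<xi>
    have "cmod (cinner \<xi> (blinfun_apply (q n) \<eta>)) = norm (blinfun_apply (G n) \<xi>)"
      unfolding G by (metis cinner_commute complex_mod_cnj)
    also have "\<dots> \<le> norm (G n) * norm \<xi>" by (rule norm_blinfun)
    also have "\<dots> \<le> B * norm \<xi>" using B by (rule mult_right_mono) simp
    finally show "cmod (cinner \<xi> (blinfun_apply (q n) \<eta>)) \<le> B * norm \<xi>" .
  qed
  then show "\<exists>B. \<forall>n. norm (blinfun_apply (q n) \<eta>) \<le> B" by blast
qed

text \<open>The inequality with a slightly larger slope \<open>m\<close> persists up to a last point; if this were not \<open>b\<close>, the right
  derivative there would carry it further. The weak-* generator provides nothing but right derivatives.\<close>

lemma right_derivative_mean_value:
  fixes k :: "real \<Rightarrow> real"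
  assumes ab: "a \<le> b" and cont: "continuous_on {a..b} k"
    and deriv: "\<And>x. a \<le> x \<Longrightarrow> x < b \<Longrightarrow> \<exists>d\<le>m. ((\<lambda>e. (k (x + e) - k x) / e) \<longlongrightarrow> d) (at_right 0)"
  shows "k b - k a \<le> m * (b - a)"
proof (rule field_le_epsilon)
  fix \<epsilon> :: real assume \<epsilon>: "0 < \<epsilon>"
  define m' where "m' = m + \<epsilon> / (b - a + 1)"
  have m': "m < m'" "m' * (b - a) \<le> m * (b - a) + \<epsilon>"
  proof -
    show "m < m'" using ab \<epsilon> by (simp add: m'_def)
    have "\<epsilon> / (b - a + 1) * (b - a) \<le> \<epsilon>" using ab \<epsilon> by (simp add: field_simps)
    then show "m' * (b - a) \<le> m * (b - a) + \<epsilon>" by (simp add: m'_def algebra_simps)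
  qed
  define S where "S = {x \<in> {a..b}. k x - k a \<le> m' * (x - a)}"
  have "closed S"
  proof -
    have "S = {a..b} \<inter> (\<lambda>x. m' * (x - a) - (k x - k a)) -` {0..}" by (auto simp: S_def)
    moreover have "continuous_on {a..b} (\<lambda>x. m' * (x - a) - (k x - k a))"
      by (intro continuous_intros cont)
    ultimately show ?thesis by (simp add: continuous_closed_preimage)
  qed
  moreover have "bounded S" unfolding S_def by (rule bounded_subset[of "{a..b}"]) auto
  ultimately have "compact S" by (simp add: compact_eq_bounded_closed)
  moreover have "a \<in> S" using ab by (simp add: S_def)
  ultimately obtain c where c: "c \<in> S" "\<And>x. x \<in> S \<Longrightarrow> x \<le> c" using compact_attains_sup[of S] by blast
  have "c = b"
  proof (rule ccontr)
    assume "c \<noteq> b"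
    then have cb: "a \<le> c" "c < b" using c(1) by (auto simp: S_def)
    \<comment> \<open>Just to the right of the last good point the inequality would still hold.\<close>
    obtain d where d: "d \<le> m" "((\<lambda>e. (k (c + e) - k c) / e) \<longlongrightarrow> d) (at_right 0)"
      using deriv[OF cb] by blast
    have "\<forall>\<^sub>F e in at_right 0. (k (c + e) - k c) / e < m'"
      using d m'(1) by (intro order_tendstoD(2)[OF d(2)]) simp
    moreover have "\<forall>\<^sub>F e in at_right 0. e \<in> {0<..<b - c}" using cb by (intro eventually_at_right_real) simp
    ultimately have "\<forall>\<^sub>F e in at_right 0. (k (c + e) - k c) / e < m' \<and> e \<in> {0<..<b - c}"
      by (rule eventually_conj)
    then obtain e where e: "(k (c + e) - k c) / e < m'" "0 < e" "e < b - c"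
      using eventually_happens[of _ "at_right (0::real)"] by auto
    have "k (c + e) - k c < m' * e" using e by (simp add: field_simps)
    then have "c + e \<in> S" using c(1) e cb by (simp add: S_def algebra_simps)
    then show False using c(2)[of "c + e"] e by simp
  qed
  then have "k b - k a \<le> m' * (b - a)" using c(1) by (simp add: S_def)
  then show "k b - k a \<le> m * (b - a) + \<epsilon>" using m'(2) by simp
qed

lemma norm_le_of_Re_cinner:
  fixes x :: "'h::chilbert_space"
  assumes "0 \<le> C" "\<And>y. Re (cinner y x) \<le> C * norm y"
  shows "norm x \<le> C"
proof (cases "x = 0")
  case False
  have "norm x * norm x \<le> C * norm x" using assms(2)[of x] by (simp add: Re_cinner_self power2_eq_square)
  then show ?thesis using False by simp
qed (use assms in simp)

section \<open>Norm differentiability of the semigroup\<close>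

context markov
begin

text \<open>The standing convention that the semigroup maps into the domain of its generator.\<close>

definition dom_regular :: bool where
  "dom_regular \<longleftrightarrow> (\<forall>s>0. \<forall>f\<in>M. T s f \<in> gen_dom M T)"

abbreviation A :: "'h op \<Rightarrow> 'h op" where "A \<equiv> generator M T"

context
  assumes regular: dom_regular
begin

lemma generator_value:
  assumes "0 < s" "f \<in> M" shows "is_generator_value M T (T s f) (A (T s f))"
proof -
  obtain y where y: "is_generator_value M T (T s f) y"
    using regular assms unfolding dom_regular_def gen_dom_def by blast
  have "z = y" if "is_generator_value M T (T s f) z" for z
    using that y unfolding is_generator_value_def by (rule limitin_weak_star_unique) simp
  with y have "A (T s f) = y" unfolding generator_def by (rule the_equality)
  then show ?thesis using y by simp
qed

lemma generator_M [simp]: "0 < s \<Longrightarrow> f \<in> M \<Longrightarrow> A (T s f) \<in> M"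
  using limitin_topspace[OF generator_value[unfolded is_generator_value_def]] by (simp add: topspace_weak_star)

lemma generator_limit:
  assumes "0 < s" "f \<in> M" "\<phi> \<in> normal_functionals"
  shows "((\<lambda>t. \<phi> ((1 / t) *\<^sub>R (T s f - T (s + t) f))) \<longlongrightarrow> \<phi> (A (T s f))) (at_right 0)"
proof -
  have "((\<lambda>t. \<phi> ((1 / t) *\<^sub>R (T s f - T t (T s f)))) \<longlongrightarrow> \<phi> (A (T s f))) (at_right 0)"
    using generator_value[OF assms(1,2)] unfolding is_generator_value_def
    by (rule limitin_weak_starD[OF _ assms(3)])
  moreover have "\<forall>\<^sub>F t in at_right 0. \<phi> ((1 / t) *\<^sub>R (T s f - T t (T s f))) = \<phi> ((1 / t) *\<^sub>R (T s f - T (s + t) f))"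
    using assms by (auto simp: eventually_at_filter T_semigroup add.commute intro!: always_eventually)
  ultimately show ?thesis by (rule Lim_transform_eventually)
qed

text \<open>Normality of \<open>T\<^sub>r\<close> carries the weak-* limit of the difference quotients along.\<close>

lemma generator_T:
  assumes "0 < s" "0 \<le> r" "f \<in> M" shows "A (T (r + s) f) = T r (A (T s f))"
proof (rule normal_functionals_separate)
  fix \<phi> :: "'h op \<Rightarrow> complex" assume \<phi>: "\<phi> \<in> normal_functionals"
  interpret R: ucp_map M "T r" by (rule T_ucp[OF assms(2)])
  obtain \<psi> where \<psi>: "\<psi> \<in> normal_functionals" "\<And>x. x \<in> M \<Longrightarrow> \<phi> (T r x) = \<psi> x"
    using T_normal[OF \<phi> assms(2)] by blast
  have "((\<lambda>t. \<psi> ((1 / t) *\<^sub>R (T s f - T (s + t) f))) \<longlongrightarrow> \<psi> (A (T s f))) (at_right 0)"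
    by (rule generator_limit[OF assms(1,3) \<psi>(1)])
  moreover have "\<forall>\<^sub>F t in at_right 0. \<psi> ((1 / t) *\<^sub>R (T s f - T (s + t) f))
      = \<phi> ((1 / t) *\<^sub>R (T (r + s) f - T (r + s + t) f))"
    using assms by (auto simp: eventually_at_filter \<psi>(2)[symmetric] R.S_scaleR R.S_diff T_semigroup add.assoc
        intro!: always_eventually)
  ultimately have "((\<lambda>t. \<phi> ((1 / t) *\<^sub>R (T (r + s) f - T (r + s + t) f))) \<longlongrightarrow> \<psi> (A (T s f))) (at_right 0)"
    by (rule Lim_transform_eventually)
  moreover have "((\<lambda>t. \<phi> ((1 / t) *\<^sub>R (T (r + s) f - T (r + s + t) f))) \<longlongrightarrow> \<phi> (A (T (r + s) f))) (at_right 0)"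
    using assms by (intro generator_limit \<phi>) auto
  ultimately have "\<phi> (A (T (r + s) f)) = \<psi> (A (T s f))"
    by (intro tendsto_unique[of "at_right (0::real)"]) auto
  then show "\<phi> (A (T (r + s) f)) = \<phi> (T r (A (T s f)))" using assms by (simp add: \<psi>(2))
qed

text \<open>Difference quotients that converge in the weak-* sense are bounded in norm near zero, by uniform
  boundedness; for large increments contractivity is enough.\<close>

lemma orbit_lipschitz_0:
  assumes s: "0 < s" and f: "f \<in> M"
  shows "\<exists>K\<ge>0. \<forall>e\<ge>0. norm (T (s + e) f - T s f) \<le> K * e"
proof -
  define q where "q e = (1 / e) *\<^sub>R (T s f - T (s + e) f)" for e
  have "\<exists>\<delta>>0. \<exists>K. \<forall>e. 0 < e \<and> e < \<delta> \<longrightarrow> norm (q e) \<le> K"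
  proof (rule ccontr)
    assume contra: "\<not> (\<exists>\<delta>>0. \<exists>K. \<forall>e. 0 < e \<and> e < \<delta> \<longrightarrow> norm (q e) \<le> K)"
    have "\<exists>e. 0 < e \<and> e < 1 / real (Suc n) \<and> real n < norm (q e)" for n
    proof -
      have "0 < 1 / real (Suc n)" by simp
      then have "\<not> (\<forall>e. 0 < e \<and> e < 1 / real (Suc n) \<longrightarrow> norm (q e) \<le> real n)" using contra by blast
      then show ?thesis by (auto simp: not_le)
    qed
    then obtain e where e: "\<And>n. 0 < e n" "\<And>n. e n < 1 / real (Suc n)" "\<And>n. real n < norm (q (e n))" by metis
    have "e \<longlonglongrightarrow> 0"
      using e(1,2) by (intro tendsto_sandwich[OF _ _ tendsto_const LIMSEQ_inverse_real_of_nat[unfolded inverse_eq_divide]])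
        (auto intro!: always_eventually less_imp_le)
    then have lim: "filterlim e (at_right 0) sequentially"
      unfolding filterlim_at using e(1) by (auto intro!: always_eventually simp: less_imp_neq[symmetric])
    have "\<exists>B. \<forall>n. cmod (cinner \<xi> (blinfun_apply (q (e n)) \<eta>)) \<le> B" for \<xi> \<eta>
    proof -
      have "(\<lambda>n. cinner \<xi> (blinfun_apply (q (e n)) \<eta>)) \<longlonglongrightarrow> cinner \<xi> (blinfun_apply (A (T s f)) \<eta>)"
        using filterlim_compose[OF generator_limit[OF s f normal_functional_vector] lim] by (simp only: q_def)
      then have "Bseq (\<lambda>n. cinner \<xi> (blinfun_apply (q (e n)) \<eta>))" by (rule convergent_imp_Bseq[OF convergentI])
      then show ?thesis unfolding Bseq_def by blast
    qed
    then obtain B where B: "\<And>n. norm (q (e n)) \<le> B" using weakly_bounded_sequence[of "\<lambda>n. q (e n)"] by blast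
    obtain n :: nat where "B \<le> real n" using real_arch_simple by blast
    then show False using B[of n] e(3)[of n] by simp
  qed
  then obtain \<delta> K where \<delta>: "0 < \<delta>" and K: "\<And>e. 0 < e \<Longrightarrow> e < \<delta> \<Longrightarrow> norm (q e) \<le> K" by blast
  define L where "L = max 0 K + 2 * norm f / \<delta>"
  have "norm (T (s + e) f - T s f) \<le> L * e" if "0 \<le> e" for e
  proof (cases "e = 0")
    case False
    then have e: "0 < e" using that by simp
    have nn: "0 \<le> 2 * norm f / \<delta>" "0 \<le> max 0 K" using \<delta> by auto
    show ?thesis
    proof (cases "e < \<delta>")
      case True
      have "norm (T (s + e) f - T s f) = e * norm (q e)"
        using e by (simp add: q_def norm_minus_commute)
      also have "\<dots> \<le> e * L" using K[OF e True] e nn by (intro mult_left_mono) (auto simp: L_def)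
      finally show ?thesis by (simp add: mult.commute)
    next
      case False
      have "norm (T (s + e) f - T s f) \<le> norm f + norm f"
        using T_contraction[of "s + e" f] T_contraction[of s f] s e f
        by (intro order_trans[OF norm_triangle_ineq4] add_mono) auto
      also have "\<dots> \<le> 2 * norm f / \<delta> * e"
        using mult_right_mono[of \<delta> e "norm f"] False \<delta> by (simp add: field_simps)
      also have "\<dots> \<le> L * e" using e nn by (intro mult_right_mono) (auto simp: L_def)
      finally show ?thesis .
    qed
  qed simp
  moreover have "0 \<le> L" using \<delta> by (simp add: L_def add_nonneg_nonneg)
  ultimately show ?thesis by blast
qed

lemma orbit_lipschitz:
  assumes s: "0 < s" and f: "f \<in> M"
  obtains K where "0 \<le> K" "\<And>v w. s \<le> v \<Longrightarrow> s \<le> w \<Longrightarrow> norm (T w f - T v f) \<le> K * \<bar>w - v\<bar>"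
proof -
  obtain K where K: "0 \<le> K" "\<And>e. 0 \<le> e \<Longrightarrow> norm (T (s + e) f - T s f) \<le> K * e"
    using orbit_lipschitz_0[OF s f] by blast
  have le: "norm (T w f - T v f) \<le> K * (w - v)" if "s \<le> v" "v \<le> w" for v w
  proof -
    interpret R: ucp_map M "T (v - s)" using that by (intro T_ucp) simp
    have "T w f - T v f = T (v - s) (T (s + (w - v)) f - T s f)"
      using that s f by (simp add: R.S_diff T_semigroup)
    also have "norm \<dots> \<le> norm (T (s + (w - v)) f - T s f)"
      using that s f by (intro R.contraction) simp
    also have "\<dots> \<le> K * (w - v)" using that by (intro K(2)) simp
    finally show ?thesis .
  qed
  have "norm (T w f - T v f) \<le> K * \<bar>w - v\<bar>" if "s \<le> v" "s \<le> w" for v w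
    using le[of v w] le[of w v] that by (cases "v \<le> w") (auto simp: norm_minus_commute)
  with K(1) show thesis by (rule that)
qed

text \<open>Both the orbit and, one regularisation step later, its weak derivative are Lipschitz in norm, so
  the one-sided mean value inequality bounds the Taylor remainder quadratically.\<close>

lemma orbit_taylor:
  assumes s: "0 < s" and f: "f \<in> M"
  obtains K where "0 \<le> K"
    "\<And>v w. s \<le> v \<Longrightarrow> v \<le> w \<Longrightarrow> norm (T w f - T v f + (w - v) *\<^sub>R A (T v f)) \<le> K * (w - v)\<^sup>2"
    "\<And>v w. s \<le> v \<Longrightarrow> s \<le> w \<Longrightarrow> norm (A (T w f) - A (T v f)) \<le> K * \<bar>w - v\<bar>"
proof -
  define \<rho> where "\<rho> = s / 2"
  have \<rho>: "0 < \<rho>" "s = \<rho> + \<rho>" using s by (auto simp: \<rho>_def)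
  define y where "y = A (T \<rho> f)"
  have y: "y \<in> M" using \<rho> f by (simp add: y_def)
  have Ay: "A (T v f) = T (v - \<rho>) y" if "s \<le> v" for v
    using generator_T[of \<rho> "v - \<rho>" f] that \<rho> f by (simp add: y_def)
  obtain K where K: "0 \<le> K" "\<And>v w. \<rho> \<le> v \<Longrightarrow> \<rho> \<le> w \<Longrightarrow> norm (T w y - T v y) \<le> K * \<bar>w - v\<bar>"
    using orbit_lipschitz[OF \<rho>(1) y] by blast
  obtain L where L: "0 \<le> L" "\<And>v w. s \<le> v \<Longrightarrow> s \<le> w \<Longrightarrow> norm (T w f - T v f) \<le> L * \<bar>w - v\<bar>"
    using orbit_lipschitz[OF s f] by blast
  have A_lip: "norm (A (T w f) - A (T v f)) \<le> K * \<bar>w - v\<bar>" if "s \<le> v" "s \<le> w" for v w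
    using K(2)[of "v - \<rho>" "w - \<rho>"] that \<rho> by (simp add: Ay)
  have taylor: "norm (T w f - T v f + (w - v) *\<^sub>R A (T v f)) \<le> K * (w - v)\<^sup>2" if vw: "s \<le> v" "v \<le> w" for v w
  proof (rule norm_blinfun_bound)
    show "0 \<le> K * (w - v)\<^sup>2" using K by simp
    fix \<eta>
    show "norm (blinfun_apply (T w f - T v f + (w - v) *\<^sub>R A (T v f)) \<eta>) \<le> K * (w - v)\<^sup>2 * norm \<eta>"
    proof (rule norm_le_of_Re_cinner)
      fix \<xi>
      define \<phi> where "\<phi> x = Re (cinner \<xi> (blinfun_apply x \<eta>))" for x :: "'h op"
      have \<phi>_lin: "\<phi> (x + z) = \<phi> x + \<phi> z" "\<phi> (x - z) = \<phi> x - \<phi> z" "\<phi> (r *\<^sub>R x) = r * \<phi> x" for x z r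
        by (simp_all add: \<phi>_def blinfun.add_left blinfun.diff_left blinfun.scaleR_left cinner_simps)
      have \<phi>_bound: "\<bar>\<phi> x\<bar> \<le> norm x * (norm \<xi> * norm \<eta>)" for x
      proof -
        have "\<bar>\<phi> x\<bar> \<le> norm \<xi> * norm (blinfun_apply x \<eta>)" unfolding \<phi>_def by (rule Re_cinner_le_norm)
        also have "\<dots> \<le> norm \<xi> * (norm x * norm \<eta>)" by (intro mult_left_mono norm_blinfun) simp
        finally show ?thesis by (simp add: mult_ac)
      qed
      have \<phi>_lim: "((\<lambda>e. \<phi> ((1 / e) *\<^sub>R (T x f - T (x + e) f))) \<longlongrightarrow> \<phi> (A (T x f))) (at_right 0)" if "s \<le> x" for x
        unfolding \<phi>_def using that s by (intro tendsto_Re generator_limit normal_functional_vector f) simp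
      define k where "k x = \<phi> (T x f) + x * \<phi> (A (T v f))" for x
      have "k w - k v \<le> (K * (w - v) * (norm \<xi> * norm \<eta>)) * (w - v)"
      proof (rule right_derivative_mean_value[OF vw(2)])
        have "continuous_on {v..w} (\<lambda>x. \<phi> (T x f))"
        proof (rule lipschitz_on_continuous_on[of "L * (norm \<xi> * norm \<eta>)"], rule lipschitz_onI)
          fix x z assume "x \<in> {v..w}" "z \<in> {v..w}"
          then have "norm (T x f - T z f) \<le> L * \<bar>x - z\<bar>" using vw by (intro L(2)) auto
          then have "norm (T x f - T z f) * (norm \<xi> * norm \<eta>) \<le> L * \<bar>x - z\<bar> * (norm \<xi> * norm \<eta>)"
            by (rule mult_right_mono) simp
          then show "dist (\<phi> (T x f)) (\<phi> (T z f)) \<le> L * (norm \<xi> * norm \<eta>) * dist x z"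
            using \<phi>_bound[of "T x f - T z f"] by (simp add: dist_real_def \<phi>_lin mult_ac)
        qed (use L in simp)
        then show "continuous_on {v..w} k" unfolding k_def by (intro continuous_intros)
        fix x assume x: "v \<le> x" "x < w"
        have "((\<lambda>e. - \<phi> ((1 / e) *\<^sub>R (T x f - T (x + e) f)) + \<phi> (A (T v f)))
            \<longlongrightarrow> - \<phi> (A (T x f)) + \<phi> (A (T v f))) (at_right 0)"
          using x vw by (intro tendsto_intros \<phi>_lim) simp
        moreover have "\<forall>\<^sub>F e in at_right 0. - \<phi> ((1 / e) *\<^sub>R (T x f - T (x + e) f)) + \<phi> (A (T v f)) = (k (x + e) - k x) / e"
          by (auto simp: eventually_at_filter k_def \<phi>_lin field_simps intro!: always_eventually)
        ultimately have "((\<lambda>e. (k (x + e) - k x) / e) \<longlongrightarrow> - \<phi> (A (T x f)) + \<phi> (A (T v f))) (at_right 0)"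
          by (rule Lim_transform_eventually)
        moreover have "- \<phi> (A (T x f)) + \<phi> (A (T v f)) \<le> K * (w - v) * (norm \<xi> * norm \<eta>)"
        proof -
          have "- \<phi> (A (T x f)) + \<phi> (A (T v f)) \<le> norm (A (T v f) - A (T x f)) * (norm \<xi> * norm \<eta>)"
            using \<phi>_bound[of "A (T v f) - A (T x f)"] by (simp add: \<phi>_lin)
          also have "\<dots> \<le> K * \<bar>v - x\<bar> * (norm \<xi> * norm \<eta>)"
            using x vw by (intro mult_right_mono A_lip) auto
          also have "\<dots> \<le> K * (w - v) * (norm \<xi> * norm \<eta>)"
            using x vw K by (intro mult_right_mono mult_left_mono) auto
          finally show ?thesis .
        qed
        ultimately show "\<exists>d\<le>K * (w - v) * (norm \<xi> * norm \<eta>). ((\<lambda>e. (k (x + e) - k x) / e) \<longlongrightarrow> d) (at_right 0)"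
          by blast
      qed
      moreover have "\<phi> (T w f - T v f + (w - v) *\<^sub>R A (T v f)) = k w - k v"
        by (simp add: k_def \<phi>_lin algebra_simps)
      ultimately show "Re (cinner \<xi> (blinfun_apply (T w f - T v f + (w - v) *\<^sub>R A (T v f)) \<eta>))
          \<le> K * (w - v)\<^sup>2 * norm \<eta> * norm \<xi>"
        by (simp add: \<phi>_def power2_eq_square mult_ac)
    qed (use K in simp)
  qed
  show thesis by (rule that[OF K(1) taylor A_lip])
qed

text \<open>A left increment from \<open>s\<close> is a right increment from \<open>s + e\<close>, and the Lipschitz continuity of the
  derivative compares the two base points.\<close>

lemma T_quotient:
  assumes s: "0 < s" and f: "f \<in> M"
  shows "((\<lambda>e. (1 / e) *\<^sub>R (T (s + e) f - T s f)) \<longlongrightarrow> - A (T s f)) (at 0)"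
proof -
  obtain K where K: "0 \<le> K"
    "\<And>v w. s / 2 \<le> v \<Longrightarrow> v \<le> w \<Longrightarrow> norm (T w f - T v f + (w - v) *\<^sub>R A (T v f)) \<le> K * (w - v)\<^sup>2"
    "\<And>v w. s / 2 \<le> v \<Longrightarrow> s / 2 \<le> w \<Longrightarrow> norm (A (T w f) - A (T v f)) \<le> K * \<bar>w - v\<bar>"
    using orbit_taylor[of "s / 2" f] s f by auto
  have bound: "norm (T (s + e) f - T s f + e *\<^sub>R A (T s f)) \<le> 2 * K * e\<^sup>2" if e: "\<bar>e\<bar> \<le> s / 2" for e
  proof (cases "0 \<le> e")
    case True
    have "norm (T (s + e) f - T s f + e *\<^sub>R A (T s f)) \<le> K * e\<^sup>2" using K(2)[of s "s + e"] True s by simp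
    also have "\<dots> \<le> 2 * K * e\<^sup>2" using K(1) by (simp add: mult_right_mono)
    finally show ?thesis .
  next
    case False
    have 1: "norm (T s f - T (s + e) f + (- e) *\<^sub>R A (T (s + e) f)) \<le> K * e\<^sup>2"
      using K(2)[of "s + e" s] False e by simp
    have 2: "norm (A (T (s + e) f) - A (T s f)) \<le> K * \<bar>e\<bar>" using K(3)[of s "s + e"] False e s by simp
    have "T (s + e) f - T s f + e *\<^sub>R A (T s f)
        = - (T s f - T (s + e) f + (- e) *\<^sub>R A (T (s + e) f)) - e *\<^sub>R (A (T (s + e) f) - A (T s f))"
      by (simp add: scaleR_diff_right)
    also have "norm \<dots> \<le> K * e\<^sup>2 + \<bar>e\<bar> * (K * \<bar>e\<bar>)"
      using 1 mult_left_mono[OF 2, of "\<bar>e\<bar>"]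
      by (intro order_trans[OF norm_triangle_ineq4] add_mono) (simp_all only: norm_minus_cancel norm_scaleR abs_ge_zero)
    also have "\<dots> = 2 * K * e\<^sup>2" by (simp add: power2_eq_square)
    finally show ?thesis .
  qed
  show ?thesis
  proof (rule LIM_I)
    fix r :: real assume r: "0 < r"
    define d where "d = min (s / 2) (r / (2 * K + 1))"
    have d: "0 < d" using s r K(1) by (simp add: d_def)
    have "norm ((1 / e) *\<^sub>R (T (s + e) f - T s f) - - A (T s f)) < r" if e: "e \<noteq> 0" "norm (e - 0) < d" for e
    proof -
      have "norm ((1 / e) *\<^sub>R (T (s + e) f - T s f) - - A (T s f))
          = norm (T (s + e) f - T s f + e *\<^sub>R A (T s f)) / \<bar>e\<bar>"
      proof -
        have "(1 / e) *\<^sub>R (T (s + e) f - T s f) - - A (T s f) = (1 / e) *\<^sub>R (T (s + e) f - T s f + e *\<^sub>R A (T s f))"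
          using e(1) by (simp add: scaleR_add_right)
        then show ?thesis by (simp only: norm_scaleR) simp
      qed
      also have "\<dots> \<le> 2 * K * e\<^sup>2 / \<bar>e\<bar>" using e by (intro divide_right_mono bound) (auto simp: d_def)
      also have "\<dots> = 2 * K * \<bar>e\<bar>" using e(1) by (simp add: power2_eq_square abs_if)
      also have "\<dots> \<le> (2 * K + 1) * \<bar>e\<bar>" by (simp add: distrib_right)
      also have "\<dots> < r" using e(2) K(1) by (simp add: d_def field_simps)
      finally show ?thesis .
    qed
    then show "\<exists>d>0. \<forall>e. e \<noteq> 0 \<and> norm (e - 0) < d \<longrightarrow> norm ((1 / e) *\<^sub>R (T (s + e) f - T s f) - - A (T s f)) < r"
      using d by blast
  qed
qed

lemma T_continuous:
  assumes s: "0 < s" and f: "f \<in> M"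
  shows "((\<lambda>e. T (s + e) f) \<longlongrightarrow> T s f) (at 0)"
proof -
  have "((\<lambda>e. T s f + e *\<^sub>R ((1 / e) *\<^sub>R (T (s + e) f - T s f))) \<longlongrightarrow> T s f + 0 *\<^sub>R (- A (T s f))) (at 0)"
    by (intro tendsto_intros T_quotient s f)
  then have "((\<lambda>e. T s f + e *\<^sub>R ((1 / e) *\<^sub>R (T (s + e) f - T s f))) \<longlongrightarrow> T s f) (at 0)" by simp
  moreover have "\<forall>\<^sub>F e in at 0. T s f + e *\<^sub>R ((1 / e) *\<^sub>R (T (s + e) f - T s f)) = T (s + e) f"
    by (auto simp: eventually_at_filter intro!: always_eventually)
  ultimately show ?thesis by (rule Lim_transform_eventually)
qed

section \<open>Convexity and the reverse Poincare inequality\<close>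

lemma filterlim_uminus_at_0: "filterlim uminus (at (0::real)) (at 0)"
  unfolding filterlim_def filtermap_at_minus by simp

text \<open>The product rule, now that all orbits are differentiable in norm: the inner factor contributes the two
  terms of \<open>\<Gamma>\<close> in which the generator falls on one factor, and the outer semigroup, run backwards,
  contributes the third.\<close>

lemma interpolation_derivative:
  assumes g: "g \<in> M" and r: "0 < r" "r < w"
  shows "((\<lambda>r. Re (cinner \<xi> (blinfun_apply (T (w - r) (abs_sq (T r g))) \<xi>))) has_real_derivative
      - 2 * Re (cinner \<xi> (blinfun_apply (gamma_form M T (w - r) r g) \<xi>))) (at r)"
proof -
  define X where "X r = T r (adj g) o\<^sub>L T r g" for r
  have X: "abs_sq (T r g) = X r" "X r \<in> M" if "0 \<le> r" for r
    using that g by (simp_all add: X_def ucp_map.S_adj[OF T_ucp])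
  define X' where "X' = ((- A (T r (adj g))) o\<^sub>L T r g) + (T r (adj g) o\<^sub>L (- A (T r g)))"
  have X': "X' \<in> M" using r g by (simp add: X'_def)
  have qX: "((\<lambda>e. (1 / e) *\<^sub>R (X (r + e) - X r)) \<longlongrightarrow> X') (at 0)"
  proof -
    have "((\<lambda>e. (((1 / e) *\<^sub>R (T (r + e) (adj g) - T r (adj g))) o\<^sub>L T (r + e) g)
        + (T r (adj g) o\<^sub>L ((1 / e) *\<^sub>R (T (r + e) g - T r g)))) \<longlongrightarrow> X') (at 0)"
      unfolding X'_def using r g
      by (intro tendsto_add bounded_bilinear.tendsto[OF bounded_bilinear_blinfun_compose] T_quotient T_continuous tendsto_const) auto
    moreover have "(((1 / e) *\<^sub>R (T (r + e) (adj g) - T r (adj g))) o\<^sub>L T (r + e) g)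
        + (T r (adj g) o\<^sub>L ((1 / e) *\<^sub>R (T (r + e) g - T r g))) = (1 / e) *\<^sub>R (X (r + e) - X r)" for e
      by (rule blinfun_eqI) (simp add: X_def blinfun.add_left blinfun.diff_left blinfun.scaleR_left
          blinfun.diff_right blinfun.scaleR_right algebra_simps)
    ultimately show ?thesis by simp
  qed
  have wr: "0 < w - r" using r by simp
  have q1: "((\<lambda>e. T (w - (r + e)) ((1 / e) *\<^sub>R (X (r + e) - X r))) \<longlongrightarrow> T (w - r) X') (at 0)"
  proof -
    have lim0: "((\<lambda>e. norm ((1 / e) *\<^sub>R (X (r + e) - X r) - X') + norm (T (w - (r + e)) X' - T (w - r) X')) \<longlongrightarrow> 0) (at 0)"
    proof -
      have "((\<lambda>e. T (w - r + - e) X') \<longlongrightarrow> T (w - r) X') (at 0)"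
        by (rule filterlim_compose[OF T_continuous[OF wr X'] filterlim_uminus_at_0])
      then have "((\<lambda>e. T (w - (r + e)) X' - T (w - r) X') \<longlongrightarrow> 0) (at 0)"
        by (simp add: LIM_zero algebra_simps)
      then show ?thesis using tendsto_add[OF tendsto_norm_zero[OF LIM_zero[OF qX]] tendsto_norm_zero] by simp
    qed
    have ev: "\<forall>\<^sub>F e in at 0. \<bar>e\<bar> < min r (w - r)"
      using r by (auto simp: eventually_at dist_real_def intro!: exI[of _ "min r (w - r)"])
    have "((\<lambda>e. T (w - (r + e)) ((1 / e) *\<^sub>R (X (r + e) - X r)) - T (w - r) X') \<longlongrightarrow> 0) (at 0)"
    proof (rule Lim_null_comparison[OF _ lim0])
      show "\<forall>\<^sub>F e in at 0. norm (T (w - (r + e)) ((1 / e) *\<^sub>R (X (r + e) - X r)) - T (w - r) X')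
        \<le> norm ((1 / e) *\<^sub>R (X (r + e) - X r) - X') + norm (T (w - (r + e)) X' - T (w - r) X')"
        using ev
      proof eventually_elim
        case (elim e)
        let ?q = "(1 / e) *\<^sub>R (X (r + e) - X r)"
        have q: "?q \<in> M" using elim r by (intro M_scaleR M_diff X(2)) auto
        interpret S: ucp_map M "T (w - (r + e))" using elim by (intro T_ucp) auto
        have "T (w - (r + e)) ?q - T (w - r) X' = T (w - (r + e)) (?q - X') + (T (w - (r + e)) X' - T (w - r) X')"
          unfolding S.S_diff[OF q X'] by simp
        also have "norm \<dots> \<le> norm (T (w - (r + e)) (?q - X')) + norm (T (w - (r + e)) X' - T (w - r) X')"
          by (rule norm_triangle_ineq)
        also have "\<dots> \<le> norm (?q - X') + norm (T (w - (r + e)) X' - T (w - r) X')"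
          by (intro add_right_mono S.contraction M_diff q X')
        finally show ?case .
      qed
    qed
    then show ?thesis by (rule LIM_zero_cancel)
  qed
  have q2: "((\<lambda>e. (1 / e) *\<^sub>R (T (w - (r + e)) (X r) - T (w - r) (X r))) \<longlongrightarrow> A (T (w - r) (X r))) (at 0)"
  proof -
    have "((\<lambda>e. (1 / (- e)) *\<^sub>R (T (w - r + - e) (X r) - T (w - r) (X r))) \<longlongrightarrow> - A (T (w - r) (X r))) (at 0)"
      using r by (intro filterlim_compose[OF T_quotient[OF wr X(2)] filterlim_uminus_at_0]) simp
    then have "((\<lambda>e. - ((1 / (- e)) *\<^sub>R (T (w - r + - e) (X r) - T (w - r) (X r)))) \<longlongrightarrow> - (- A (T (w - r) (X r)))) (at 0)"
      by (rule tendsto_minus)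
    then show ?thesis by (simp add: algebra_simps)
  qed
  define \<phi> where "\<phi> x = Re (cinner \<xi> (blinfun_apply x \<xi>))" for x :: "'h op"
  have \<phi>_lin: "\<phi> (x + z) = \<phi> x + \<phi> z" "\<phi> (x - z) = \<phi> x - \<phi> z" "\<phi> (r *\<^sub>R x) = r * \<phi> x" for x z r
    by (simp_all add: \<phi>_def blinfun.add_left blinfun.diff_left blinfun.scaleR_left cinner_simps)
  have \<phi>_tendsto: "((\<lambda>e. \<phi> (F e)) \<longlongrightarrow> \<phi> l) G" if "(F \<longlongrightarrow> l) G" for F l and G :: "real filter"
    unfolding \<phi>_def using that by (intro tendsto_intros cinner.tendsto)
  have "((\<lambda>e. \<phi> (T (w - (r + e)) ((1 / e) *\<^sub>R (X (r + e) - X r)) + (1 / e) *\<^sub>R (T (w - (r + e)) (X r) - T (w - r) (X r))))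
      \<longlongrightarrow> \<phi> (T (w - r) X' + A (T (w - r) (X r)))) (at 0)"
    by (intro \<phi>_tendsto tendsto_add q1 q2)
  moreover have "\<forall>\<^sub>F e in at 0. \<phi> (T (w - (r + e)) ((1 / e) *\<^sub>R (X (r + e) - X r)) + (1 / e) *\<^sub>R (T (w - (r + e)) (X r) - T (w - r) (X r)))
      = (\<phi> (T (w - (r + e)) (abs_sq (T (r + e) g))) - \<phi> (T (w - r) (abs_sq (T r g)))) / e"
  proof -
    have ev: "\<forall>\<^sub>F e in at 0. \<bar>e\<bar> < min r (w - r)"
      using r by (auto simp: eventually_at dist_real_def intro!: exI[of _ "min r (w - r)"])
    then show ?thesis
    proof eventually_elim
      case (elim e)
      interpret S: ucp_map M "T (w - (r + e))" using elim by (intro T_ucp) auto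
      have re: "0 \<le> r + e" "0 \<le> r" using elim by auto
      have "T (w - (r + e)) ((1 / e) *\<^sub>R (X (r + e) - X r))
          = (1 / e) *\<^sub>R (T (w - (r + e)) (X (r + e)) - T (w - (r + e)) (X r))"
        using X(2)[OF re(1)] X(2)[OF re(2)] by (simp only: S.S_scaleR S.S_diff M_diff)
      then show ?case
        unfolding X(1)[OF re(1)] X(1)[OF re(2)] by (simp only: \<phi>_lin) (simp add: diff_divide_distrib)
    qed
  qed
  ultimately have "((\<lambda>e. (\<phi> (T (w - (r + e)) (abs_sq (T (r + e) g))) - \<phi> (T (w - r) (abs_sq (T r g)))) / e)
      \<longlongrightarrow> \<phi> (T (w - r) X' + A (T (w - r) (X r)))) (at 0)"
    by (rule Lim_transform_eventually)
  then have D: "((\<lambda>r. \<phi> (T (w - r) (abs_sq (T r g)))) has_real_derivative \<phi> (T (w - r) X' + A (T (w - r) (X r)))) (at r)"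
    by (simp add: DERIV_def)
  have "gamma_form M T (w - r) r g = (- 1 / 2) *\<^sub>R (T (w - r) X' + A (T (w - r) (X r)))"
  proof -
    interpret S: ucp_map M "T (w - r)" using r by (intro T_ucp) auto
    have m: "A (T r (adj g)) o\<^sub>L T r g \<in> M" "T r (adj g) o\<^sub>L A (T r g) \<in> M" using r g by simp_all
    have "X' = (-1) *\<^sub>R ((A (T r (adj g)) o\<^sub>L T r g) + (T r (adj g) o\<^sub>L A (T r g)))"
      by (rule blinfun_eqI) (simp add: X'_def blinfun.add_left blinfun.diff_left blinfun.minus_left blinfun.minus_right)
    then have "T (w - r) X' = (-1) *\<^sub>R (T (w - r) (A (T r (adj g)) o\<^sub>L T r g) + T (w - r) (T r (adj g) o\<^sub>L A (T r g)))"
      by (simp only: S.S_scaleR[OF M_add[OF m]] S.S_add[OF m])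
    then show ?thesis
      unfolding gamma_form_def X_def by (simp add: scaleR_add_right scaleR_diff_right)
  qed
  then have "\<phi> (T (w - r) X' + A (T (w - r) (X r))) = - 2 * \<phi> (gamma_form M T (w - r) r g)"
    by (simp only: \<phi>_lin) (simp add: field_simps)
  with D show ?thesis unfolding \<phi>_def by (simp only:)
qed

end

text \<open>The value at \<open>\<xi>\<close> of the conditional variance \<open>T\<^sub>u \<bar>x\<bar>\<^sup>2 - \<bar>T\<^sub>u x\<bar>\<^sup>2\<close>.\<close>

definition variance_form :: "real \<Rightarrow> 'h \<Rightarrow> 'h op \<Rightarrow> real" where
  "variance_form u \<xi> x = Re (cinner \<xi> (blinfun_apply (T u (abs_sq x)) \<xi>)) - (norm (blinfun_apply (T u x) \<xi>))\<^sup>2"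

definition reverse_poincare :: bool where
  "reverse_poincare \<longleftrightarrow> (\<forall>u>0. \<forall>s>0. \<forall>g\<in>M. \<forall>\<xi>. variance_form u \<xi> (T s g) \<le> 2 * u / s * (norm g)\<^sup>2 * (norm \<xi>)\<^sup>2)"

text \<open>The variance is the decrease of the convex function \<open>h(r) = T\<^sub>w\<^sub>-\<^sub>r \<bar>T\<^sub>r g\<bar>\<^sup>2\<close> over \<open>[s, s + u]\<close>. By convexity the
  slope there is no steeper than over \<open>[s/2, s]\<close>, where \<open>0 \<le> h \<le> \<parallel>g\<parallel>\<^sup>2\<close>. The endpoint \<open>w = s + u\<close>, at which
  the outer semigroup degenerates, is reached as a weak-* limit \<open>\<epsilon> \<rightarrow> 0\<close> with \<open>w = s + u + \<epsilon>\<close>.\<close>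

theorem gamma2_reverse_poincare:
  assumes regular: dom_regular and \<Gamma>: "gamma2_nonneg M T"
  shows reverse_poincare
  unfolding reverse_poincare_def
proof (intro allI impI ballI)
  fix u s :: real and g \<xi> assume u: "0 < u" and s: "0 < s" and g: "g \<in> M"
  have step: "Re (cinner \<xi> (blinfun_apply (T (\<epsilon> + u) (abs_sq (T s g))) \<xi>)) - Re (cinner \<xi> (blinfun_apply (T \<epsilon> (abs_sq (T (s + u) g))) \<xi>))
      \<le> 2 * u / s * (norm g)\<^sup>2 * (norm \<xi>)\<^sup>2" if \<epsilon>: "0 < \<epsilon>" for \<epsilon>
  proof -
    define w where "w = s + u + \<epsilon>"
    define h where "h r = Re (cinner \<xi> (blinfun_apply (T (w - r) (abs_sq (T r g))) \<xi>))" for r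
    define h' where "h' r = - 2 * Re (cinner \<xi> (blinfun_apply (gamma_form M T (w - r) r g) \<xi>))" for r
    have D: "DERIV h r :> h' r" if "0 < r" "r < w" for r
      using interpolation_derivative[OF regular g that, of \<xi>] unfolding h_def[abs_def] h'_def .
    have mono: "h' r1 \<le> h' r2" if "0 < r1" "r1 < r2" "r2 < w" for r1 r2
    proof -
      have "op_le (gamma_form M T (w - r2) (r1 + (r2 - r1)) g) (gamma_form M T (w - r2 + (r2 - r1)) r1 g)"
        using \<Gamma>[unfolded gamma2_nonneg_def, rule_format, of "w - r2" r1 "r2 - r1" g] that g by simp
      then have "cinner \<xi> (blinfun_apply (gamma_form M T (w - r1) r1 g - gamma_form M T (w - r2) r2 g) \<xi>) \<in> \<real>\<^sub>\<ge>\<^sub>0"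
        unfolding op_le_def positive_op_def by simp
      then show ?thesis by (simp add: h'_def complex_nonneg_Reals_iff blinfun.diff_left cinner_simps)
    qed
    obtain z1 where z1: "s / 2 < z1" "z1 < s" "h s - h (s / 2) = (s - s / 2) * h' z1"
      using MVT2[of "s / 2" s h h'] D s u \<epsilon> by (auto simp: w_def)
    obtain z2 where z2: "s < z2" "z2 < s + u" "h (s + u) - h s = (s + u - s) * h' z2"
      using MVT2[of s "s + u" h h'] D s u \<epsilon> by (auto simp: w_def)
    have "h' z1 \<le> h' z2" using z1 z2 s \<epsilon> by (intro mono) (auto simp: w_def)
    have nonneg: "0 \<le> h r" and upper: "h r \<le> (norm g)\<^sup>2 * (norm \<xi>)\<^sup>2" if "0 < r" "r < w" for r
    proof -
      interpret S: ucp_map M "T (w - r)" using that by (intro T_ucp) auto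
      have m: "T r g \<in> M" using that g by simp
      show "0 \<le> h r" unfolding h_def using S.schwarz[OF m, of \<xi>] zero_le_power2 order_trans by blast
      have "h r \<le> (norm (T r g))\<^sup>2 * (norm \<xi>)\<^sup>2" unfolding h_def by (rule S.S_abs_sq_le[OF m])
      also have "\<dots> \<le> (norm g)\<^sup>2 * (norm \<xi>)\<^sup>2"
        using that g by (intro mult_right_mono power_mono T_contraction) auto
      finally show "h r \<le> (norm g)\<^sup>2 * (norm \<xi>)\<^sup>2" .
    qed
    have "h s - h (s + u) = u * (- h' z2)" using z2(3) by simp
    also have "\<dots> \<le> u * (- h' z1)" using u \<open>h' z1 \<le> h' z2\<close> by (intro mult_left_mono) auto
    also have "- h' z1 = 2 / s * (h (s / 2) - h s)" using z1(3) s by (simp add: field_simps)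
    also have "u * (2 / s * (h (s / 2) - h s)) \<le> u * (2 / s * ((norm g)\<^sup>2 * (norm \<xi>)\<^sup>2))"
      using u s nonneg[of s] upper[of "s / 2"] \<epsilon> by (intro mult_left_mono) (auto simp: w_def)
    finally show ?thesis by (simp add: h_def w_def algebra_simps)
  qed
  have m: "T s g \<in> M" "T (s + u) g \<in> M" using s u g by simp_all
  have "variance_form u \<xi> (T s g) = Re (cinner \<xi> (blinfun_apply (T u (abs_sq (T s g))) \<xi>)) - Re (cinner \<xi> (blinfun_apply (abs_sq (T (s + u) g)) \<xi>))"
  proof -
    have "T u (T s g) = T (s + u) g" using s u g by (simp add: T_semigroup add.commute)
    then show ?thesis unfolding variance_form_def cinner_abs_sq[OF m(2)] by simp
  qed
  also have "\<dots> \<le> 2 * u / s * (norm g)\<^sup>2 * (norm \<xi>)\<^sup>2"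
  proof (rule tendsto_upperbound)
    have mm: "T u (abs_sq (T s g)) \<in> M" "abs_sq (T (s + u) g) \<in> M" using m u by simp_all
    show "((\<lambda>\<epsilon>. Re (cinner \<xi> (blinfun_apply (T \<epsilon> (T u (abs_sq (T s g)))) \<xi>)) - Re (cinner \<xi> (blinfun_apply (T \<epsilon> (abs_sq (T (s + u) g))) \<xi>)))
        \<longlongrightarrow> Re (cinner \<xi> (blinfun_apply (T u (abs_sq (T s g))) \<xi>)) - Re (cinner \<xi> (blinfun_apply (abs_sq (T (s + u) g)) \<xi>))) (at_right 0)"
      by (intro tendsto_diff tendsto_Re T_limit_0[OF normal_functional_vector mm(1)] T_limit_0[OF normal_functional_vector mm(2)])
    show "\<forall>\<^sub>F \<epsilon> in at_right 0. Re (cinner \<xi> (blinfun_apply (T \<epsilon> (T u (abs_sq (T s g)))) \<xi>)) - Re (cinner \<xi> (blinfun_apply (T \<epsilon> (abs_sq (T (s + u) g))) \<xi>))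
        \<le> 2 * u / s * (norm g)\<^sup>2 * (norm \<xi>)\<^sup>2"
      using eventually_at_right_less[of 0]
    proof eventually_elim
      case (elim \<epsilon>)
      have "T \<epsilon> (T u (abs_sq (T s g))) = T (\<epsilon> + u) (abs_sq (T s g))"
        using elim u m by (intro T_semigroup) auto
      then show ?case using step[OF elim] by simp
    qed
  qed simp
  finally show "variance_form u \<xi> (T s g) \<le> 2 * u / s * (norm g)\<^sup>2 * (norm \<xi>)\<^sup>2" .
qed

end

section \<open>Smoothing estimates for the Poisson semigroup\<close>

context markov
begin

definition kernel_moment :: real where
  "kernel_moment = (\<integral>r. r powr (-1) \<partial>subordinator 1)"

lemma kernel_moment:
  assumes v: "0 < v"
  shows "integrable (subordinator v) (\<lambda>r. r powr (-1))"
    and "(\<integral>r. r powr (-1) \<partial>subordinator v) = kernel_moment / v\<^sup>2"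
proof -
  show "integrable (subordinator v) (\<lambda>r. r powr (-1))"
    by (rule subordinator_moment(1)[OF v]) auto
  have "v powr (2 * (-1)) = 1 / v\<^sup>2"
    using v by (simp add: powr_minus_divide)
  then show "(\<integral>r. r powr (-1) \<partial>subordinator v) = kernel_moment / v\<^sup>2"
    using subordinator_moment(2)[OF v, of "-1"] by (simp add: kernel_moment_def)
qed

lemma kernel_moment_nonneg: "0 \<le> kernel_moment"
  unfolding kernel_moment_def by (rule integral_nonneg_AE) simp

lemma T_P_integral:
  assumes \<phi>: "\<phi> \<in> normal_functionals" and f: "f \<in> M" and u: "0 \<le> u" and v: "0 < v"
  shows "\<phi> (T u (P v f)) = (\<integral>r. \<phi> (T \<bar>r + u\<bar> f) \<partial>subordinator v)"
proof -
  note [measurable] = orbit_measurable[OF \<phi> f]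
  obtain \<psi> where \<psi>: "\<psi> \<in> normal_functionals" "\<And>x. x \<in> M \<Longrightarrow> \<phi> (T u x) = \<psi> x"
    using T_normal[OF \<phi> u] by blast
  have "\<phi> (T u (P v f)) = (\<integral>r. \<psi> (T \<bar>r\<bar> f) \<partial>subordinator v)"
    using f v by (simp add: \<psi> P_integral)
  also have "\<dots> = (\<integral>r. \<phi> (T \<bar>\<bar>r\<bar> + u\<bar> f) \<partial>subordinator v)"
    using f u by (simp add: \<psi>(2)[symmetric] T_semigroup add.commute)
  also have "\<dots> = (\<integral>r. \<phi> (T \<bar>r + u\<bar> f) \<partial>subordinator v)"
    using AE_subordinator_pos[OF v] by (intro integral_cong_AE) (auto elim!: eventually_mono)
  finally show ?thesis .
qed

text \<open>Applying \<open>T\<^sub>u\<close> translates the subordination law by \<open>u\<close>.\<close>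

lemma norm_T_P_diff:
  assumes f: "f \<in> M" and u: "0 \<le> u" and v: "0 < v"
  shows "norm (T u (P v f) - P v f) \<le> 4 * kernel_moment * u / v\<^sup>2 * norm f"
proof (rule norm_blinfun_bound)
  show nn: "0 \<le> 4 * kernel_moment * u / v\<^sup>2 * norm f" using kernel_moment_nonneg u by simp
  fix \<eta>
  show "norm (blinfun_apply (T u (P v f) - P v f) \<eta>) \<le> 4 * kernel_moment * u / v\<^sup>2 * norm f * norm \<eta>"
  proof (rule norm_le_of_cinner)
    fix \<xi>
    let ?k = "\<lambda>r. cinner \<xi> (blinfun_apply (T \<bar>r\<bar> f) \<eta>)"
    have b: "norm (?k r) \<le> norm \<xi> * (norm f * norm \<eta>)" for r
    proof -
      have "norm (?k r) \<le> norm \<xi> * norm (blinfun_apply (T \<bar>r\<bar> f) \<eta>)" by (rule cinner_le_norm)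
      also have "\<dots> \<le> norm \<xi> * (norm (T \<bar>r\<bar> f) * norm \<eta>)" by (intro mult_left_mono norm_blinfun) simp
      also have "\<dots> \<le> norm \<xi> * (norm f * norm \<eta>)"
        using f by (intro mult_left_mono mult_right_mono T_contraction) auto
      finally show ?thesis .
    qed
    have "cinner \<xi> (blinfun_apply (T u (P v f) - P v f) \<eta>)
        = (\<integral>r. ?k (r + u) \<partial>subordinator v) - (\<integral>r. ?k r \<partial>subordinator v)"
      using T_P_integral[OF normal_functional_vector f u v, of \<xi> \<eta>] P_integral[OF f v normal_functional_vector, of \<xi> \<eta>]
      by (simp add: blinfun.diff_left cinner_simps)
    also have "norm \<dots> \<le> 4 * u * (norm \<xi> * (norm f * norm \<eta>)) * (\<integral>r. r powr (-1) \<partial>subordinator v)"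
      by (rule subordinator_shift[OF orbit_measurable[OF normal_functional_vector f] v u b])
    also have "\<dots> = 4 * kernel_moment * u / v\<^sup>2 * norm f * norm \<eta> * norm \<xi>"
      unfolding kernel_moment(2)[OF v] by simp
    finally show "cmod (cinner \<xi> (blinfun_apply (T u (P v f) - P v f) \<eta>))
        \<le> 4 * kernel_moment * u / v\<^sup>2 * norm f * norm \<eta> * norm \<xi>" .
  qed (rule mult_nonneg_nonneg[OF nn norm_ge_zero])
qed

text \<open>The polarisation of \<open>variance_form\<close>. For fixed \<open>m\<close> it is a normal functional of \<open>x\<close>, so it may be
  averaged against the subordination law.\<close>

definition variance_polar :: "real \<Rightarrow> 'h \<Rightarrow> 'h op \<Rightarrow> 'h op \<Rightarrow> complex" where
  "variance_polar u \<xi> m x = cinner \<xi> (blinfun_apply (T u (adj m o\<^sub>L x)) \<xi>)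
     - cinner (blinfun_apply (T u m) \<xi>) (blinfun_apply (T u x) \<xi>)"

lemma variance_form_nonneg: "0 \<le> u \<Longrightarrow> x \<in> M \<Longrightarrow> 0 \<le> variance_form u \<xi> x"
  using ucp_map.schwarz[OF T_ucp, of u x \<xi>] by (simp add: variance_form_def)

lemma variance_form_le: "0 \<le> u \<Longrightarrow> x \<in> M \<Longrightarrow> variance_form u \<xi> x \<le> (norm x)\<^sup>2 * (norm \<xi>)\<^sup>2"
  using ucp_map.S_abs_sq_le[OF T_ucp, of u x \<xi>] zero_le_power2[of "norm (blinfun_apply (T u x) \<xi>)"]
  unfolding variance_form_def by linarith

lemma Re_cinner_T_adj:
  assumes u: "0 \<le> u" and x: "x \<in> M"
  shows "Re (cinner \<xi> (blinfun_apply (T u (adj x)) \<xi>)) = Re (cinner \<xi> (blinfun_apply (T u x) \<xi>))"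
proof -
  have "cinner \<xi> (blinfun_apply (T u (adj x)) \<xi>) = cinner (blinfun_apply (T u x) \<xi>) \<xi>"
    using u x by (simp add: ucp_map.S_adj[OF T_ucp] cinner_adj)
  then show ?thesis by (simp add: Re_cinner_commute)
qed

lemma abs_sq_add_scaleR:
  assumes "f \<in> M" "g \<in> M"
  shows "abs_sq (f + r *\<^sub>R g) = abs_sq f + r *\<^sub>R ((adj f o\<^sub>L g) + (adj g o\<^sub>L f)) + r\<^sup>2 *\<^sub>R abs_sq g"
  by (rule blinfun_eqI)
    (simp add: assms adj_add adj_scaleR blinfun.add_left blinfun.scaleR_left blinfun.add_right
      blinfun.scaleR_right power2_eq_square scaleR_add_right)

lemma Re_T_abs_sq_add_scaleR:
  assumes u: "0 \<le> u" and f: "f \<in> M" and g: "g \<in> M"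
  shows "Re (cinner \<xi> (blinfun_apply (T u (abs_sq (f + r *\<^sub>R g))) \<xi>))
    = Re (cinner \<xi> (blinfun_apply (T u (abs_sq f)) \<xi>)) + r * (2 * Re (cinner \<xi> (blinfun_apply (T u (adj f o\<^sub>L g)) \<xi>)))
      + r\<^sup>2 * Re (cinner \<xi> (blinfun_apply (T u (abs_sq g)) \<xi>))"
proof -
  interpret S: ucp_map M "T u" by (rule T_ucp[OF u])
  have m: "abs_sq f \<in> M" "abs_sq g \<in> M" "adj f o\<^sub>L g \<in> M" "adj g o\<^sub>L f \<in> M" using f g by simp_all
  have "adj g o\<^sub>L f = adj (adj f o\<^sub>L g)" using f g by (simp add: adj_compose)
  then have sym: "Re (cinner \<xi> (blinfun_apply (T u (adj g o\<^sub>L f)) \<xi>)) = Re (cinner \<xi> (blinfun_apply (T u (adj f o\<^sub>L g)) \<xi>))"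
    using Re_cinner_T_adj[OF u m(3)] by simp
  have "T u (abs_sq (f + r *\<^sub>R g)) = T u (abs_sq f) + r *\<^sub>R (T u (adj f o\<^sub>L g) + T u (adj g o\<^sub>L f)) + r\<^sup>2 *\<^sub>R T u (abs_sq g)"
    unfolding abs_sq_add_scaleR[OF f g] using m by (simp only: S.S_add S.S_scaleR M_add M_scaleR)
  then show ?thesis
    by (simp only: blinfun.add_left blinfun.scaleR_left cinner_simps plus_complex.sel Re_complex_of_real Im_complex_of_real
        times_complex.sel sym) simp
qed

lemma variance_form_diff:
  assumes u: "0 \<le> u" and m: "m \<in> M" and x: "x \<in> M"
  shows "variance_form u \<xi> (x - m) = variance_form u \<xi> x - 2 * Re (variance_polar u \<xi> m x) + variance_form u \<xi> m"
proof -
  interpret S: ucp_map M "T u" by (rule T_ucp[OF u])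
  have 1: "Re (cinner \<xi> (blinfun_apply (T u (abs_sq (x - m))) \<xi>))
      = Re (cinner \<xi> (blinfun_apply (T u (abs_sq x)) \<xi>)) - 2 * Re (cinner \<xi> (blinfun_apply (T u (adj m o\<^sub>L x)) \<xi>))
      + Re (cinner \<xi> (blinfun_apply (T u (abs_sq m)) \<xi>))"
  proof -
    have "adj x o\<^sub>L m = adj (adj m o\<^sub>L x)" using m x by (simp add: adj_compose)
    then have "Re (cinner \<xi> (blinfun_apply (T u (adj x o\<^sub>L m)) \<xi>)) = Re (cinner \<xi> (blinfun_apply (T u (adj m o\<^sub>L x)) \<xi>))"
      using Re_cinner_T_adj[OF u, of "adj m o\<^sub>L x" \<xi>] m x by simp
    then show ?thesis using Re_T_abs_sq_add_scaleR[OF u x m, of \<xi> "-1"] by simp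
  qed
  have 2: "(norm (blinfun_apply (T u (x - m)) \<xi>))\<^sup>2 = (norm (blinfun_apply (T u x) \<xi>))\<^sup>2
      - 2 * Re (cinner (blinfun_apply (T u m) \<xi>) (blinfun_apply (T u x) \<xi>)) + (norm (blinfun_apply (T u m) \<xi>))\<^sup>2"
    by (simp add: S.S_diff[OF x m] blinfun.diff_left norm_diff_sq Re_cinner_commute)
  show ?thesis unfolding variance_form_def variance_polar_def 1 2 by simp
qed

lemma variance_polar_self: "m \<in> M \<Longrightarrow> Re (variance_polar u \<xi> m m) = variance_form u \<xi> m"
  by (simp add: variance_polar_def variance_form_def Re_cinner_self)

lemma variance_polar_normal:
  assumes u: "0 \<le> u" and m: "m \<in> M"
  obtains \<beta> where "\<beta> \<in> normal_functionals" "\<And>x. x \<in> M \<Longrightarrow> variance_polar u \<xi> m x = \<beta> x"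
proof -
  obtain \<psi>1 where 1: "\<psi>1 \<in> normal_functionals" "\<And>x. x \<in> M \<Longrightarrow> cinner \<xi> (blinfun_apply (T u x) \<xi>) = \<psi>1 x"
    using T_normal[OF normal_functional_vector u, of \<xi> \<xi>] by blast
  obtain \<psi>2 where 2: "\<psi>2 \<in> normal_functionals"
      "\<And>x. x \<in> M \<Longrightarrow> cinner (blinfun_apply (T u m) \<xi>) (blinfun_apply (T u x) \<xi>) = \<psi>2 x"
    using T_normal[OF normal_functional_vector u, of "blinfun_apply (T u m) \<xi>" \<xi>] by blast
  have "(\<lambda>x. \<psi>1 (adj m o\<^sub>L x) + (-1) * \<psi>2 x) \<in> normal_functionals"
    by (rule normal_functional_add[OF normal_functional_left_mult[OF 1(1) is_adjoint_sym[OF is_adjoint_adj[OF m]]]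
          normal_functional_cmult[OF 2(1)]])
  then show thesis
    by (rule that) (use m in \<open>simp add: variance_polar_def 1(2) 2(2)\<close>)
qed

text \<open>Jensen's inequality for the convex form \<open>V\<close> of the variance. With \<open>m = P\<^sub>v g\<close>, the inequality
  \<open>0 \<le> V(T\<^sub>r g - m)\<close> is expanded, \<open>V(T\<^sub>r g)\<close> is estimated by the reverse Poincare inequality, and the
  result is integrated in \<open>r\<close>: only the cross term, a normal functional of \<open>T\<^sub>r g\<close>, depends on the orbit.\<close>

lemma variance_P_le:
  assumes rp: reverse_poincare and u: "0 < u" and v: "0 < v" and g: "g \<in> M"
  shows "variance_form u \<xi> (P v g) \<le> 2 * kernel_moment * u / v\<^sup>2 * (norm g)\<^sup>2 * (norm \<xi>)\<^sup>2"
proof -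
  interpret prob_space "subordinator v" by (rule prob_space_subordinator[OF v])
  define m where "m = P v g"
  have m: "m \<in> M" using g v by (simp add: m_def)
  define K where "K = 2 * u * ((norm g)\<^sup>2 * (norm \<xi>)\<^sup>2)"
  have u0: "0 \<le> u" using u by simp
  obtain \<beta> where \<beta>: "\<beta> \<in> normal_functionals" "\<And>x. x \<in> M \<Longrightarrow> variance_polar u \<xi> m x = \<beta> x"
    using variance_polar_normal[OF u0 m] by blast
  have ptw: "2 * Re (\<beta> (T \<bar>r\<bar> g)) \<le> K * r powr (-1) + variance_form u \<xi> m" if r: "0 < r" for r
  proof -
    have x: "T r g \<in> M" using r g by simp
    have "0 \<le> variance_form u \<xi> (T r g - m)" using x m u by (intro variance_form_nonneg) auto
    then have "2 * Re (\<beta> (T r g)) \<le> variance_form u \<xi> (T r g) + variance_form u \<xi> m"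
      unfolding variance_form_diff[OF u0 m x] \<beta>(2)[OF x] by simp
    also have "variance_form u \<xi> (T r g) \<le> 2 * u / r * (norm g)\<^sup>2 * (norm \<xi>)\<^sup>2"
      using rp u r g unfolding reverse_poincare_def by blast
    also have "2 * u / r * (norm g)\<^sup>2 * (norm \<xi>)\<^sup>2 = K * r powr (-1)"
      using r by (simp add: K_def powr_minus_divide)
    finally show ?thesis using r by simp
  qed
  have int: "integrable (subordinator v) (\<lambda>r. \<beta> (T \<bar>r\<bar> g))" by (rule orbit_integrable[OF \<beta>(1) g v])
  have "2 * variance_form u \<xi> m = 2 * Re (\<beta> m)"
    using variance_polar_self[OF m, of u \<xi>] \<beta>(2)[OF m] by simp
  also have "\<dots> = (\<integral>r. 2 * Re (\<beta> (T \<bar>r\<bar> g)) \<partial>subordinator v)"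
    using P_integral[OF g v \<beta>(1)] int by (simp add: m_def)
  also have "\<dots> \<le> (\<integral>r. K * r powr (-1) + variance_form u \<xi> m \<partial>subordinator v)"
  proof (rule integral_mono_AE)
    show "AE r in subordinator v. 2 * Re (\<beta> (T \<bar>r\<bar> g)) \<le> K * r powr (-1) + variance_form u \<xi> m"
      using AE_subordinator_pos[OF v] by eventually_elim (rule ptw)
    show "integrable (subordinator v) (\<lambda>r. 2 * Re (\<beta> (T \<bar>r\<bar> g)))" using int by simp
    show "integrable (subordinator v) (\<lambda>r. K * r powr (-1) + variance_form u \<xi> m)"
      by (intro Bochner_Integration.integrable_add integrable_mult_right kernel_moment(1)[OF v] integrable_const)
  qed
  also have "\<dots> = K * (kernel_moment / v\<^sup>2) + variance_form u \<xi> m"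
  proof -
    have "(\<integral>r. K * r powr (-1) + variance_form u \<xi> m \<partial>subordinator v)
        = (\<integral>r. K * r powr (-1) \<partial>subordinator v) + (\<integral>r. variance_form u \<xi> m \<partial>subordinator v)"
      by (intro Bochner_Integration.integral_add integrable_mult_right kernel_moment(1)[OF v] integrable_const)
    then show ?thesis
      unfolding Bochner_Integration.integral_mult_right_zero kernel_moment(2)[OF v] using prob_space by simp
  qed
  finally have "variance_form u \<xi> m \<le> K * (kernel_moment / v\<^sup>2)" by linarith
  also have "\<dots> = 2 * kernel_moment * u / v\<^sup>2 * (norm g)\<^sup>2 * (norm \<xi>)\<^sup>2" by (simp add: K_def)
  finally show ?thesis unfolding m_def .
qed

section \<open>The second moment seminorm\<close>

text \<open>The value at \<open>\<xi>\<close> of \<open>T\<^sub>u \<bar>f\<bar>\<^sup>2 - f\<^sup>* T\<^sub>u f - (T\<^sub>u f)\<^sup>* f + \<bar>f\<bar>\<^sup>2\<close>: classically, the mean of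
  \<open>\<bar>f(y) - f(x)\<bar>\<^sup>2\<close> over \<open>y\<close>. Unlike the variance it is affine in \<open>T\<^sub>u\<close>, so that it can be integrated over
  \<open>u\<close>.\<close>

definition moment_form :: "real \<Rightarrow> 'h \<Rightarrow> 'h op \<Rightarrow> real" where
  "moment_form u \<xi> f = Re (cinner \<xi> (blinfun_apply (T u (abs_sq f)) \<xi>))
     - 2 * Re (cinner (blinfun_apply f \<xi>) (blinfun_apply (T u f) \<xi>)) + (norm (blinfun_apply f \<xi>))\<^sup>2"

lemma moment_form_variance:
  "moment_form u \<xi> f = variance_form u \<xi> f + (norm (blinfun_apply (T u f) \<xi> - blinfun_apply f \<xi>))\<^sup>2"
  by (simp add: moment_form_def variance_form_def norm_diff_sq Re_cinner_commute)

lemma moment_form_nonneg: "0 \<le> u \<Longrightarrow> f \<in> M \<Longrightarrow> 0 \<le> moment_form u \<xi> f"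
  using variance_form_nonneg[of u f \<xi>] by (simp add: moment_form_variance)

text \<open>The form is quadratic and nonnegative, so the cross term obeys Cauchy--Schwarz.\<close>

lemma moment_seminorm_triangle:
  assumes u: "0 \<le> u" and f: "f \<in> M" and g: "g \<in> M"
  shows "sqrt (moment_form u \<xi> (f + g)) \<le> sqrt (moment_form u \<xi> f) + sqrt (moment_form u \<xi> g)"
proof -
  interpret S: ucp_map M "T u" by (rule T_ucp[OF u])
  define b where "b = 2 * Re (cinner \<xi> (blinfun_apply (T u (adj f o\<^sub>L g)) \<xi>))
    - 2 * Re (cinner (blinfun_apply f \<xi>) (blinfun_apply (T u g) \<xi>))
    - 2 * Re (cinner (blinfun_apply g \<xi>) (blinfun_apply (T u f) \<xi>))
    + 2 * Re (cinner (blinfun_apply f \<xi>) (blinfun_apply g \<xi>))"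
  let ?q = "moment_form u \<xi>"
  have expand: "?q (f + r *\<^sub>R g) = ?q f + r * b + r\<^sup>2 * ?q g" for r
  proof -
    have 1: "T u (f + r *\<^sub>R g) = T u f + r *\<^sub>R T u g" using f g by (simp add: S.S_add S.S_scaleR)
    have 2: "Re (cinner (blinfun_apply (f + r *\<^sub>R g) \<xi>) (blinfun_apply (T u (f + r *\<^sub>R g)) \<xi>))
        = Re (cinner (blinfun_apply f \<xi>) (blinfun_apply (T u f) \<xi>))
        + r * Re (cinner (blinfun_apply f \<xi>) (blinfun_apply (T u g) \<xi>))
        + r * Re (cinner (blinfun_apply g \<xi>) (blinfun_apply (T u f) \<xi>))
        + r\<^sup>2 * Re (cinner (blinfun_apply g \<xi>) (blinfun_apply (T u g) \<xi>))"
      unfolding 1 by (simp add: blinfun.add_left blinfun.scaleR_left cinner_simps power2_eq_square algebra_simps)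
    have 3: "(norm (blinfun_apply (f + r *\<^sub>R g) \<xi>))\<^sup>2 = (norm (blinfun_apply f \<xi>))\<^sup>2
        + r * (2 * Re (cinner (blinfun_apply f \<xi>) (blinfun_apply g \<xi>))) + r\<^sup>2 * (norm (blinfun_apply g \<xi>))\<^sup>2"
      by (simp add: blinfun.add_left blinfun.scaleR_left norm_add_sq cinner_simps power_mult_distrib)
    show ?thesis
      unfolding moment_form_def Re_T_abs_sq_add_scaleR[OF u f g] 2 3 b_def by (simp add: algebra_simps)
  qed
  have qf: "0 \<le> ?q f" and qg: "0 \<le> ?q g" using u f g by (simp_all add: moment_form_nonneg)
  have "b\<^sup>2 \<le> 4 * ?q f * ?q g"
  proof (rule nonneg_quadratic_discriminant)
    fix r show "0 \<le> ?q f + r * b + r\<^sup>2 * ?q g"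
      unfolding expand[symmetric] using u f g by (intro moment_form_nonneg) auto
  qed
  also have "\<dots> = (2 * (sqrt (?q f) * sqrt (?q g)))\<^sup>2" using qf qg by (simp add: power_mult_distrib)
  finally have "b \<le> 2 * (sqrt (?q f) * sqrt (?q g))"
    by (rule power2_le_imp_le) (use qf qg in simp)
  then have "?q (f + g) \<le> (sqrt (?q f) + sqrt (?q g))\<^sup>2"
    using expand[of 1] qf qg by (simp add: power2_sum)
  then show ?thesis using qf qg by (intro real_le_lsqrt) auto
qed

lemma moment_seminorm_le:
  assumes u: "0 \<le> u" and f: "f \<in> M"
  shows "sqrt (moment_form u \<xi> f) \<le> 3 * norm f * norm \<xi>"
proof (rule real_le_lsqrt)
  have "norm (blinfun_apply (T u f) \<xi> - blinfun_apply f \<xi>) \<le> norm f * norm \<xi> + norm f * norm \<xi>"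
  proof (intro order_trans[OF norm_triangle_ineq4] add_mono)
    show "norm (blinfun_apply (T u f) \<xi>) \<le> norm f * norm \<xi>"
      using mult_right_mono[OF T_contraction[OF u f], of "norm \<xi>"] norm_blinfun[of "T u f" \<xi>] by simp
  qed (rule norm_blinfun)
  then have d: "(norm (blinfun_apply (T u f) \<xi> - blinfun_apply f \<xi>))\<^sup>2 \<le> (2 * (norm f * norm \<xi>))\<^sup>2"
    by (intro power_mono) (auto simp: mult.commute)
  have "moment_form u \<xi> f \<le> (norm f * norm \<xi>)\<^sup>2 + (2 * (norm f * norm \<xi>))\<^sup>2"
    unfolding moment_form_variance
    using variance_form_le[OF u f, of \<xi>] d by (intro add_mono) (simp_all only: power_mult_distrib)
  also have "\<dots> \<le> (3 * (norm f * norm \<xi>))\<^sup>2"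
    unfolding power_mult_distrib[of 2] power_mult_distrib[of 3] by simp
  finally show "moment_form u \<xi> f \<le> (3 * norm f * norm \<xi>)\<^sup>2" by (simp only: mult.assoc)
qed simp

text \<open>Twice \<open>kernel_moment\<close> comes from the variance, and eight times from the displacement \<open>T\<^sub>u P\<^sub>v g - P\<^sub>v g\<close>.\<close>

definition smoothing_const :: real where "smoothing_const = sqrt (10 * kernel_moment)"

lemma moment_seminorm_P_le:
  assumes rp: reverse_poincare and u: "0 < u" and v: "0 < v" and g: "g \<in> M"
  shows "sqrt (moment_form u \<xi> (P v g)) \<le> smoothing_const * sqrt u / v * norm g * norm \<xi>"
proof (rule real_le_lsqrt)
  let ?d = "blinfun_apply (T u (P v g)) \<xi> - blinfun_apply (P v g) \<xi>"
  define c where "c = kernel_moment * u / v\<^sup>2"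
  have c: "0 \<le> c" using kernel_moment_nonneg u by (simp add: c_def)
  have u0: "0 \<le> u" using u by simp
  have d_apply: "norm ?d \<le> norm (T u (P v g) - P v g) * norm \<xi>"
    using norm_blinfun[of "T u (P v g) - P v g" \<xi>] by (simp add: blinfun.diff_left)
  \<comment> \<open>One factor of the square is bounded trivially, the other by the smoothing estimate.\<close>
  have g1: "norm (T u (P v g) - P v g) \<le> 2 * norm g"
  proof -
    have "norm (T u (P v g) - P v g) \<le> norm (P v g) + norm (P v g)"
      using T_contraction[OF u0 P_M[OF g v]] by (intro order_trans[OF norm_triangle_ineq4] add_right_mono)
    then show ?thesis using P_contraction[OF v g] by simp
  qed
  have d1: "norm ?d \<le> 2 * (norm g * norm \<xi>)"
    using order_trans[OF d_apply mult_right_mono[OF g1 norm_ge_zero]] by (simp only: mult.assoc)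
  have g2: "norm (T u (P v g) - P v g) \<le> 4 * c * norm g"
    using norm_T_P_diff[OF g u0 v] by (simp add: c_def)
  have d2: "norm ?d \<le> 4 * c * (norm g * norm \<xi>)"
    using order_trans[OF d_apply mult_right_mono[OF g2 norm_ge_zero]] by (simp only: mult.assoc)
  have "(norm ?d)\<^sup>2 \<le> (2 * (norm g * norm \<xi>)) * (4 * c * (norm g * norm \<xi>))"
    unfolding power2_eq_square using c by (intro mult_mono d1 d2) auto
  also have "\<dots> = 8 * c * ((norm g)\<^sup>2 * (norm \<xi>)\<^sup>2)" by (simp add: power2_eq_square)
  finally have "moment_form u \<xi> (P v g) \<le> 2 * c * ((norm g)\<^sup>2 * (norm \<xi>)\<^sup>2) + 8 * c * ((norm g)\<^sup>2 * (norm \<xi>)\<^sup>2)"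
    unfolding moment_form_variance using variance_P_le[OF rp u v g, of \<xi>]
    by (intro add_mono) (simp_all add: c_def)
  also have "\<dots> = (smoothing_const * sqrt u / v * norm g * norm \<xi>)\<^sup>2"
    using kernel_moment_nonneg u by (simp add: smoothing_const_def c_def power_mult_distrib power_divide)
  finally show "moment_form u \<xi> (P v g) \<le> (smoothing_const * sqrt u / v * norm g * norm \<xi>)\<^sup>2" .
qed (use u v kernel_moment_nonneg in \<open>simp add: smoothing_const_def\<close>)

text \<open>Summing over the dyadic scales above \<open>v\<close>, from \<open>P\<^sub>v f = P\<^sub>v (f - P\<^sub>v f) + P\<^sub>2\<^sub>v f\<close>; the
  remainder at the largest scale is negligible because of the factor \<open>1/v\<close>.\<close>

lemma moment_seminorm_P_lipschitz:
  assumes rp: reverse_poincare and u: "0 < u" and f: "f \<in> M" and \<alpha>: "0 < \<alpha>" "\<alpha> < 1" and L: "0 \<le> L"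
    and lip: "\<And>v. 0 < v \<Longrightarrow> norm (f - P v f) \<le> L * v powr \<alpha>" and v: "0 < v"
  shows "sqrt (moment_form u \<xi> (P v f))
    \<le> smoothing_const * sqrt u * norm \<xi> * L / (1 - 2 powr (\<alpha> - 1)) * v powr (\<alpha> - 1)"
proof -
  define N where "N g = sqrt (moment_form u \<xi> g)" for g
  define c where "c = smoothing_const * sqrt u * norm \<xi>"
  define q where "q = 2 powr (\<alpha> - 1)"
  have c: "0 \<le> c" using u kernel_moment_nonneg by (simp add: c_def smoothing_const_def)
  have q: "0 < q" "q < 1"
  proof -
    show "q < 1" unfolding q_def using \<alpha> powr_less_mono[of "\<alpha> - 1" 0 2] by simp
  qed (simp add: q_def)
  have u0: "0 \<le> u" using u by simp
  have smooth: "N (P v g) \<le> c / v * norm g" if "0 < v" "g \<in> M" for v g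
    using moment_seminorm_P_le[OF rp u that, of \<xi>] by (simp add: N_def c_def mult_ac)
  have step: "N (P v f) \<le> c * L * v powr (\<alpha> - 1) + N (P (2 * v) f)" if v: "0 < v" for v
  proof -
    have m: "f - P v f \<in> M" "P (2 * v) f \<in> M" using f v by simp_all
    have "P v f = P v (f - P v f) + P (2 * v) f"
      unfolding P_diff[OF v f P_M[OF f v]] P_semigroup[OF v v f] mult_2 by simp
    then have "N (P v f) = N (P v (f - P v f) + P (2 * v) f)" by (rule arg_cong)
    also have "\<dots> \<le> N (P v (f - P v f)) + N (P (2 * v) f)"
      unfolding N_def by (rule moment_seminorm_triangle[OF u0 P_M[OF m(1) v] m(2)])
    also have "N (P v (f - P v f)) \<le> c / v * (L * v powr \<alpha>)"
      using smooth[OF v m(1)] mult_left_mono[OF lip[OF v], of "c / v"] c v by simp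
    also have "c / v * (L * v powr \<alpha>) = c * L * v powr (\<alpha> - 1)"
      using v by (simp add: powr_diff)
    finally show ?thesis by (simp only: add_right_mono)
  qed
  have sum: "N (P v f) \<le> c * L / (1 - q) * v powr (\<alpha> - 1) + N (P (2 ^ J * v) f)" if "0 < v" for v J
    using that
  proof (induction J arbitrary: v)
    case 0
    then show ?case using c L q by simp
  next
    case (Suc J)
    have "N (P v f) \<le> c * L * v powr (\<alpha> - 1) + N (P (2 * v) f)" by (rule step[OF Suc.prems])
    also have "N (P (2 * v) f) \<le> c * L / (1 - q) * (2 * v) powr (\<alpha> - 1) + N (P (2 ^ J * (2 * v)) f)"
      using Suc.prems by (intro Suc.IH) simp
    also have "(2 * v) powr (\<alpha> - 1) = q * v powr (\<alpha> - 1)"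
      using Suc.prems by (simp add: q_def powr_mult)
    also have "c * L * v powr (\<alpha> - 1) + (c * L / (1 - q) * (q * v powr (\<alpha> - 1)) + N (P (2 ^ J * (2 * v)) f))
        = c * L / (1 - q) * v powr (\<alpha> - 1) + N (P (2 ^ Suc J * v) f)"
      using q by (simp add: field_simps)
    finally show ?case by simp
  qed
  have "N (P v f) \<le> c * L / (1 - q) * v powr (\<alpha> - 1) + 0"
  proof (rule LIMSEQ_le_const[OF tendsto_add[OF tendsto_const]])
    have "(\<lambda>J. c * norm f / v * (1 / 2) ^ J) \<longlonglongrightarrow> c * norm f / v * 0"
      by (intro tendsto_intros LIMSEQ_power_zero) simp
    then have lim: "(\<lambda>J. c * norm f / v * (1 / 2) ^ J) \<longlonglongrightarrow> 0" by simp
    show "(\<lambda>J. c * norm f / v * (1 / 2) ^ J) \<longlonglongrightarrow> 0" by (rule lim)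
    have "N (P v f) \<le> c * L / (1 - q) * v powr (\<alpha> - 1) + c * norm f / v * (1 / 2) ^ J" for J
    proof -
      have "N (P (2 ^ J * v) f) \<le> c / (2 ^ J * v) * norm f" using v f by (intro smooth) auto
      also have "\<dots> = c * norm f / v * (1 / 2) ^ J" by (simp add: power_divide)
      finally show ?thesis using sum[OF v, of J] by simp
    qed
    then show "\<exists>N'. \<forall>J\<ge>N'. N (P v f) \<le> c * L / (1 - q) * v powr (\<alpha> - 1) + c * norm f / v * (1 / 2) ^ J"
      by blast
  qed
  then show ?thesis by (simp add: N_def c_def q_def)
qed

text \<open>The scale \<open>v = \<surd>u\<close> balances the trivial bound for \<open>f - P\<^sub>v f\<close> with the smoothing bound for \<open>P\<^sub>v f\<close>.\<close>

lemma moment_form_lipschitz: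
  assumes rp: reverse_poincare and u: "0 < u" and f: "f \<in> M" and \<alpha>: "0 < \<alpha>" "\<alpha> < 1" and L: "0 \<le> L"
    and lip: "\<And>v. 0 < v \<Longrightarrow> norm (f - P v f) \<le> L * v powr \<alpha>"
  shows "moment_form u \<xi> f \<le> (3 + smoothing_const / (1 - 2 powr (\<alpha> - 1)))\<^sup>2 * L\<^sup>2 * u powr \<alpha> * (norm \<xi>)\<^sup>2"
proof -
  define K where "K = smoothing_const / (1 - 2 powr (\<alpha> - 1))"
  define v where "v = sqrt u"
  have v: "0 < v" using u by (simp add: v_def)
  have u0: "0 \<le> u" using u by simp
  have m: "f - P v f \<in> M" "P v f \<in> M" using f v by simp_all
  have "sqrt (moment_form u \<xi> f) \<le> sqrt (moment_form u \<xi> (f - P v f)) + sqrt (moment_form u \<xi> (P v f))"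
    using moment_seminorm_triangle[OF u0 m, of \<xi>] by simp
  also have "\<dots> \<le> 3 * (L * v powr \<alpha>) * norm \<xi> + K * (L * v powr \<alpha>) * norm \<xi>"
  proof (rule add_mono)
    show "sqrt (moment_form u \<xi> (f - P v f)) \<le> 3 * (L * v powr \<alpha>) * norm \<xi>"
      using moment_seminorm_le[OF u0 m(1), of \<xi>] mult_right_mono[OF lip[OF v], of "3 * norm \<xi>"] by (simp add: mult_ac)
    have "sqrt u * v powr (\<alpha> - 1) = v powr \<alpha>" using v by (simp add: v_def[symmetric] powr_diff)
    then have "smoothing_const * sqrt u * norm \<xi> * L / (1 - 2 powr (\<alpha> - 1)) * v powr (\<alpha> - 1) = K * (L * v powr \<alpha>) * norm \<xi>"
      by (simp add: K_def mult_ac)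
    then show "sqrt (moment_form u \<xi> (P v f)) \<le> K * (L * v powr \<alpha>) * norm \<xi>"
      using moment_seminorm_P_lipschitz[OF rp u f \<alpha> L lip v, of \<xi>] by simp
  qed
  also have "\<dots> = (3 + K) * L * v powr \<alpha> * norm \<xi>" by (simp add: algebra_simps)
  finally have "(sqrt (moment_form u \<xi> f))\<^sup>2 \<le> ((3 + K) * L * v powr \<alpha> * norm \<xi>)\<^sup>2"
    using u0 f by (intro power_mono) (auto simp: moment_form_nonneg)
  then have "moment_form u \<xi> f \<le> (3 + K)\<^sup>2 * L\<^sup>2 * (v powr \<alpha>)\<^sup>2 * (norm \<xi>)\<^sup>2"
    using moment_form_nonneg[OF u0 f] by (simp add: power_mult_distrib)
  also have "(v powr \<alpha>)\<^sup>2 = u powr \<alpha>"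
  proof -
    have "(v powr \<alpha>)\<^sup>2 = (v * v) powr \<alpha>" using v by (simp add: power2_eq_square powr_mult)
    then show ?thesis using u by (simp add: v_def)
  qed
  finally show ?thesis by (simp add: K_def)
qed

section \<open>Little Campanato spaces\<close>

lemma P_variance_self_adjoint:
  assumes t: "0 < t" and f: "f \<in> M"
  shows "is_adjoint (P t (abs_sq f) - abs_sq (P t f)) (P t (abs_sq f) - abs_sq (P t f))"
proof -
  have m: "P t (abs_sq f) - abs_sq (P t f) \<in> M" using t f by simp
  have "adj (P t (abs_sq f) - abs_sq (P t f)) = P t (abs_sq f) - abs_sq (P t f)"
    using t f by (simp add: adj_diff adj_compose P_adj[symmetric])
  then show ?thesis using is_adjoint_adj[OF m] by simp
qed

lemma P_variance_form:
  assumes t: "0 < t" and f: "f \<in> M"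
  shows "Re (cinner \<xi> (blinfun_apply (P t (abs_sq f) - abs_sq (P t f)) \<xi>))
    = Re (cinner \<xi> (blinfun_apply (P t (abs_sq f)) \<xi>)) - (norm (blinfun_apply (P t f) \<xi>))\<^sup>2"
  using cinner_abs_sq[OF P_M[OF f t], of \<xi>] by (simp add: blinfun.diff_left cinner_simps)

text \<open>Oscillation is controlled by variance: with \<open>Q = 2 P\<^sub>t - P\<^sub>2\<^sub>t\<close> the operator \<open>P\<^sub>t\<close> is
  the midpoint of \<open>P\<^sub>2\<^sub>t\<close> and \<open>Q\<close>, and the Schwarz inequality applies to both.\<close>

lemma P_oscillation_le_variance:
  assumes t: "0 < t" and f: "f \<in> M"
  shows "norm (P t (f - P t f)) \<le> sqrt (norm (P t (abs_sq f) - abs_sq (P t f)))"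
proof (rule norm_blinfun_bound)
  fix \<xi>
  interpret Q: ucp_map M "\<lambda>x. 2 *\<^sub>R P t x - P (2 * t) x" by (rule doubled_difference_ucp[OF t])
  interpret D: ucp_map M "P (2 * t)" using t by (intro P_ucp) simp
  let ?V = "P t (abs_sq f) - abs_sq (P t f)"
  define p d where "p = blinfun_apply (P t f) \<xi>" and "d = blinfun_apply (P (2 * t) f) \<xi>"
  have Q: "(norm (2 *\<^sub>R p - d))\<^sup>2 \<le> 2 * Re (cinner \<xi> (blinfun_apply (P t (abs_sq f)) \<xi>)) - Re (cinner \<xi> (blinfun_apply (P (2 * t) (abs_sq f)) \<xi>))"
    using Q.schwarz[OF f, of \<xi>] by (simp add: blinfun.diff_left blinfun.scaleR_left cinner_simps p_def d_def)
  have D: "(norm d)\<^sup>2 \<le> Re (cinner \<xi> (blinfun_apply (P (2 * t) (abs_sq f)) \<xi>))"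
    using D.schwarz[OF f, of \<xi>] by (simp add: d_def)
  have "(norm (2 *\<^sub>R p - d))\<^sup>2 + (norm d)\<^sup>2 = 2 * (norm p)\<^sup>2 + 2 * (norm (p - d))\<^sup>2"
    by (simp add: norm_diff_sq cinner_simps power_mult_distrib)
  then have "(norm (p - d))\<^sup>2 \<le> Re (cinner \<xi> (blinfun_apply ?V \<xi>))"
    using Q D unfolding P_variance_form[OF t f] p_def[symmetric] by linarith
  also have "\<dots> \<le> norm \<xi> * norm (blinfun_apply ?V \<xi>)" using Re_cinner_le_norm abs_le_D1 by blast
  also have "\<dots> \<le> norm \<xi> * (norm ?V * norm \<xi>)" by (intro mult_left_mono norm_blinfun) simp
  also have "\<dots> = (sqrt (norm ?V) * norm \<xi>)\<^sup>2" by (simp add: power_mult_distrib power2_eq_square)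
  finally have "norm (p - d) \<le> sqrt (norm ?V) * norm \<xi>" by (rule power2_le_imp_le) simp
  moreover have "blinfun_apply (P t (f - P t f)) \<xi> = p - d"
    unfolding P_diff[OF t f P_M[OF f t]] P_semigroup[OF t t f] p_def d_def mult_2 blinfun.diff_left ..
  ultimately show "norm (blinfun_apply (P t (f - P t f)) \<xi>) \<le> sqrt (norm ?V) * norm \<xi>" by simp
qed simp

text \<open>A variance is at most a second moment about any other point: about \<open>f\<close> it exceeds the variance under
  \<open>P\<^sub>t\<close> by \<open>\<bar>P\<^sub>t f - f\<bar>\<^sup>2\<close>, and it is the mean of \<open>moment_form\<close> over \<open>u\<close>. The bound \<open>u\<^sup>\<alpha>\<close> for the latter integrates
  to a multiple of \<open>t\<^sup>2\<^sup>\<alpha>\<close>.\<close>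

lemma P_variance_le_lipschitz:
  assumes rp: reverse_poincare and f: "f \<in> M" and \<alpha>: "0 < \<alpha>" "\<alpha> < 1 / 2" and L: "0 \<le> L"
    and lip: "\<And>v. 0 < v \<Longrightarrow> norm (f - P v f) \<le> L * v powr \<alpha>" and t: "0 < t"
  shows "sqrt (norm (P t (abs_sq f) - abs_sq (P t f)))
    \<le> (3 + smoothing_const / (1 - 2 powr (\<alpha> - 1))) * sqrt (\<integral>r. r powr \<alpha> \<partial>subordinator 1) * L * t powr \<alpha>"
proof -
  interpret prob_space "subordinator t" by (rule prob_space_subordinator[OF t])
  define K where "K = 3 + smoothing_const / (1 - 2 powr (\<alpha> - 1))"
  define m\<alpha> where "m\<alpha> = (\<integral>r. r powr \<alpha> \<partial>subordinator 1)"
  have m\<alpha>: "0 \<le> m\<alpha>" unfolding m\<alpha>_def by (rule integral_nonneg_AE) simp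
  have K: "0 \<le> K"
  proof -
    have "2 powr (\<alpha> - 1) < 1" using \<alpha> powr_less_mono[of "\<alpha> - 1" 0 2] by simp
    then show ?thesis unfolding K_def smoothing_const_def using kernel_moment_nonneg
      by (intro add_nonneg_nonneg divide_nonneg_nonneg) auto
  qed
  let ?V = "P t (abs_sq f) - abs_sq (P t f)"
  have "norm ?V \<le> K\<^sup>2 * L\<^sup>2 * m\<alpha> * t powr (2 * \<alpha>)"
  proof (rule op_norm_le_of_form[OF P_variance_self_adjoint[OF t f]])
    show "0 \<le> K\<^sup>2 * L\<^sup>2 * m\<alpha> * t powr (2 * \<alpha>)" using m\<alpha> by simp
    fix \<xi>
    show "0 \<le> Re (cinner \<xi> (blinfun_apply ?V \<xi>))"
      unfolding P_variance_form[OF t f] using ucp_map.schwarz[OF P_ucp[OF t] f, of \<xi>] by simp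
    let ?n = "\<lambda>u. cinner \<xi> (blinfun_apply (T \<bar>u\<bar> (abs_sq f)) \<xi>)"
      and ?o = "\<lambda>u. cinner (blinfun_apply f \<xi>) (blinfun_apply (T \<bar>u\<bar> f) \<xi>)"
    have ff: "abs_sq f \<in> M" using f by simp
    have n: "integrable (subordinator t) ?n" and o: "integrable (subordinator t) ?o"
      by (rule orbit_integrable[OF normal_functional_vector _ t], fact)+
    have P1: "Re (cinner \<xi> (blinfun_apply (P t (abs_sq f)) \<xi>)) = (\<integral>u. Re (?n u) \<partial>subordinator t)"
      using P_integral[OF ff t normal_functional_vector, of \<xi> \<xi>] n by simp
    have P2: "Re (cinner (blinfun_apply f \<xi>) (blinfun_apply (P t f) \<xi>)) = (\<integral>u. Re (?o u) \<partial>subordinator t)"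
      using P_integral[OF f t normal_functional_vector, of "blinfun_apply f \<xi>" \<xi>] o by simp
    have "Re (cinner \<xi> (blinfun_apply ?V \<xi>)) \<le> Re (cinner \<xi> (blinfun_apply ?V \<xi>))
        + (norm (blinfun_apply (P t f) \<xi> - blinfun_apply f \<xi>))\<^sup>2" by simp
    also have "\<dots> = Re (cinner \<xi> (blinfun_apply (P t (abs_sq f)) \<xi>))
        - 2 * Re (cinner (blinfun_apply f \<xi>) (blinfun_apply (P t f) \<xi>)) + (norm (blinfun_apply f \<xi>))\<^sup>2"
      unfolding P_variance_form[OF t f] by (simp add: norm_diff_sq Re_cinner_commute)
    also have "\<dots> = (\<integral>u. moment_form \<bar>u\<bar> \<xi> f \<partial>subordinator t)"
      unfolding P1 P2 moment_form_def using n o prob_space by simp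
    also have "\<dots> \<le> (\<integral>u. K\<^sup>2 * L\<^sup>2 * (norm \<xi>)\<^sup>2 * u powr \<alpha> \<partial>subordinator t)"
    proof (rule integral_mono_AE)
      show "integrable (subordinator t) (\<lambda>u. moment_form \<bar>u\<bar> \<xi> f)"
        unfolding moment_form_def using n o by simp
      show "integrable (subordinator t) (\<lambda>u. K\<^sup>2 * L\<^sup>2 * (norm \<xi>)\<^sup>2 * u powr \<alpha>)"
        using subordinator_moment(1)[OF t, of \<alpha>] \<alpha> by simp
      show "AE u in subordinator t. moment_form \<bar>u\<bar> \<xi> f \<le> K\<^sup>2 * L\<^sup>2 * (norm \<xi>)\<^sup>2 * u powr \<alpha>"
        using AE_subordinator_pos[OF t]
      proof eventually_elim
        case (elim u)
        have "moment_form u \<xi> f \<le> K\<^sup>2 * L\<^sup>2 * u powr \<alpha> * (norm \<xi>)\<^sup>2"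
          unfolding K_def using \<alpha> by (intro moment_form_lipschitz[OF rp elim f _ _ L lip]) auto
        then show ?case using elim by (simp add: mult_ac)
      qed
    qed
    also have "\<dots> = K\<^sup>2 * L\<^sup>2 * m\<alpha> * t powr (2 * \<alpha>) * (norm \<xi>)\<^sup>2"
      using subordinator_moment(2)[OF t, of \<alpha>] \<alpha> by (simp add: m\<alpha>_def mult_ac)
    finally show "Re (cinner \<xi> (blinfun_apply ?V \<xi>)) \<le> K\<^sup>2 * L\<^sup>2 * m\<alpha> * t powr (2 * \<alpha>) * (norm \<xi>)\<^sup>2" .
  qed
  also have "\<dots> = (K * sqrt m\<alpha> * L * t powr \<alpha>)\<^sup>2"
  proof -
    have "t powr (2 * \<alpha>) = (t powr \<alpha>)\<^sup>2" by (simp add: power2_eq_square powr_add[symmetric])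
    then show ?thesis using m\<alpha> by (simp add: power_mult_distrib)
  qed
  finally have "sqrt (norm ?V) \<le> K * sqrt m\<alpha> * L * t powr \<alpha>"
    using K m\<alpha> L by (intro real_le_lsqrt) auto
  then show ?thesis by (simp add: K_def m\<alpha>_def)
qed

theorem little_norm_adjoint:
  assumes rp: reverse_poincare and \<alpha>: "0 < \<alpha>" "\<alpha> < 1 / 2"
  shows "\<exists>C\<ge>1. \<forall>f\<in>M. little_norm_c \<alpha> P (adj f) \<le> ennreal C * little_norm_c \<alpha> P f"
proof -
  define K where "K = (3 + smoothing_const / (1 - 2 powr (\<alpha> - 1))) * sqrt (\<integral>r. r powr \<alpha> \<partial>subordinator 1)"
  define C where "C = max 1 (K / (2 powr \<alpha> - 1))"
  have "little_norm_c \<alpha> P (adj f) \<le> ennreal C * little_norm_c \<alpha> P f" if f: "f \<in> M" for f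
    unfolding little_norm_c_def norm_adj[OF f]
  proof (rule seminorm_sum_transfer)
    fix B t :: real
    assume B: "0 \<le> B" and bound: "\<And>t. 0 < t \<Longrightarrow> sqrt (norm (P t (abs_sq f) - abs_sq (P t f))) \<le> B * t powr \<alpha>"
      and t: "0 < t"
    define L where "L = B / (2 powr \<alpha> - 1)"
    have "1 < 2 powr \<alpha>" using \<alpha> by simp
    then have L: "0 \<le> L" using B unfolding L_def by (intro divide_nonneg_nonneg) auto
    have lip: "norm (f - P v f) \<le> L * v powr \<alpha>" if v: "0 < v" for v
    proof -
      have "norm (P s ((\<Delta> s ^^ 1) f)) \<le> B * s powr \<alpha>" if s: "0 < s" for s
        using order_trans[OF P_oscillation_le_variance[OF s f] bound[OF s]] by simp
      from \<Delta>_power_norm_le[OF \<alpha>(1) f B this _ v] show ?thesis by (simp add: L_def)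
    qed
    have "norm (adj f - P v (adj f)) \<le> L * v powr \<alpha>" if v: "0 < v" for v
    proof -
      have "adj f - P v (adj f) = adj (f - P v f)" using f v by (simp add: adj_diff P_adj)
      then show ?thesis using lip[OF v] f v by (simp add: norm_adj)
    qed
    from P_variance_le_lipschitz[OF rp adj_M[OF f] \<alpha> L this t]
    have "sqrt (norm (P t (abs_sq (adj f)) - abs_sq (P t (adj f)))) \<le> K * L * t powr \<alpha>"
      by (simp only: K_def)
    also have "\<dots> = K / (2 powr \<alpha> - 1) * (B * t powr \<alpha>)" by (simp add: L_def)
    also have "\<dots> \<le> C * (B * t powr \<alpha>)" unfolding C_def using B by (intro mult_right_mono) auto
    finally show "sqrt (norm (P t (abs_sq (adj f)) - abs_sq (P t (adj f)))) \<le> C * B * t powr \<alpha>"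
      by (simp add: mult.assoc)
  qed (auto simp: C_def)
  moreover have "1 \<le> C" by (simp add: C_def)
  ultimately show ?thesis by blast
qed

end

theorem theorem1p1:
  fixes M :: "'h::chilbert_space op set"
    and \<tau> :: "'h op \<Rightarrow> complex"
    and T P :: "real \<Rightarrow> 'h op \<Rightarrow> 'h op"
  assumes "von_neumann_algebra M"
    and "nff_trace M \<tau>"
    and "markov_semigroup M \<tau> T"
    and "P = poisson_semigroup M T"
  shows "(\<forall>\<alpha>::real. 0 < \<alpha> \<and> \<alpha> < 2 \<longrightarrow>
           campanato_c M \<alpha> P = campanato_r M \<alpha> P \<and>
           campanato_r M \<alpha> P = campanato_cr M \<alpha> P \<and>
           equivalent_norms_on (campanato_cr M \<alpha> P)
             (campanato_norm_c \<alpha> P) (campanato_norm_r \<alpha> P) \<and>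
           equivalent_norms_on (campanato_cr M \<alpha> P)
             (campanato_norm_r \<alpha> P) (campanato_norm_cr \<alpha> P)) \<and>
         ((\<forall>s>0. \<forall>f\<in>M. T s f \<in> gen_dom M T) \<and> gamma2_nonneg M T \<longrightarrow>
         (\<forall>\<alpha>::real. 0 < \<alpha> \<and> \<alpha> < 1/2 \<longrightarrow>
           little_campanato_c M \<alpha> P = little_campanato_r M \<alpha> P \<and>
           little_campanato_r M \<alpha> P = little_campanato_cr M \<alpha> P \<and>
           equivalent_norms_on (little_campanato_cr M \<alpha> P)
             (little_norm_c \<alpha> P) (little_norm_r \<alpha> P) \<and>
           equivalent_norms_on (little_campanato_cr M \<alpha> P)
             (little_norm_r \<alpha> P) (little_norm_cr \<alpha> P)))"
proof -
  interpret markov M \<tau> T by unfold_locales (fact assms)+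
  have P: "P = markov.P M T"
    by (simp add: P_def assms(4))
  show ?thesis
  proof (intro conjI allI impI; (elim conjE)?)
    fix \<alpha> :: real assume \<alpha>: "0 < \<alpha>" "\<alpha> < 2"
    obtain C where C: "1 \<le> C" "\<And>f. f \<in> M \<Longrightarrow> campanato_norm_c \<alpha> P (adj f) \<le> ennreal C * campanato_norm_c \<alpha> P f"
      using campanato_norm_adjoint[OF \<alpha>(1)] unfolding P by (meson max.cobounded1)
    note comparison = adjoint_comparison[of C "campanato_norm_c \<alpha> P", OF C(1)]
    have sub: "campanato_cr M \<alpha> P \<subseteq> M" by (auto simp: campanato_cr_def campanato_c_def)
    show eq: "campanato_c M \<alpha> P = campanato_r M \<alpha> P"
      using comparison(1)[OF C(2)] by (simp add: campanato_c_def campanato_r_def campanato_norm_r_def)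
    show "campanato_r M \<alpha> P = campanato_cr M \<alpha> P"
      by (simp add: campanato_cr_def eq)
    show "equivalent_norms_on (campanato_cr M \<alpha> P) (campanato_norm_c \<alpha> P) (campanato_norm_r \<alpha> P)"
      using comparison(2)[OF C(2) sub] by (simp add: campanato_norm_r_def[abs_def])
    show "equivalent_norms_on (campanato_cr M \<alpha> P) (campanato_norm_r \<alpha> P) (campanato_norm_cr \<alpha> P)"
      using comparison(3)[OF C(2) sub] by (simp add: campanato_norm_r_def[abs_def] campanato_norm_cr_def[abs_def])
  next
    fix \<alpha> :: real
    assume "\<forall>s>0. \<forall>f\<in>M. T s f \<in> gen_dom M T" "gamma2_nonneg M T" and \<alpha>: "0 < \<alpha>" "\<alpha> < 1 / 2"
    then have rp: reverse_poincare
      by (intro gamma2_reverse_poincare) (auto simp: dom_regular_def)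
    obtain C where C: "1 \<le> C" "\<And>f. f \<in> M \<Longrightarrow> little_norm_c \<alpha> P (adj f) \<le> ennreal C * little_norm_c \<alpha> P f"
      using little_norm_adjoint[OF rp \<alpha>] unfolding P by blast
    note comparison = adjoint_comparison[of C "little_norm_c \<alpha> P", OF C(1)]
    have sub: "little_campanato_cr M \<alpha> P \<subseteq> M" by (auto simp: little_campanato_cr_def)
    show eq: "little_campanato_c M \<alpha> P = little_campanato_r M \<alpha> P"
      using comparison(1)[OF C(2)] by (simp add: little_campanato_c_def little_campanato_r_def little_norm_r_def)
    then show "little_campanato_r M \<alpha> P = little_campanato_cr M \<alpha> P"
      by (auto simp: little_campanato_c_def little_campanato_r_def little_campanato_cr_def little_norm_cr_def set_eq_iff)
    show "equivalent_norms_on (little_campanato_cr M \<alpha> P) (little_norm_c \<alpha> P) (little_norm_r \<alpha> P)"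
      using comparison(2)[OF C(2) sub] by (simp add: little_norm_r_def[abs_def])
    show "equivalent_norms_on (little_campanato_cr M \<alpha> P) (little_norm_r \<alpha> P) (little_norm_cr \<alpha> P)"
      using comparison(3)[OF C(2) sub] by (simp add: little_norm_r_def[abs_def] little_norm_cr_def[abs_def])
  qed
qed

end
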